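(* Let $(S,T)$ be a closed triangulated connected surface with set of edges $E$, and let $h\in\mathbb{R}$ be arbitrary. (1) If $l,l':E\to\mathbb{R}_{>0}$ are (edge length functions of) two Euclidean polyhedral metrics on $(S,T)$ having the same $\phi_h$ curvature, i.e. $\phi_h(e)$ is the same for $l$ and $l'$ for every $e\in E$, then the two metrics agree up to isometry and scaling: there is $\lambda>0$ with $l'=\lambda l$. (2) If $l,l':E\to\mathbb{R}_{>0}$ are two spherical polyhedral metrics on $(S,T)$ having the same $\phi_h$ curvature, then the two metrics agree up to isometry: $l=l'$. (3) If $l,l':E\to\mathbb{R}_{>0}$ are two hyperbolic polyhedral metrics on $(S,T)$ having the same $\psi_h$ curvature, then the two metrics agree up to isometry: $l=l'$.
   Context: Let $K^2$ be the Euclidean plane $\mathbb{E}^2$, the unit sphere $\mathbb{S}^2$, or the hyperbolic plane $\mathbb{H}^2$ (curvature $0$, $1$, $-1$). For a closed triangulated surface $(S,T)$ with triangulation $T$ and set of edges $E$, a $K^2$ polyhedral metric (called Euclidean, spherical or hyperbolic respectively) on $(S,T)$ is given by its edge length function $l:E\to\mathbb{R}_{>0}$ such that whenever $e_i,e_j,e_k$ are the three edges of a triangle of $T$, $l(e_i)+l(e_j)>l(e_k)$ (for all permutations), and, if $K^2=\mathbb{S}^2$, additionally $l(e_i)+l(e_j)+l(e_k)<2\pi$. Each triangle of $T$ is then realized as the geodesic triangle in $K^2$ with these edge lengths, and inner angles are those of these triangles. Two polyhedral metrics on $(S,T)$ are identified up to isometry when their edge length functions coincide. Each edge $e$ lies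 in two triangles. Let $a,a'$ be the inner angles facing (opposite to) $e$ in these two triangles; let $b,c$ be the two inner angles adjacent to $e$ in the triangle containing $a$, and $b',c'$ the two inner angles adjacent to $e$ in the triangle containing $a'$. For $h\in\mathbb{R}$ the curvatures $\phi_h,\psi_h:E\to\mathbb{R}$ of the metric are $$\phi_h(e)=\int_{\pi/2}^{a}\sin^h(t)\,dt+\int_{\pi/2}^{a'}\sin^h(t)\,dt,$$ $$\psi_h(e)=\int_0^{\frac{b+c-a}{2}}\cos^h(t)\,dt+\int_0^{\frac{b'+c'-a'}{2}}\cos^h(t)\,dt.$$ *)

theory Defs
  imports "HOL-Analysis.Analysis"
begin

section \<open>Closed triangulated surfaces\<close>

text \<open>
  A triangulation is the combinatorial pattern by which a finite disjoint union of triangles is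
  glued along its sides in pairs. The corners of a triangle are indexed by the
  three-element type \<open>3\<close> (arithmetic modulo 3), and side \<open>i\<close> is the side opposite to corner \<open>i\<close>;
  thus the other two corners, which are the ends of side \<open>i\<close>, are \<open>i + 1\<close> and \<open>i + 2\<close>.

  \<open>side_edge t f i\<close> is the edge of the triangulation of which side \<open>i\<close> of the triangle \<open>f\<close> is a copy.
  \<open>side_start t f i\<close> is the corner of \<open>f\<close> at the start of that side for an orientation
  of the edge; it determines which ends of the two sides are glued to each other.

  Two sides of the same triangle may be copies of the same edge, and two triangles may share more
  than one edge. Simplicial complexes are the special case where this does not occur.
\<close>

record ('f, 'e) triangulation =
  faces :: "'f set"
  side_edge :: "'f \<Rightarrow> 3 \<Rightarrow> 'e"
  side_start :: "'f \<Rightarrow> 3 \<Rightarrow> 3"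

definition edges :: "('f, 'e) triangulation \<Rightarrow> 'e set" where
  "edges t = {side_edge t f i | f i. f \<in> faces t}"

definition sides_of :: "('f, 'e) triangulation \<Rightarrow> 'e \<Rightarrow> ('f \<times> 3) set" where
  "sides_of t e = {(f, i). f \<in> faces t \<and> side_edge t f i = e}"

definition standard_triangle :: "(real^3) set" where
  "standard_triangle = {x. (\<forall>i. 0 \<le> x $ i) \<and> (\<Sum>i\<in>UNIV. x $ i) = 1}"

definition disjoint_triangles :: "('f, 'e) triangulation \<Rightarrow> ('f \<times> (real^3)) topology" where
  "disjoint_triangles t =
     prod_topology (discrete_topology (faces t)) (top_of_set standard_triangle)"

text \<open>
  A point of a side is determined by its barycentric coordinate at the start of the side, so the
  following relation identifies the copies of an edge by affine homeomorphisms.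
\<close>

definition glued :: "('f, 'e) triangulation \<Rightarrow> (('f \<times> (real^3)) \<times> ('f \<times> (real^3))) set" where
  "glued t = {((f, x), (g, y)).
     f \<in> faces t \<and> x \<in> standard_triangle \<and> g \<in> faces t \<and> y \<in> standard_triangle \<and>
     (\<exists>i j. x $ i = 0 \<and> y $ j = 0 \<and> side_edge t f i = side_edge t g j \<and>
            x $ side_start t f i = y $ side_start t g j)}"

text \<open>
  \<open>S\<close> is the quotient of the disjoint union of the triangles by the equivalence relation generated
  by the gluing. Since every edge has exactly two sides, such a quotient is
  always a compact surface without boundary.
\<close>

definition closed_triangulated_surface ::
    "'a topology \<Rightarrow> ('f, 'e) triangulation \<Rightarrow> bool" where
  "closed_triangulated_surface S t \<longleftrightarrow>
     finite (faces t) \<and> faces t \<noteq> {} \<and>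
     (\<forall>e\<in>edges t. card (sides_of t e) = 2) \<and>
     (\<forall>f\<in>faces t. \<forall>i. side_start t f i \<noteq> i) \<and>
     (\<exists>q. quotient_map (disjoint_triangles t) S q \<and>
          (\<forall>p\<in>topspace (disjoint_triangles t). \<forall>p'\<in>topspace (disjoint_triangles t).
             q p = q p' \<longleftrightarrow> (p, p') \<in> (glued t)\<^sup>*))"

section \<open>The three planes\<close>

text \<open>\<open>pangle p q r\<close> is the angle at \<open>p\<close> between the geodesics from \<open>p\<close> to \<open>q\<close> and from \<open>p\<close> to \<open>r\<close>.\<close>

record 'p plane =
  points :: "'p set"
  pdist :: "'p \<Rightarrow> 'p \<Rightarrow> real"
  pangle :: "'p \<Rightarrow> 'p \<Rightarrow> 'p \<Rightarrow> real"

definition vangle :: "'v::real_inner \<Rightarrow> 'v \<Rightarrow> real" where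
  "vangle u v = arccos ((u \<bullet> v) / (norm u * norm v))"

definition E2 :: "(real^2) plane" where
  "E2 = \<lparr>points = UNIV,
         pdist = dist,
         pangle = (\<lambda>p q r. vangle (q - p) (r - p))\<rparr>"

text \<open>
  \<open>q - (p \<bullet> q) *\<^sub>R p\<close> is the orthogonal projection of \<open>q\<close> to the tangent plane at \<open>p\<close>. It is a positive
  multiple of the initial velocity of the geodesic from \<open>p\<close> to \<open>q\<close> if \<open>q \<noteq> p\<close> and \<open>q \<noteq> - p\<close>.
\<close>

definition S2 :: "(real^3) plane" where
  "S2 = \<lparr>points = {x. norm x = 1},
         pdist = (\<lambda>p q. arccos (p \<bullet> q)),
         pangle = (\<lambda>p q r. vangle (q - (p \<bullet> q) *\<^sub>R p) (r - (p \<bullet> r) *\<^sub>R p))\<rparr>"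

text \<open>The hyperbolic plane is the hyperboloid model, with the metric induced by the Lorentz form.\<close>

definition lorentz :: "real^3 \<Rightarrow> real^3 \<Rightarrow> real" where
  "lorentz x y = x $ 1 * y $ 1 + x $ 2 * y $ 2 - x $ 3 * y $ 3"

definition lorentz_angle :: "real^3 \<Rightarrow> real^3 \<Rightarrow> real" where
  "lorentz_angle u v = arccos (lorentz u v / (sqrt (lorentz u u) * sqrt (lorentz v v)))"

definition H2 :: "(real^3) plane" where
  "H2 = \<lparr>points = {x. lorentz x x = -1 \<and> x $ 3 > 0},
         pdist = (\<lambda>p q. arcosh (- lorentz p q)),
         pangle = (\<lambda>p q r.
           lorentz_angle (q + lorentz p q *\<^sub>R p) (r + lorentz p r *\<^sub>R p))\<rparr>"

section \<open>Polyhedral metrics and their curvatures\<close>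

definition triangle_metric :: "('f, 'e) triangulation \<Rightarrow> ('e \<Rightarrow> real) \<Rightarrow> bool" where
  "triangle_metric t l \<longleftrightarrow>
     (\<forall>e\<in>edges t. 0 < l e) \<and>
     (\<forall>f\<in>faces t. \<forall>i.
        l (side_edge t f i) < l (side_edge t f (i + 1)) + l (side_edge t f (i + 2)))"

definition euclidean_polyhedral_metric :: "('f, 'e) triangulation \<Rightarrow> ('e \<Rightarrow> real) \<Rightarrow> bool" where
  "euclidean_polyhedral_metric t l \<longleftrightarrow> triangle_metric t l"

definition spherical_polyhedral_metric :: "('f, 'e) triangulation \<Rightarrow> ('e \<Rightarrow> real) \<Rightarrow> bool" where
  "spherical_polyhedral_metric t l \<longleftrightarrow>
     triangle_metric t l \<and> (\<forall>f\<in>faces t. (\<Sum>i\<in>UNIV. l (side_edge t f i)) < 2 * pi)"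

definition hyperbolic_polyhedral_metric :: "('f, 'e) triangulation \<Rightarrow> ('e \<Rightarrow> real) \<Rightarrow> bool" where
  "hyperbolic_polyhedral_metric t l \<longleftrightarrow> triangle_metric t l"

text \<open>
  A geodesic triangle with prescribed side lengths, given by its corners. For the lengths
  of a polyhedral metric it exists and is unique up to an isometry of the plane, so that the
  choice made in \<open>realization\<close> does not affect the inner angles.
\<close>

definition realizes :: "'p plane \<Rightarrow> (3 \<Rightarrow> real) \<Rightarrow> (3 \<Rightarrow> 'p) \<Rightarrow> bool" where
  "realizes K len P \<longleftrightarrow>
     (\<forall>i. P i \<in> points K) \<and> (\<forall>i. pdist K (P (i + 1)) (P (i + 2)) = len i)"

definition realization ::
    "'p plane \<Rightarrow> ('f, 'e) triangulation \<Rightarrow> ('e \<Rightarrow> real) \<Rightarrow> 'f \<Rightarrow> 3 \<Rightarrow> 'p" where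
  "realization K t l f = (SOME P. realizes K (\<lambda>i. l (side_edge t f i)) P)"

definition inner_angle ::
    "'p plane \<Rightarrow> ('f, 'e) triangulation \<Rightarrow> ('e \<Rightarrow> real) \<Rightarrow> 'f \<Rightarrow> 3 \<Rightarrow> real" where
  "inner_angle K t l f i =
     (let P = realization K t l f in pangle K (P i) (P (i + 1)) (P (i + 2)))"

text \<open>
  Below, a sum over \<open>sides_of t e\<close> has two summands, one for each of the two triangles in which the
  edge \<open>e\<close> lies. The integrals are oriented. For inner angles of nondegenerate triangles \<open>sin\<close> and
  \<open>cos\<close> are positive on the ranges of integration, also at the ends, so \<open>powr\<close> is the real power.
\<close>

definition phi ::
    "'p plane \<Rightarrow> ('f, 'e) triangulation \<Rightarrow> real \<Rightarrow> ('e \<Rightarrow> real) \<Rightarrow> 'e \<Rightarrow> real" where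
  "phi K t h l e =
     (\<Sum>(f, i)\<in>sides_of t e. LBINT s=ereal (pi / 2)..ereal (inner_angle K t l f i). sin s powr h)"

definition psi ::
    "'p plane \<Rightarrow> ('f, 'e) triangulation \<Rightarrow> real \<Rightarrow> ('e \<Rightarrow> real) \<Rightarrow> 'e \<Rightarrow> real" where
  "psi K t h l e =
     (\<Sum>(f, i)\<in>sides_of t e.
        LBINT s=ereal 0..ereal ((inner_angle K t l f (i + 1) + inner_angle K t l f (i + 2)
                                   - inner_angle K t l f i) / 2). cos s powr h)"

end

theory Submission
  imports Defs
begin

text \<open>
  Triangles are compared one at a time. Let \<open>L x\<close> be \<open>x\<close>, \<open>sin x\<close> or \<open>tanh (x / 2)\<close> in the Euclidean,
  spherical and hyperbolic plane, let \<open>F x\<close> be the integral of \<open>sin\<^sup>h\<close> from \<open>\<pi> / 2\<close> to \<open>x\<close>, and let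
  \<open>g\<close> be a coordinate on the possible edge lengths with derivative \<open>L powr (- h - 1)\<close>. A triangle
  with sides \<open>a\<^sub>1, a\<^sub>2, a\<^sub>3\<close> gets three angles \<open>\<theta>\<^sub>1, \<theta>\<^sub>2, \<theta>\<^sub>3\<close>: its inner angles in the first two
  geometries, and \<open>\<theta>\<^sub>i = \<pi> / 2 - (\<beta> + \<gamma> - \<alpha>) / 2\<close> in the hyperbolic one, where \<open>\<alpha>\<close> is the inner angle
  opposite to \<open>a\<^sub>i\<close> and \<open>\<beta>, \<gamma>\<close> are the other two. Then \<open>\<phi>\<^sub>h\<close>, respectively \<open>- \<psi>\<^sub>h\<close>, sums \<open>F \<theta>\<close> over the
  two sides of an edge, and all three geometries have the same shape: there is a sine law
  \<open>sin \<theta>\<^sub>i = K * L a\<^sub>i\<close> whose factor \<open>K\<close> is common to the three sides.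

  The theorem follows from a monotonicity inequality for a single triangle
  (\<open>cosine_law.triangle_monotone\<close>): if two triangles with sides \<open>a\<^sub>i\<close> and \<open>a'\<^sub>i\<close> differ (in the
  Euclidean plane: are not similar), then the sum over \<open>i\<close> of
  \<open>(F \<theta>'\<^sub>i - F \<theta>\<^sub>i) * (g a'\<^sub>i - g a\<^sub>i)\<close> is positive. Add this up over all faces and collect the terms
  that belong to one edge: the result is the sum over the edges of the difference of the curvatures
  times the difference of the values of \<open>g\<close>, which is zero. So no face can differ
  (\<open>faces_equal_if_edge_sums_equal\<close>). In the Euclidean plane each face is thus scaled by some factor;
  adjacent faces have the same factor since they share an edge, and the surface is connected
  (\<open>faces_connected\<close>).

  For the inequality, move the sides along the path on which each \<open>g a\<^sub>i\<close> is affine in the time \<open>t\<close>, and let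
  \<open>G t\<close> be the sum of the \<open>F \<theta>\<^sub>i\<close>, each multiplied by the velocity of \<open>g a\<^sub>i\<close>. By the sine law the
  derivative of \<open>G\<close> is a positive multiple of a quadratic form in the velocities of the sides that does
  not depend on \<open>h\<close>, and this form is definite: it is the Gram matrix of the normals of the
  triangle in the first two geometries and a similar explicit matrix in the third one.

  The path may leave the set of triangles, however. For \<open>h > -1\<close> the angles are extended to all triples of
  lengths by truncating their cosines to \<open>[-1, 1]\<close>. Since all three angles degenerate at the same
  time, to \<open>0\<close> or \<open>\<pi>\<close>, the extended function \<open>G\<close> is continuous and takes only finitely many values at
  the times outside, and a continuous function which has a positive derivative off a set with finite image is
  increasing (\<open>strict_mono_off_finite_image\<close>). For \<open>h \<le> -1\<close> the integral \<open>F\<close> is unbounded and there is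
  no such extension, but then the set of triangles is convex in the coordinate \<open>g\<close>
  (\<open>cosine_law.triangles_convex\<close>), and the path stays inside.
\<close>

section \<open>Monotonicity and positivity criteria on an interval\<close>

text \<open>
  If \<open>G b < G a\<close>, pick a value \<open>y\<close> between them which \<open>G\<close> does not take on \<open>D\<close>. At the last time when \<open>G\<close>
  equals \<open>y\<close> the derivative is positive, so \<open>G\<close> would have to come down through \<open>y\<close> once more.
\<close>

lemma mono_off_finite_image:
  fixes G :: "real \<Rightarrow> real"
  assumes "a \<le> b" and cont: "continuous_on {a..b} G" and fin: "finite (G ` D)"
    and der: "\<And>t. a < t \<Longrightarrow> t < b \<Longrightarrow> t \<notin> D \<Longrightarrow> \<exists>d>0. (G has_real_derivative d) (at t)"
  shows "G a \<le> G b"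
proof (rule ccontr)
  assume "\<not> G a \<le> G b"
  then have lt: "G b < G a" by simp
  then have "infinite ({G b<..<G a} - G ` D)"
    using fin by (simp add: Diff_infinite_finite infinite_Ioo)
  then obtain y where y: "G b < y" "y < G a" "y \<notin> G ` D"
    by (metis (no_types, lifting) Diff_iff ex_in_conv finite.emptyI greaterThanLessThan_iff)
  \<comment> \<open>The last time at which the value is taken is the maximum of this compact set.\<close>
  define C where "C = {t \<in> {a..b}. G t = y}"
  have "closed C"
    unfolding C_def by (rule continuous_closed_preimage_constant[OF cont]) auto
  moreover have "bounded C"
    unfolding C_def by (rule bounded_subset[OF bounded_closed_interval[of a b]]) auto
  ultimately have "compact C" by (simp add: compact_eq_bounded_closed)
  moreover obtain x where "a \<le> x" "x \<le> b" "G x = y"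
    using IVT2'[of G b y a] y \<open>a \<le> b\<close> cont by auto
  then have "C \<noteq> {}" unfolding C_def by auto
  ultimately obtain s where s: "s \<in> C" "\<And>t. t \<in> C \<Longrightarrow> t \<le> s"
    using compact_attains_sup by metis
  have sab: "a < s" "s < b" "s \<notin> D" "G s = y"
    using s(1) y unfolding C_def by (auto simp: less_le)
  obtain d where "d > 0" "(G has_real_derivative d) (at s)"
    using der sab by blast
  then obtain e where e: "e > 0" "\<And>h. 0 < h \<Longrightarrow> h < e \<Longrightarrow> G s < G (s + h)"
    using DERIV_pos_inc_right by blast
  define r where "r = s + min (e/2) ((b - s)/2)"
  have r: "s < r" "r < b" "y < G r"
    using e(2)[of "min (e/2) ((b - s)/2)"] e(1) sab by (auto simp: r_def min_def field_simps)
  obtain x where "r \<le> x" "x \<le> b" "G x = y"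
    using IVT2'[of G b y r] y r continuous_on_subset[OF cont, of "{r..b}"] sab by auto
  then have "x \<in> C" using r sab unfolding C_def by auto
  then show False using s(2) r \<open>r \<le> x\<close> by force
qed

text \<open>
  \<open>G\<close> grows strictly near the time \<open>c\<close>, and the preceding lemma covers what lies before and after. In the
  application \<open>D\<close> consists of the times at which a moving triangle is degenerate, about which nothing is known
  except that \<open>G\<close> has few values there.
\<close>

lemma strict_mono_off_finite_image:
  fixes G :: "real \<Rightarrow> real"
  assumes cont: "continuous_on {a..b} G" and fin: "finite (G ` D)"
    and der: "\<And>t. a < t \<Longrightarrow> t < b \<Longrightarrow> t \<notin> D \<Longrightarrow> \<exists>d>0. (G has_real_derivative d) (at t)"
    and c: "a < c" "c < b" "c \<notin> D"
  shows "G a < G b"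
proof -
  obtain d where "d > 0" "(G has_real_derivative d) (at c)"
    using der c by blast
  then obtain e where e: "e > 0" "\<And>h. 0 < h \<Longrightarrow> h < e \<Longrightarrow> G c < G (c + h)"
    using DERIV_pos_inc_right by blast
  define r where "r = c + min (e/2) ((b - c)/2)"
  have r: "c < r" "r < b" "G c < G r"
    using e(2)[of "min (e/2) ((b - c)/2)"] e(1) c by (auto simp: r_def min_def field_simps)
  have "G a \<le> G c"
    by (rule mono_off_finite_image[OF _ _ fin])
       (use c der in \<open>auto intro!: continuous_on_subset[OF cont]\<close>)
  moreover have "G r \<le> G b"
    by (rule mono_off_finite_image[OF _ _ fin])
       (use c r der in \<open>auto intro!: continuous_on_subset[OF cont]\<close>)
  ultimately show ?thesis using r by linarith
qed

text \<open>
  Otherwise the minimum of \<open>\<delta>\<close> is an interior critical point with a nonpositive value, where the second derivative is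
  negative; but then it is not a minimum.
\<close>

lemma positive_if_concave_at_nonpositive_critical_points:
  fixes \<delta> \<delta>' \<delta>'' :: "real \<Rightarrow> real"
  assumes d1: "\<And>t. t \<in> {0..1} \<Longrightarrow> (\<delta> has_real_derivative \<delta>' t) (at t)"
    and d2: "\<And>t. t \<in> {0..1} \<Longrightarrow> (\<delta>' has_real_derivative \<delta>'' t) (at t)"
    and ends: "\<delta> 0 > 0" "\<delta> 1 > 0"
    and crit: "\<And>t. t \<in> {0..1} \<Longrightarrow> \<delta> t \<le> 0 \<Longrightarrow> \<delta>' t = 0 \<Longrightarrow> \<delta>'' t < 0"
    and t: "t \<in> {0..1}"
  shows "\<delta> t > 0"
proof -
  have "continuous_on {0..1} \<delta>"
    by (meson DERIV_isCont continuous_at_imp_continuous_on d1)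
  then obtain s where s: "s \<in> {0..1}" "\<And>r. r \<in> {0..1} \<Longrightarrow> \<delta> s \<le> \<delta> r"
    using continuous_attains_inf[of "{0..1::real}" \<delta>] by auto
  have "\<delta> s > 0"
  proof (rule ccontr)
    assume "\<not> \<delta> s > 0"
    then have neg: "\<delta> s \<le> 0" by simp
    then have s01: "0 < s" "s < 1" using s(1) ends by (auto simp: less_le)
    have "\<delta>' s = 0"
      by (rule DERIV_local_min[OF d1[OF s(1)], of "min s (1 - s)"])
         (use s01 in \<open>auto intro!: s(2)\<close>)
    with crit[OF s(1) neg] have "\<delta>'' s < 0" by simp
    from DERIV_neg_dec_right[OF d2[OF s(1)] this] \<open>\<delta>' s = 0\<close>
    obtain e where e: "e > 0" "\<And>h. 0 < h \<Longrightarrow> h < e \<Longrightarrow> \<delta>' (s + h) < 0" by auto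
    define r where "r = s + min (e/2) ((1 - s)/2)"
    have r: "s < r" "r < 1" "r < s + e" using e(1) s01 by (auto simp: r_def min_def field_simps)
    have "\<exists>z>s. z < r \<and> \<delta> r - \<delta> s = (r - s) * \<delta>' z"
      by (rule MVT2) (use r s01 in \<open>auto intro!: d1\<close>)
    then obtain z where z: "s < z" "z < r" "\<delta> r - \<delta> s = (r - s) * \<delta>' z" by auto
    have "\<delta>' z < 0" using e(2)[of "z - s"] z r by simp
    then have "\<delta> r < \<delta> s" using z r by (smt (verit) mult_pos_neg)
    with s(2)[of r] r s01 show False by auto
  qed
  with s(2)[OF t] show ?thesis by linarith
qed

lemma positive_if_constant_slope:
  fixes \<delta> :: "real \<Rightarrow> real"
  assumes d1: "\<And>t. t \<in> {0..1} \<Longrightarrow> (\<delta> has_real_derivative k) (at t)"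
    and ends: "\<delta> 0 > 0" "\<delta> 1 > 0" and t: "t \<in> {0..1}"
  shows "\<delta> t > 0"
proof (cases "k \<ge> 0")
  case True
  have "\<delta> 0 \<le> \<delta> t"
    by (rule DERIV_nonneg_imp_nondecreasing[of 0 t]) (use t True d1 in \<open>auto intro!: exI[of _ k]\<close>)
  with ends show ?thesis by simp
next
  case False
  have "\<delta> 1 \<le> \<delta> t"
    by (rule DERIV_nonpos_imp_nonincreasing[of t 1]) (use t False d1 in \<open>auto intro!: exI[of _ k]\<close>)
  with ends show ?thesis by simp
qed

text \<open>
  The segment between \<open>a\<close> and \<open>b\<close> that is straight in the coordinate \<open>g\<close>. It is differentiable at the ends
  too, because \<open>I\<close> is open.
\<close>

lemma path_linear_in_coordinate:
  fixes g w :: "real \<Rightarrow> real"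
  assumes I: "open I" "is_interval I"
    and g: "\<And>x. x \<in> I \<Longrightarrow> (g has_real_derivative w x) (at x)"
    and w: "\<And>x. x \<in> I \<Longrightarrow> w x > 0"
    and ab: "a \<in> I" "b \<in> I"
  obtains \<gamma> where "\<gamma> 0 = a" "\<gamma> 1 = b"
    "\<And>t. t \<in> {0..1} \<Longrightarrow> \<gamma> t \<in> I"
    "\<And>t. t \<in> {0..1} \<Longrightarrow> g (\<gamma> t) = g a + t * (g b - g a)"
    "\<And>t. t \<in> {0..1} \<Longrightarrow> (\<gamma> has_real_derivative (g b - g a) / w (\<gamma> t)) (at t)"
proof -
  have less: "g x < g y" if "x \<in> I" "y \<in> I" "x < y" for x y
  proof (rule DERIV_pos_imp_increasing[OF \<open>x < y\<close>])
    fix z assume "x \<le> z" "z \<le> y"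
    then have "z \<in> I" using I(2) that by (meson mem_is_interval_1_I)
    then show "\<exists>d. (g has_real_derivative d) (at z) \<and> d > 0" using g w by blast
  qed
  have inj: "inj_on g I"
    by (rule inj_onI) (metis less less_irrefl linorder_neqE)
  have cont: "continuous_on I g"
    by (meson DERIV_isCont continuous_at_imp_continuous_on g)
  have conv: "is_interval (g ` I)"
    using connected_continuous_image[OF cont] I(2) is_interval_connected_1 by blast
  define \<eta> where "\<eta> = the_inv_into I g"
  have \<eta>: "\<eta> (g x) = x" if "x \<in> I" for x
    unfolding \<eta>_def by (rule the_inv_into_f_f[OF inj that])
  define \<gamma> where "\<gamma> t = \<eta> (g a + t * (g b - g a))" for t
  have line: "g a + t * (g b - g a) \<in> g ` I" if "t \<in> {0..1}" for t
  proof -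
    have "(1 - t) *\<^sub>R g a + t *\<^sub>R g b \<in> g ` I"
      by (rule convexD_alt) (use conv ab that is_interval_convex_1 in auto)
    then show ?thesis by (simp add: algebra_simps)
  qed
  have in_I: "\<gamma> t \<in> I" and g\<gamma>: "g (\<gamma> t) = g a + t * (g b - g a)" if t: "t \<in> {0..1}" for t
  proof -
    obtain x where "x \<in> I" "g a + t * (g b - g a) = g x" using line[OF t] by auto
    then show "\<gamma> t \<in> I" "g (\<gamma> t) = g a + t * (g b - g a)" by (auto simp: \<gamma>_def \<eta>)
  qed
  show ?thesis
  proof (rule that[of \<gamma>])
    fix t :: real assume t: "t \<in> {0..1}"
    have "(\<eta> has_real_derivative inverse (w (\<gamma> t))) (at (g (\<gamma> t)))"
      unfolding has_field_derivative_def
      by (rule has_derivative_inverse_strong[of I "\<gamma> t" g \<eta> "(*) (w (\<gamma> t))"])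
         (use g[OF in_I[OF t]] in_I[OF t] w[OF in_I[OF t]] I cont \<eta> in
           \<open>auto simp: has_field_derivative_def fun_eq_iff\<close>)
    then have "(\<eta> has_real_derivative inverse (w (\<gamma> t))) (at (g a + t * (g b - g a)))"
      by (simp add: g\<gamma>[OF t])
    then have "((\<lambda>t. \<eta> (g a + t * (g b - g a))) has_real_derivative
        inverse (w (\<gamma> t)) * (g b - g a)) (at t)"
      by (rule DERIV_chain2) (auto intro!: derivative_eq_intros)
    then show "(\<gamma> has_real_derivative (g b - g a) / w (\<gamma> t)) (at t)"
      by (simp add: \<gamma>_def[abs_def] divide_inverse mult.commute)
  qed (use in_I g\<gamma> ab \<eta> in \<open>auto simp: \<gamma>_def\<close>)
qed

section \<open>The integrals of powers of sine and cosine\<close>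

definition sin_power_integral :: "real \<Rightarrow> real \<Rightarrow> real" where
  "sin_power_integral h x = (LBINT s=ereal (pi / 2)..ereal x. sin s powr h)"

lemma interval_integral_deriv:
  fixes f :: "real \<Rightarrow> real"
  assumes cont: "continuous_on {p<..<q} f" and "p < c" "c < q" "p < x" "x < q"
  shows "((\<lambda>u. LBINT y=ereal c..ereal u. f y) has_real_derivative f x) (at x)"
proof -
  define a b where "a = (p + min c x) / 2" and "b = (q + max c x) / 2"
  have ab: "p < a" "a \<le> c" "c \<le> b" "b < q" "a < x" "x < b"
    using assms by (auto simp: a_def b_def min_def max_def)
  have "continuous_on {a..b} f" by (rule continuous_on_subset[OF cont]) (use ab in auto)
  then have "((\<lambda>u. LBINT y=c..u. f y) has_vector_derivative f x) (at x within {a..b})"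
    using ab by (intro interval_integral_FTC2) auto
  then show ?thesis
    using at_within_Icc_at[OF ab(5,6)] by (simp add: has_real_derivative_iff_has_vector_derivative)
qed

lemma sin_power_integral_deriv:
  assumes "0 < x" "x < pi"
  shows "(sin_power_integral h has_real_derivative sin x powr h) (at x)"
  unfolding sin_power_integral_def[abs_def]
proof (rule interval_integral_deriv[of 0 pi])
  show "continuous_on {0<..<pi} (\<lambda>s. sin s powr h)"
    by (intro continuous_on_powr continuous_intros ballI)
       (metis greaterThanLessThan_iff less_irrefl sin_gt_zero)
qed (use assms in auto)

lemma sin_power_integral_half_pi [simp]: "sin_power_integral h (pi / 2) = 0"
  by (simp add: sin_power_integral_def)

lemma sin_power_integral_mono:
  assumes "0 < x" "x \<le> y" "y < pi"
  shows "sin_power_integral h x \<le> sin_power_integral h y"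
proof (rule DERIV_nonneg_imp_nondecreasing[OF assms(2)])
  fix z assume "x \<le> z" "z \<le> y"
  then show "\<exists>d. (sin_power_integral h has_real_derivative d) (at z) \<and> 0 \<le> d"
    using assms by (intro exI[of _ "sin z powr h"] conjI sin_power_integral_deriv) auto
qed

lemma sin_power_integral_reflect:
  assumes "0 < x" "x < pi"
  shows "sin_power_integral h (pi - x) = - sin_power_integral h x"
proof -
  have "\<exists>c. \<forall>y\<in>{0<..<pi}. sin_power_integral h (pi - y) + sin_power_integral h y = c"
  proof (rule has_field_derivative_zero_constant)
    fix y assume y: "y \<in> {0<..<pi}"
    have "((\<lambda>y. sin_power_integral h (pi - y)) has_real_derivative sin (pi - y) powr h * (- 1)) (at y)"
      by (rule DERIV_chain2[OF sin_power_integral_deriv])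
         (use y in \<open>auto intro!: derivative_eq_intros\<close>)
    from DERIV_add[OF this sin_power_integral_deriv[of y h]] y
    show "((\<lambda>y. sin_power_integral h (pi - y) + sin_power_integral h y) has_real_derivative 0)
        (at y within {0<..<pi})"
      by (auto intro: has_field_derivative_at_within)
  qed auto
  then obtain c where c: "\<And>y. y \<in> {0<..<pi} \<Longrightarrow> sin_power_integral h (pi - y) + sin_power_integral h y = c"
    by blast
  from c[of "pi/2"] have "c = 0" by (simp add: )
  with c[of x] assms show ?thesis by simp
qed

text \<open>
  This turns the summands of \<open>\<psi>\<^sub>h\<close> into integrals of a power of the sine.
\<close>

lemma cos_power_integral:
  assumes "- (pi / 2) < x" "x < pi / 2"
  shows "(LBINT s=ereal 0..ereal x. cos s powr h) = - sin_power_integral h (pi / 2 - x)"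
proof -
  let ?J = "{- (pi / 2)<..<pi / 2}" and ?C = "\<lambda>x. LBINT s=ereal 0..ereal x. cos s powr h"
  have "\<exists>c. \<forall>y\<in>?J. ?C y + sin_power_integral h (pi / 2 - y) = c"
  proof (rule has_field_derivative_zero_constant)
    fix y assume y: "y \<in> ?J"
    have "continuous_on ?J (\<lambda>s. cos s powr h)"
      by (intro continuous_on_powr continuous_intros ballI)
         (metis greaterThanLessThan_iff less_irrefl cos_gt_zero_pi)
    then have "(?C has_real_derivative cos y powr h) (at y)"
      by (rule interval_integral_deriv) (use y in auto)
    from DERIV_add[OF this] have sum: "((\<lambda>y. ?C y + f y) has_real_derivative cos y powr h + d) (at y)"
      if "(f has_real_derivative d) (at y)" for f d using that .
    have "((\<lambda>y. sin_power_integral h (pi / 2 - y)) has_real_derivative sin (pi / 2 - y) powr h * (- 1)) (at y)"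
      by (rule DERIV_chain2[OF sin_power_integral_deriv])
         (use y in \<open>auto intro!: derivative_eq_intros\<close>)
    from sum[OF this] have "((\<lambda>y. ?C y + sin_power_integral h (pi / 2 - y)) has_real_derivative 0) (at y)"
      by (simp add: sin_diff)
    then show "((\<lambda>y. ?C y + sin_power_integral h (pi / 2 - y)) has_real_derivative 0) (at y within ?J)"
      by (rule has_field_derivative_at_within)
  qed auto
  then obtain c where c: "\<And>y. y \<in> ?J \<Longrightarrow> ?C y + sin_power_integral h (pi / 2 - y) = c" by blast
  from c[of 0] have "c = 0" by simp
  with c[of x] assms show ?thesis by simp
qed

text \<open>
  Up to \<open>\<pi> / 3\<close> the derivative of the sine is at least \<open>1 / 2\<close>; from there on \<open>sin x \<ge> sqrt 3 / 2\<close>, which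
  exceeds \<open>\<pi> / 4\<close>.
\<close>

lemma half_le_sin:
  assumes "0 \<le> x" "x \<le> pi / 2"
  shows "x / 2 \<le> sin x"
proof (cases "x \<le> pi / 3")
  case True
  have "sin 0 - 0 / 2 \<le> sin x - x / 2"
  proof (rule DERIV_nonneg_imp_nondecreasing[OF assms(1)])
    fix y assume y: "0 \<le> y" "y \<le> x"
    have "cos (pi/3) \<le> cos y" by (rule cos_monotone_0_pi_le) (use y True in auto)
    then show "\<exists>d. ((\<lambda>x. sin x - x / 2) has_real_derivative d) (at y) \<and> 0 \<le> d"
      by (intro exI[of _ "cos y - 1 / 2"]) (auto intro!: derivative_eq_intros simp: cos_60)
  qed
  then show ?thesis by simp
next
  case False
  have "sin (pi/3) \<le> sin x" by (rule sin_monotone_2pi_le) (use False assms in auto)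
  moreover have "sqrt 3 \<ge> 1.7" by (rule real_le_rsqrt) (simp add: power2_eq_square)
  moreover have "pi < 3.2" using pi_approx by simp
  ultimately show ?thesis using assms by (simp add: sin_60)
qed

text \<open>
  Near \<open>0\<close> the integrand is comparable to \<open>y powr h\<close>, which is integrable for \<open>h > -1\<close>.
\<close>

lemma sin_power_integral_bounded_below:
  assumes h: "h > -1"
  obtains m where "\<And>x. 0 < x \<Longrightarrow> x < pi \<Longrightarrow> m \<le> sin_power_integral h x"
proof -
  \<comment> \<open>Since \<open>y / 2 \<le> sin y \<le> y\<close>, the integrand is at most \<open>C * (h + 1) * y powr h\<close>, for either sign of \<open>h\<close>;
    this is the derivative of \<open>C * y powr (h + 1)\<close>.\<close>
  define C where "C = max 1 ((1/2) powr h) / (h + 1)"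
  have C: "sin y powr h \<le> C * (h + 1) * y powr h" if y: "0 < y" "y \<le> pi/2" for y
  proof (cases "h \<ge> 0")
    case True
    have "sin y powr h \<le> y powr h"
      by (rule powr_mono2) (use y True sin_x_le_x[of y] in \<open>auto intro!: sin_ge_zero\<close>)
    also have "\<dots> \<le> max 1 ((1/2) powr h) * y powr h"
      using mult_right_mono[of 1 "max 1 ((1/2) powr h)" "y powr h"] by simp
    finally show ?thesis using h by (simp add: C_def)
  next
    case False
    have "sin y powr h \<le> (y / 2) powr h"
      by (rule powr_mono2') (use y False half_le_sin[of y] in auto)
    also have "\<dots> = (1/2) powr h * y powr h"
      using y powr_mult[of "1/2" y h] by simp
    also have "\<dots> \<le> max 1 ((1/2) powr h) * y powr h"
      by (rule mult_right_mono) auto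
    finally show ?thesis using h by (simp add: C_def)
  qed
  have small: "- C * (pi/2) powr (h + 1) \<le> sin_power_integral h x" if x: "0 < x" "x \<le> pi/2" for x
  proof -
    define E where "E y = sin_power_integral h y - C * y powr (h + 1)" for y
    have "E (pi/2) \<le> E x"
    proof (rule DERIV_nonpos_imp_nonincreasing[OF x(2)])
      fix y assume y: "x \<le> y" "y \<le> pi/2"
      have "(E has_real_derivative sin y powr h - C * ((h + 1) * y powr (h + 1 - 1))) (at y)"
        unfolding E_def by (intro DERIV_diff sin_power_integral_deriv DERIV_cmult has_real_derivative_powr)
           (use x y pi_gt_zero in linarith)+
      moreover have "sin y powr h - C * ((h + 1) * y powr (h + 1 - 1)) \<le> 0"
        using C[of y] x y by (simp add: mult.assoc)
      ultimately show "\<exists>d. (E has_real_derivative d) (at y) \<and> d \<le> 0" by blast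
    qed
    moreover have "C * x powr (h + 1) \<ge> 0" using h by (simp add: C_def)
    ultimately show ?thesis by (simp add: E_def)
  qed
  show ?thesis
  proof (rule that[of "min 0 (- C * (pi/2) powr (h + 1))"])
    fix x :: real assume x: "0 < x" "x < pi"
    show "min 0 (- C * (pi/2) powr (h + 1)) \<le> sin_power_integral h x"
    proof (cases "x \<le> pi/2")
      case True then show ?thesis using small[of x] x by simp
    next
      case False
      then have "sin_power_integral h (pi/2) \<le> sin_power_integral h x"
        using x by (intro sin_power_integral_mono) auto
      then show ?thesis by simp
    qed
  qed
qed

text \<open>
  The limit at \<open>0\<close> exists by monotonicity, and the one at \<open>\<pi>\<close> by the symmetry about \<open>\<pi> / 2\<close>.
\<close>

lemma sin_power_integral_extension:
  assumes h: "h > -1"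
  obtains \<Phi> where "continuous_on {0..pi} \<Phi>"
    "\<And>x. 0 < x \<Longrightarrow> x < pi \<Longrightarrow> \<Phi> x = sin_power_integral h x"
proof -
  let ?F = "sin_power_integral h"
  obtain m where m: "\<And>x. 0 < x \<Longrightarrow> x < pi \<Longrightarrow> m \<le> ?F x"
    using sin_power_integral_bounded_below[OF h] by blast
  define l where "l = Inf (?F ` {0<..<pi})"
  have bdd: "bdd_below (?F ` {0<..<pi})" by (rule bdd_belowI[of _ m]) (use m in auto)
  have low: "(?F \<longlongrightarrow> l) (at_right 0)"
  proof (rule order_tendstoI)
    fix a assume "a < l"
    moreover have "l \<le> ?F x" if "0 < x" "x < pi" for x
      unfolding l_def by (rule cInf_lower[OF _ bdd]) (use that in auto)
    ultimately show "\<forall>\<^sub>F x in at_right 0. a < ?F x"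
      unfolding eventually_at_right_field
      by (intro exI[of _ pi] conjI allI impI) (use pi_gt_zero in \<open>auto intro: less_le_trans\<close>)
  next
    fix a assume "l < a"
    then obtain x where x: "0 < x" "x < pi" "?F x < a"
      using cInf_lessD[of "?F ` {0<..<pi}" a] pi_gt_zero unfolding l_def
      by (auto simp del: greaterThanLessThan_eq)
    show "\<forall>\<^sub>F x in at_right 0. ?F x < a"
      unfolding eventually_at_right_field
    proof (intro exI[of _ x] conjI allI impI)
      fix y assume "0 < y" "y < x"
      then show "?F y < a" using x sin_power_integral_mono[of y x h] by linarith
    qed (use x in simp)
  qed
  have flip: "filterlim (\<lambda>x. pi - x) (at_right 0) (at_left pi)"
    unfolding filterlim_at by (auto simp: eventually_at_filter intro!: tendsto_eq_intros)
  have "((\<lambda>x. - ?F (pi - x)) \<longlongrightarrow> - l) (at_left pi)"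
    by (rule tendsto_minus[OF filterlim_compose[OF low flip]])
  moreover have "\<forall>\<^sub>F x in at_left pi. - ?F (pi - x) = ?F x"
    unfolding eventually_at_left_field
    by (intro exI[of _ 0]) (auto simp: sin_power_integral_reflect)
  ultimately have high: "(?F \<longlongrightarrow> - l) (at_left pi)"
    by (rule Lim_transform_eventually)
  define \<Phi> where "\<Phi> x = (if x \<le> 0 then l else if x \<ge> pi then - l else ?F x)" for x
  have \<Phi>_simps: "\<Phi> 0 = l" "\<Phi> pi = - l" "\<And>x. 0 < x \<Longrightarrow> x < pi \<Longrightarrow> \<Phi> x = ?F x"
    by (auto simp: \<Phi>_def pi_gt_zero[unfolded not_le[symmetric]] simp del: pi_ge_zero)
  show ?thesis
  proof (rule that[of \<Phi>])
    show "continuous_on {0..pi} \<Phi>"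
    proof (rule continuous_on_IccI)
      have "\<forall>\<^sub>F x in at_right 0. ?F x = \<Phi> x"
        unfolding eventually_at_right_field
        by (intro exI[of _ pi]) (auto simp: \<Phi>_def)
      from Lim_transform_eventually[OF low this]
      show "(\<Phi> \<longlongrightarrow> \<Phi> 0) (at_right 0)" by (simp add: \<Phi>_simps)
      have "\<forall>\<^sub>F x in at_left pi. ?F x = \<Phi> x"
        unfolding eventually_at_left_field
        by (intro exI[of _ 0]) (auto simp: \<Phi>_def)
      from Lim_transform_eventually[OF high this]
      show "(\<Phi> \<longlongrightarrow> \<Phi> pi) (at_left pi)" by (simp add: \<Phi>_simps)
      fix x :: real assume x: "0 < x" "x < pi"
      have "?F \<midarrow>x\<rightarrow> ?F x"
        using DERIV_isCont[OF sin_power_integral_deriv[OF x]] by (simp add: isCont_def)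
      moreover have "\<forall>\<^sub>F y in at x. ?F y = \<Phi> y"
        by (rule eventually_mono[OF eventually_at_in_open'[of "{0<..<pi}" x]])
           (use x in \<open>auto simp: \<Phi>_def\<close>)
      ultimately have "\<Phi> \<midarrow>x\<rightarrow> ?F x" by (rule Lim_transform_eventually)
      then show "\<Phi> \<midarrow>x\<rightarrow> \<Phi> x" using x by (simp add: \<Phi>_simps)
    qed simp
  qed (simp add: \<Phi>_def)
qed

text \<open>
  For \<open>h > -1\<close> the function \<open>P\<close> continues the integral constantly beyond \<open>-1\<close> and \<open>1\<close>. The expressions for the cosines of
  the angles make sense for all triples of lengths, but have values outside \<open>[-1, 1]\<close> if the lengths are not
  those of a triangle; there \<open>P\<close> treats the angles as \<open>0\<close> or \<open>\<pi>\<close>.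
\<close>

lemma sin_power_integral_arccos:
  obtains P where
    "\<And>x. \<bar>x\<bar> < 1 \<Longrightarrow> P x = sin_power_integral h (arccos x)"
    "\<And>x. \<bar>x\<bar> < 1 \<Longrightarrow> (P has_real_derivative - ((1 - x\<^sup>2) powr ((h - 1) / 2))) (at x)"
    "h > -1 \<Longrightarrow> continuous_on UNIV P"
    "\<And>x. h > -1 \<Longrightarrow> \<bar>x\<bar> \<ge> 1 \<Longrightarrow> P x \<in> {P 1, P (- 1)}"
proof -
  obtain \<Phi> where \<Phi>: "h > -1 \<Longrightarrow> continuous_on {0..pi} \<Phi>"
    "\<And>x. 0 < x \<Longrightarrow> x < pi \<Longrightarrow> \<Phi> x = sin_power_integral h x"
  proof (cases "h > -1")
    case True
    then show ?thesis using sin_power_integral_extension[of h] that by blast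
  next
    case False
    then show ?thesis using that[of "sin_power_integral h"] by simp
  qed
  define clamp where "clamp x = max (- 1) (min 1 x)" for x :: real
  define P where "P x = \<Phi> (arccos (clamp x))" for x
  have eq: "P x = sin_power_integral h (arccos x)" if "\<bar>x\<bar> < 1" for x
    using that arccos_lt_bounded[of x] by (simp add: P_def clamp_def \<Phi>)
  show ?thesis
  proof (rule that[of P])
    fix x :: real assume x: "\<bar>x\<bar> < 1"
    then have "x\<^sup>2 < 1" by (simp add: abs_square_less_1)
    have "((\<lambda>x. sin_power_integral h (arccos x)) has_real_derivative
        sin (arccos x) powr h * inverse (- sqrt (1 - x\<^sup>2))) (at x)"
      by (rule DERIV_chain2[OF sin_power_integral_deriv DERIV_arccos])
         (use x arccos_lt_bounded[of x] in auto)
    moreover have "sin (arccos x) powr h * inverse (- sqrt (1 - x\<^sup>2)) = - ((1 - x\<^sup>2) powr ((h - 1) / 2))"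
    proof -
      have "sin (arccos x) = (1 - x\<^sup>2) powr (1 / 2)"
        using x \<open>x\<^sup>2 < 1\<close> by (simp add: sin_arccos powr_half_sqrt)
      moreover have "inverse (- sqrt (1 - x\<^sup>2)) = - ((1 - x\<^sup>2) powr (- 1 / 2))"
        using \<open>x\<^sup>2 < 1\<close> powr_minus[of "1 - x\<^sup>2" "1 / 2"] by (simp add: powr_half_sqrt)
      ultimately have "sin (arccos x) powr h * inverse (- sqrt (1 - x\<^sup>2)) =
          - ((1 - x\<^sup>2) powr (h / 2) * (1 - x\<^sup>2) powr (- 1 / 2))"
        by (simp only: powr_powr) simp
      also have "\<dots> = - ((1 - x\<^sup>2) powr ((h - 1) / 2))"
        by (simp add: powr_add[symmetric] diff_divide_distrib)
      finally show ?thesis .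
    qed
    ultimately have "((\<lambda>x. sin_power_integral h (arccos x)) has_real_derivative
        - ((1 - x\<^sup>2) powr ((h - 1) / 2))) (at x)" by simp
    then show "(P has_real_derivative - ((1 - x\<^sup>2) powr ((h - 1) / 2))) (at x)"
      by (rule has_field_derivative_transform_within_open[of _ _ _ "{-1<..<1}"])
         (use x eq in auto)
  next
    assume "h > -1"
    show "continuous_on UNIV P"
      unfolding P_def
      by (rule continuous_on_compose2[OF \<Phi>(1)[OF \<open>h > -1\<close>]])
         (auto simp: clamp_def intro!: continuous_intros arccos_lbound arccos_ubound)
  next
    fix x :: real assume "\<bar>x\<bar> \<ge> 1"
    then have "clamp x \<in> {1, - 1}" by (auto simp: clamp_def)
    then show "P x \<in> {P 1, P (- 1)}" by (auto simp: P_def clamp_def)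
  qed (use eq in auto)
qed

section \<open>Comparing curvatures face by face\<close>

lemma index_arith: "i + 1 + 1 = i + 2" "i + 1 + 2 = i" "i + 2 + 1 = i" "i + 2 + 2 = i + 1" for i :: 3
  by (simp_all add: add.assoc)

lemma index_values: "(0::3) + 1 = 1" "(0::3) + 2 = 2" "(1::3) + 1 = 2" "(1::3) + 2 = 0"
    "(2::3) + 1 = 0" "(2::3) + 2 = 1"
  by simp_all

lemma all_index: "(\<forall>i. Q i) \<longleftrightarrow> Q 0 \<and> Q 1 \<and> Q (2 :: 3)"
proof -
  have "(3 :: 3) = 0" by simp
  then show ?thesis unfolding forall_3 by (simp only: conj_ac)
qed

lemma sum_index: "(\<Sum>i\<in>UNIV. f i) = f 0 + f 1 + f (2 :: 3)"
proof -
  have "(3 :: 3) = 0" by simp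
  then show ?thesis unfolding sum_3 by (simp only: add_ac)
qed

lemma finite_edges:
  assumes "finite (faces t)"
  shows "finite (edges t)"
proof -
  have "edges t = (\<lambda>(f, i). side_edge t f i) ` (faces t \<times> UNIV)" by (auto simp: edges_def)
  then show "finite (edges t)" using assms by simp
qed

text \<open>
  Summed over all faces, the sums in \<open>pos\<close> and \<open>nonneg\<close> can be collected by edges. All sides of an edge have the
  same weight \<open>w\<close>, so an edge contributes its weight times the difference of the two sides of \<open>same\<close>, and the total is
  zero.
\<close>

lemma faces_equal_if_edge_sums_equal:
  fixes t :: "('f, 'e) triangulation" and X Y :: "'f \<Rightarrow> 3 \<Rightarrow> real" and w :: "'e \<Rightarrow> real"
  assumes fin: "finite (faces t)"
    and same: "\<And>e. e \<in> edges t \<Longrightarrow> (\<Sum>(f, i)\<in>sides_of t e. X f i) = (\<Sum>(f, i)\<in>sides_of t e. Y f i)"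
    and pos: "\<And>f. f \<in> faces t \<Longrightarrow> \<not> E f \<Longrightarrow> 0 < (\<Sum>i\<in>UNIV. (Y f i - X f i) * w (side_edge t f i))"
    and nonneg: "\<And>f. f \<in> faces t \<Longrightarrow> E f \<Longrightarrow> 0 \<le> (\<Sum>i\<in>UNIV. (Y f i - X f i) * w (side_edge t f i))"
    and f: "f \<in> faces t"
  shows "E f"
proof (rule ccontr)
  assume "\<not> E f"
  let ?h = "\<lambda>(f, i). (Y f i - X f i) * w (side_edge t f i)"
  have "(\<Sum>f\<in>faces t. \<Sum>i\<in>UNIV. (Y f i - X f i) * w (side_edge t f i)) = sum ?h (faces t \<times> UNIV)"
    by (simp add: sum.cartesian_product)
  also have "\<dots> = (\<Sum>e\<in>edges t. sum ?h {x \<in> faces t \<times> UNIV. (\<lambda>(f, i). side_edge t f i) x = e})"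
    by (rule sum.group[symmetric]) (use fin finite_edges[OF fin] in \<open>auto simp: edges_def\<close>)
  also have "\<dots> = (\<Sum>e\<in>edges t. 0)"
  proof (rule sum.cong[OF refl])
    fix e assume e: "e \<in> edges t"
    have "{x \<in> faces t \<times> UNIV. (\<lambda>(f, i). side_edge t f i) x = e} = sides_of t e"
      by (auto simp: sides_of_def)
    moreover have "sum ?h (sides_of t e) = (\<Sum>(f, i)\<in>sides_of t e. (Y f i - X f i) * w e)"
      by (rule sum.cong) (auto simp: sides_of_def)
    moreover have "\<dots> = ((\<Sum>(f, i)\<in>sides_of t e. Y f i) - (\<Sum>(f, i)\<in>sides_of t e. X f i)) * w e"
      by (simp add: sum_subtractf[symmetric] sum_distrib_right case_prod_beta)
    ultimately show "sum ?h {x \<in> faces t \<times> UNIV. (\<lambda>(f, i). side_edge t f i) x = e} = 0"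
      using same[OF e] by simp
  qed
  finally have "(\<Sum>f\<in>faces t. \<Sum>i\<in>UNIV. (Y f i - X f i) * w (side_edge t f i)) = 0" by simp
  moreover have "0 < (\<Sum>f\<in>faces t. \<Sum>i\<in>UNIV. (Y f i - X f i) * w (side_edge t f i))"
  proof (rule sum_pos2[OF fin f])
    show "0 < (\<Sum>i\<in>UNIV. (Y f i - X f i) * w (side_edge t f i))" by (rule pos[OF f \<open>\<not> E f\<close>])
    show "0 \<le> (\<Sum>i\<in>UNIV. (Y f i - X f i) * w (side_edge t f i))" if "f \<in> faces t" for f
      using pos[OF that] nonneg[OF that] by (cases "E f") auto
  qed
  ultimately show False by simp
qed

section \<open>The monotonicity inequality for a single triangle\<close>

text \<open>
  What the three geometries have in common. The admissible lengths form \<open>I\<close>, and \<open>co a b c\<close> is the cosine of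
  the angle opposite to the side \<open>a\<close>, given by an expression that is defined for all lengths; \<open>dco a b c\<close> is its
  differential, applied to velocities of the sides. The sine law says that \<open>sin \<theta> / L a\<close> is the same for all three
  sides.
  
  \<open>form_neg\<close> is infinitesimal rigidity. The velocities in \<open>flat\<close> are excluded from it; they are those which
  do not change the shape of the triangle.
  
  A wall \<open>(k, p, q, r)\<close> stands for the inequality \<open>k + p * a + q * b + r * c > 0\<close>; together the walls describe the triples of
  lengths for which a triangle exists. \<open>wall_convex\<close> is what makes the set of triangles convex in the
  coordinate \<open>g\<close> for \<open>h < -1\<close>: along a path that is straight in this coordinate, the second
  derivative of the left-hand side of the inequality is \<open>h + 1\<close> times the sum in the conclusion.
\<close>

locale cosine_law =
  fixes I :: "real set" and L L' :: "real \<Rightarrow> real"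
    and co :: "real \<Rightarrow> real \<Rightarrow> real \<Rightarrow> real"
    and dco :: "real \<Rightarrow> real \<Rightarrow> real \<Rightarrow> real \<Rightarrow> real \<Rightarrow> real \<Rightarrow> real"
    and walls :: "(real \<times> real \<times> real \<times> real) set"
    and flat :: "real \<Rightarrow> real \<Rightarrow> real \<Rightarrow> real \<Rightarrow> real \<Rightarrow> real \<Rightarrow> bool"
  assumes open_I: "open I" and interval_I: "is_interval I"
    and L_pos: "\<And>x. x \<in> I \<Longrightarrow> L x > 0"
    and L_deriv: "\<And>x. x \<in> I \<Longrightarrow> (L has_real_derivative L' x) (at x)"
    and sine_law: "\<And>a b c. a \<in> I \<Longrightarrow> b \<in> I \<Longrightarrow> c \<in> I \<Longrightarrow>
      (1 - (co a b c)\<^sup>2) * (L b)\<^sup>2 = (1 - (co b c a)\<^sup>2) * (L a)\<^sup>2"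
    and co_deriv: "\<And>\<alpha> \<beta> \<gamma> a' b' c' t.
      (\<alpha> has_real_derivative a') (at t) \<Longrightarrow> (\<beta> has_real_derivative b') (at t) \<Longrightarrow>
      (\<gamma> has_real_derivative c') (at t) \<Longrightarrow> \<alpha> t \<in> I \<Longrightarrow> \<beta> t \<in> I \<Longrightarrow> \<gamma> t \<in> I \<Longrightarrow>
      ((\<lambda>t. co (\<alpha> t) (\<beta> t) (\<gamma> t)) has_real_derivative dco (\<alpha> t) (\<beta> t) (\<gamma> t) a' b' c') (at t)"
    and form_neg: "\<And>a b c a' b' c'. a \<in> I \<Longrightarrow> b \<in> I \<Longrightarrow> c \<in> I \<Longrightarrow> \<bar>co a b c\<bar> < 1 \<Longrightarrow>
      \<bar>co b c a\<bar> < 1 \<Longrightarrow> \<bar>co c a b\<bar> < 1 \<Longrightarrow>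
      \<not> flat a b c a' b' c' \<Longrightarrow>
      a' * dco a b c a' b' c' / (L a)\<^sup>2 + b' * dco b c a b' c' a' / (L b)\<^sup>2
        + c' * dco c a b c' a' b' / (L c)\<^sup>2 < 0"
    and inside: "\<And>a b c. a \<in> I \<Longrightarrow> b \<in> I \<Longrightarrow> c \<in> I \<Longrightarrow>
      (\<And>k p q r. (k, p, q, r) \<in> walls \<Longrightarrow> k + p * a + q * b + r * c > 0) \<Longrightarrow> \<bar>co a b c\<bar> < 1"
    and wall_convex: "\<And>k p q r a b c a' b' c'. (k, p, q, r) \<in> walls \<Longrightarrow> a \<in> I \<Longrightarrow> b \<in> I \<Longrightarrow> c \<in> I \<Longrightarrow>
      k + p * a + q * b + r * c \<le> 0 \<Longrightarrow> p * a' + q * b' + r * c' = 0 \<Longrightarrow> \<not> flat a b c a' b' c' \<Longrightarrow>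
      p * (L' a / L a * a'\<^sup>2) + q * (L' b / L b * b'\<^sup>2) + r * (L' c / L c * c'\<^sup>2) > 0"
begin

text \<open>
  By the sine law the three angles degenerate at the same time.
\<close>

lemma nondegenerate_rotate:
  assumes "a \<in> I" "b \<in> I" "c \<in> I" "\<bar>co a b c\<bar> < 1"
  shows "\<bar>co b c a\<bar> < 1"
proof -
  have "(1 - (co a b c)\<^sup>2) * (L b)\<^sup>2 > 0"
    using assms L_pos[of b] by (simp add: abs_square_less_1)
  with sine_law[OF assms(1,2,3)] have "(1 - (co b c a)\<^sup>2) * (L a)\<^sup>2 > 0" by simp
  then have "1 - (co b c a)\<^sup>2 > 0" by (simp add: zero_less_mult_iff)
  then show ?thesis by (simp add: abs_square_less_1)
qed

definition triangle :: "real \<Rightarrow> real \<Rightarrow> real \<Rightarrow> bool" where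
  "triangle a b c \<longleftrightarrow> a \<in> I \<and> b \<in> I \<and> c \<in> I \<and>
     (\<forall>(k, p, q, r)\<in>walls. k + p * a + q * b + r * c > 0)"

text \<open>
  By the sine law \<open>1 - co\<^sup>2 = \<kappa> * L\<^sup>2\<close> with a common \<open>\<kappa>\<close>. Hence the factors \<open>(1 - co\<^sup>2) powr ((h - 1) / 2)\<close> from
  the integrals, multiplied by \<open>u\<close>, \<open>v\<close> and \<open>w\<close>, are \<open>\<kappa> powr ((h - 1) / 2)\<close> times the velocities of the
  sides divided by \<open>L\<^sup>2\<close>. So \<open>h\<close> disappears from the quadratic form and only changes the positive factor.
\<close>

lemma angle_form_positive:
  fixes \<alpha> \<beta> \<gamma> :: "real \<Rightarrow> real" and u v w h t
  assumes P: "\<And>x. \<bar>x\<bar> < 1 \<Longrightarrow> (P has_real_derivative - ((1 - x\<^sup>2) powr ((h - 1) / 2))) (at x)"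
    and mem: "\<alpha> t \<in> I" "\<beta> t \<in> I" "\<gamma> t \<in> I"
    and d\<alpha>: "(\<alpha> has_real_derivative u * L (\<alpha> t) powr (h + 1)) (at t)"
    and d\<beta>: "(\<beta> has_real_derivative v * L (\<beta> t) powr (h + 1)) (at t)"
    and d\<gamma>: "(\<gamma> has_real_derivative w * L (\<gamma> t) powr (h + 1)) (at t)"
    and nonflat: "\<not> flat (\<alpha> t) (\<beta> t) (\<gamma> t) (u * L (\<alpha> t) powr (h + 1))
      (v * L (\<beta> t) powr (h + 1)) (w * L (\<gamma> t) powr (h + 1))"
    and nondeg: "\<bar>co (\<alpha> t) (\<beta> t) (\<gamma> t)\<bar> < 1"
  shows "\<exists>d>0. ((\<lambda>t. u * P (co (\<alpha> t) (\<beta> t) (\<gamma> t)) + v * P (co (\<beta> t) (\<gamma> t) (\<alpha> t))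
    + w * P (co (\<gamma> t) (\<alpha> t) (\<beta> t))) has_real_derivative d) (at t)"
proof -
  let ?a = "\<alpha> t" and ?b = "\<beta> t" and ?c = "\<gamma> t"
  define a' b' c' where "a' = u * L ?a powr (h + 1)" and "b' = v * L ?b powr (h + 1)"
    and "c' = w * L ?c powr (h + 1)"
  note der = d\<alpha>[folded a'_def] d\<beta>[folded b'_def] d\<gamma>[folded c'_def]
  have nd2: "\<bar>co ?b ?c ?a\<bar> < 1" by (rule nondegenerate_rotate[OF mem nondeg])
  have nd3: "\<bar>co ?c ?a ?b\<bar> < 1" by (rule nondegenerate_rotate[OF mem(2,3,1) nd2])
  define \<kappa> where "\<kappa> = (1 - (co ?a ?b ?c)\<^sup>2) / (L ?a)\<^sup>2"
  have L: "L ?a > 0" "L ?b > 0" "L ?c > 0" using mem L_pos by auto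
  have "1 - (co ?a ?b ?c)\<^sup>2 > 0" using nondeg by (simp add: abs_square_less_1)
  then have \<kappa>: "\<kappa> > 0" using L by (simp add: \<kappa>_def)
  have s1: "1 - (co ?a ?b ?c)\<^sup>2 = \<kappa> * (L ?a)\<^sup>2" using L by (simp add: \<kappa>_def)
  have s2: "1 - (co ?b ?c ?a)\<^sup>2 = \<kappa> * (L ?b)\<^sup>2"
    using sine_law[OF mem] L by (simp add: \<kappa>_def field_simps)
  have s3: "1 - (co ?c ?a ?b)\<^sup>2 = \<kappa> * (L ?c)\<^sup>2"
  proof -
    have "(1 - (co ?c ?a ?b)\<^sup>2) * (L ?b)\<^sup>2 = (1 - (co ?b ?c ?a)\<^sup>2) * (L ?c)\<^sup>2"
      by (rule sine_law[OF mem(2,3,1), symmetric])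
    also have "\<dots> = \<kappa> * (L ?c)\<^sup>2 * (L ?b)\<^sup>2"
      unfolding s2 by simp
    finally show ?thesis
      using L(2) by (metis less_irrefl mult_right_cancel zero_less_power)
  qed
  have pw: "y * (\<kappa> * (L x)\<^sup>2) powr ((h - 1) / 2) = \<kappa> powr ((h - 1) / 2) * (y * L x powr (h + 1) / (L x)\<^sup>2)"
    if "L x > 0" for x y
  proof -
    have "(\<kappa> * (L x)\<^sup>2) powr ((h - 1) / 2) = \<kappa> powr ((h - 1) / 2) * (L x) powr (h - 1)"
    proof -
      have "2 * ((h - 1) / 2) = h - 1" by simp
      then show ?thesis
        using \<kappa> that by (simp only: powr_mult powr_powr zero_le_power2 less_imp_le flip: powr_numeral)
    qed
    also have "L x powr (h - 1) = L x powr (h + 1) / (L x)\<^sup>2"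
      using that powr_diff[of "L x" "h + 1" 2] by simp
    finally show ?thesis by simp
  qed
  have D: "((\<lambda>t. P (co (\<alpha> t) (\<beta> t) (\<gamma> t))) has_real_derivative
      - ((1 - (co ?a ?b ?c)\<^sup>2) powr ((h - 1) / 2)) * dco ?a ?b ?c a' b' c') (at t)"
    "((\<lambda>t. P (co (\<beta> t) (\<gamma> t) (\<alpha> t))) has_real_derivative
      - ((1 - (co ?b ?c ?a)\<^sup>2) powr ((h - 1) / 2)) * dco ?b ?c ?a b' c' a') (at t)"
    "((\<lambda>t. P (co (\<gamma> t) (\<alpha> t) (\<beta> t))) has_real_derivative
      - ((1 - (co ?c ?a ?b)\<^sup>2) powr ((h - 1) / 2)) * dco ?c ?a ?b c' a' b') (at t)"
    by (rule DERIV_chain2[where f = P, OF P[OF nondeg] co_deriv[OF der mem]]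
          DERIV_chain2[where f = P, OF P[OF nd2] co_deriv[OF der(2,3,1) mem(2,3,1)]]
          DERIV_chain2[where f = P, OF P[OF nd3] co_deriv[OF der(3,1,2) mem(3,1,2)]])+
  let ?d = "u * (- ((1 - (co ?a ?b ?c)\<^sup>2) powr ((h - 1) / 2)) * dco ?a ?b ?c a' b' c')
    + v * (- ((1 - (co ?b ?c ?a)\<^sup>2) powr ((h - 1) / 2)) * dco ?b ?c ?a b' c' a')
    + w * (- ((1 - (co ?c ?a ?b)\<^sup>2) powr ((h - 1) / 2)) * dco ?c ?a ?b c' a' b')"
  have "?d = - (dco ?a ?b ?c a' b' c' * (u * (\<kappa> * (L ?a)\<^sup>2) powr ((h - 1) / 2))
      + dco ?b ?c ?a b' c' a' * (v * (\<kappa> * (L ?b)\<^sup>2) powr ((h - 1) / 2))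
      + dco ?c ?a ?b c' a' b' * (w * (\<kappa> * (L ?c)\<^sup>2) powr ((h - 1) / 2)))"
    unfolding s1 s2 s3 by (simp add: algebra_simps)
  also have "\<dots> = - (\<kappa> powr ((h - 1) / 2) * (a' * dco ?a ?b ?c a' b' c' / (L ?a)\<^sup>2
      + b' * dco ?b ?c ?a b' c' a' / (L ?b)\<^sup>2 + c' * dco ?c ?a ?b c' a' b' / (L ?c)\<^sup>2))"
    unfolding pw[OF L(1)] pw[OF L(2)] pw[OF L(3)]
      a'_def[symmetric] b'_def[symmetric] c'_def[symmetric]
    by (simp add: algebra_simps)
  also have "\<dots> > 0"
    using form_neg[OF mem nondeg nd2 nd3 nonflat[folded a'_def b'_def c'_def]] \<kappa>
    by (simp add: mult_less_0_iff)
  finally have "?d > 0" .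
  moreover have "((\<lambda>t. u * P (co (\<alpha> t) (\<beta> t) (\<gamma> t)) + v * P (co (\<beta> t) (\<gamma> t) (\<alpha> t))
    + w * P (co (\<gamma> t) (\<alpha> t) (\<beta> t))) has_real_derivative ?d) (at t)"
    by (intro DERIV_add DERIV_cmult D)
  ultimately show ?thesis by blast
qed

text \<open>
  By \<open>wall_convex\<close>, the left-hand side of each wall inequality is strictly concave at those of its critical points where it is
  not positive. For \<open>h = -1\<close> the coordinate is the length itself, and the walls are affine.
\<close>

lemma triangles_convex:
  fixes \<alpha> \<beta> \<gamma> :: "real \<Rightarrow> real"
  assumes h: "h \<le> -1"
    and mem: "\<And>t. t \<in> {0..1} \<Longrightarrow> \<alpha> t \<in> I \<and> \<beta> t \<in> I \<and> \<gamma> t \<in> I"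
    and d\<alpha>: "\<And>t. t \<in> {0..1} \<Longrightarrow> (\<alpha> has_real_derivative u * L (\<alpha> t) powr (h + 1)) (at t)"
    and d\<beta>: "\<And>t. t \<in> {0..1} \<Longrightarrow> (\<beta> has_real_derivative v * L (\<beta> t) powr (h + 1)) (at t)"
    and d\<gamma>: "\<And>t. t \<in> {0..1} \<Longrightarrow> (\<gamma> has_real_derivative w * L (\<gamma> t) powr (h + 1)) (at t)"
    and nonflat: "\<And>t. t \<in> {0..1} \<Longrightarrow> \<not> flat (\<alpha> t) (\<beta> t) (\<gamma> t) (u * L (\<alpha> t) powr (h + 1))
      (v * L (\<beta> t) powr (h + 1)) (w * L (\<gamma> t) powr (h + 1))"
    and ends: "triangle (\<alpha> 0) (\<beta> 0) (\<gamma> 0)" "triangle (\<alpha> 1) (\<beta> 1) (\<gamma> 1)"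
    and t: "t \<in> {0..1}"
  shows "triangle (\<alpha> t) (\<beta> t) (\<gamma> t)"
proof -
  have dd: "((\<lambda>s. u * L (f s) powr (h + 1)) has_real_derivative
      (h + 1) * (L' (f s) / L (f s) * (u * L (f s) powr (h + 1))\<^sup>2)) (at s)"
    if "f s \<in> I" "(f has_real_derivative u * L (f s) powr (h + 1)) (at s)" for f u s
  proof -
    have "L (f s) > 0" using L_pos that by blast
    have "((\<lambda>s. L (f s)) has_real_derivative L' (f s) * (u * L (f s) powr (h + 1))) (at s)"
      by (rule DERIV_chain2[OF L_deriv[OF that(1)] that(2)])
    from DERIV_cmult[OF DERIV_powr[OF this \<open>L (f s) > 0\<close> DERIV_const]]
    have "((\<lambda>s. u * L (f s) powr (h + 1)) has_real_derivative
       u * (L (f s) powr (h + 1) * (0 * ln (L (f s)) + L' (f s) * (u * L (f s) powr (h + 1)) * (h + 1) / L (f s)))) (at s)" .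
    then show ?thesis by (simp add: power2_eq_square algebra_simps)
  qed
  have "k + p * \<alpha> t + q * \<beta> t + r * \<gamma> t > 0" if wall: "(k, p, q, r) \<in> walls" for k p q r
  proof -
    let ?\<delta> = "\<lambda>t. k + p * \<alpha> t + q * \<beta> t + r * \<gamma> t"
    let ?a = "\<lambda>t. u * L (\<alpha> t) powr (h + 1)" and ?b = "\<lambda>t. v * L (\<beta> t) powr (h + 1)"
      and ?c = "\<lambda>t. w * L (\<gamma> t) powr (h + 1)"
    have d1: "(?\<delta> has_real_derivative p * ?a s + q * ?b s + r * ?c s) (at s)" if "s \<in> {0..1}" for s
      using DERIV_add[OF DERIV_add[OF DERIV_add[OF DERIV_const[of k] DERIV_cmult[OF d\<alpha>[OF that], of p]]
          DERIV_cmult[OF d\<beta>[OF that], of q]] DERIV_cmult[OF d\<gamma>[OF that], of r]] by simp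
    have ends': "?\<delta> 0 > 0" "?\<delta> 1 > 0" using ends wall by (auto simp: triangle_def)
    show ?thesis
    proof (cases "h = -1")
      case True
      show ?thesis
      proof (rule positive_if_constant_slope[of ?\<delta>, OF _ ends' t])
        fix s :: real assume s: "s \<in> {0..1}"
        have "L (\<alpha> s) > 0" "L (\<beta> s) > 0" "L (\<gamma> s) > 0" using mem[OF s] L_pos by auto
        then show "(?\<delta> has_real_derivative p * u + q * v + r * w) (at s)"
          using d1[OF s] True by simp
      qed
    next
      case False
      show ?thesis
      proof (rule positive_if_concave_at_nonpositive_critical_points[of ?\<delta>, OF d1 _ ends' _ t])
        fix s :: real assume s: "s \<in> {0..1}"
        let ?m = "\<lambda>f u. L' (f s) / L (f s) * (u * L (f s) powr (h + 1))\<^sup>2"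
        show "((\<lambda>s. p * ?a s + q * ?b s + r * ?c s) has_real_derivative
          p * ((h + 1) * ?m \<alpha> u) + q * ((h + 1) * ?m \<beta> v) + r * ((h + 1) * ?m \<gamma> w)) (at s)"
          using mem[OF s] d\<alpha>[OF s] d\<beta>[OF s] d\<gamma>[OF s]
          by (intro DERIV_add DERIV_cmult dd) auto
        assume "?\<delta> s \<le> 0" "p * ?a s + q * ?b s + r * ?c s = 0"
        then have "p * ?m \<alpha> u + q * ?m \<beta> v + r * ?m \<gamma> w > 0"
          using mem[OF s] nonflat[OF s] by (intro wall_convex[OF wall]) auto
        moreover have "h + 1 < 0" using h False by simp
        ultimately have "(h + 1) * (p * ?m \<alpha> u + q * ?m \<beta> v + r * ?m \<gamma> w) < 0"
          by (rule mult_neg_pos[rotated])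
        then show "p * ((h + 1) * ?m \<alpha> u) + q * ((h + 1) * ?m \<beta> v) + r * ((h + 1) * ?m \<gamma> w) < 0"
          by (simp add: algebra_simps)
      qed
    qed
  qed
  then show ?thesis using mem[OF t] by (auto simp: triangle_def)
qed

lemma triangle_nondegenerate: "triangle a b c \<Longrightarrow> \<bar>co a b c\<bar> < 1"
  by (rule inside) (auto simp: triangle_def)

text \<open>
  The monotonicity inequality. The function \<open>G\<close> below increases along the path from one triangle to the other that is
  straight in the coordinate \<open>g\<close>; \<open>nonflat\<close> guarantees that no velocity on this path is excluded from
  the definiteness of the form.
\<close>

lemma triangle_monotone:
  assumes g: "\<And>x. x \<in> I \<Longrightarrow> (g has_real_derivative L x powr (- h - 1)) (at x)"
    and tri: "triangle a b c" "triangle a' b' c'"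
    and nonflat: "\<And>t x y z. t \<in> {0..1} \<Longrightarrow> x \<in> I \<Longrightarrow> y \<in> I \<Longrightarrow> z \<in> I \<Longrightarrow>
      g x = g a + t * (g a' - g a) \<Longrightarrow> g y = g b + t * (g b' - g b) \<Longrightarrow> g z = g c + t * (g c' - g c) \<Longrightarrow>
      \<not> flat x y z ((g a' - g a) * L x powr (h + 1)) ((g b' - g b) * L y powr (h + 1))
         ((g c' - g c) * L z powr (h + 1))"
  shows "0 < (sin_power_integral h (arccos (co a' b' c')) - sin_power_integral h (arccos (co a b c))) * (g a' - g a)
    + (sin_power_integral h (arccos (co b' c' a')) - sin_power_integral h (arccos (co b c a))) * (g b' - g b)
    + (sin_power_integral h (arccos (co c' a' b')) - sin_power_integral h (arccos (co c a b))) * (g c' - g c)"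
proof -
  define u v w where "u = g a' - g a" and "v = g b' - g b" and "w = g c' - g c"
  have wpos: "L x powr (- h - 1) > 0" if "x \<in> I" for x using L_pos[OF that] by simp
  have memI: "a \<in> I" "b \<in> I" "c \<in> I" "a' \<in> I" "b' \<in> I" "c' \<in> I"
    using tri by (auto simp: triangle_def)
  note path = path_linear_in_coordinate[OF open_I interval_I g wpos]
  obtain \<alpha> where \<alpha>: "\<alpha> 0 = a" "\<alpha> 1 = a'" "\<And>t. t \<in> {0..1} \<Longrightarrow> \<alpha> t \<in> I"
    "\<And>t. t \<in> {0..1} \<Longrightarrow> g (\<alpha> t) = g a + t * (g a' - g a)"
    "\<And>t. t \<in> {0..1} \<Longrightarrow> (\<alpha> has_real_derivative (g a' - g a) / L (\<alpha> t) powr (- h - 1)) (at t)"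
    using path[of a a'] memI by blast
  obtain \<beta> where \<beta>: "\<beta> 0 = b" "\<beta> 1 = b'" "\<And>t. t \<in> {0..1} \<Longrightarrow> \<beta> t \<in> I"
    "\<And>t. t \<in> {0..1} \<Longrightarrow> g (\<beta> t) = g b + t * (g b' - g b)"
    "\<And>t. t \<in> {0..1} \<Longrightarrow> (\<beta> has_real_derivative (g b' - g b) / L (\<beta> t) powr (- h - 1)) (at t)"
    using path[of b b'] memI by blast
  obtain \<gamma> where \<gamma>: "\<gamma> 0 = c" "\<gamma> 1 = c'" "\<And>t. t \<in> {0..1} \<Longrightarrow> \<gamma> t \<in> I"
    "\<And>t. t \<in> {0..1} \<Longrightarrow> g (\<gamma> t) = g c + t * (g c' - g c)"
    "\<And>t. t \<in> {0..1} \<Longrightarrow> (\<gamma> has_real_derivative (g c' - g c) / L (\<gamma> t) powr (- h - 1)) (at t)"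
    using path[of c c'] memI by blast
  have inv: "y / L x powr (- h - 1) = y * L x powr (h + 1)" for x y
  proof -
    have "L x powr (- h - 1) = inverse (L x powr (h + 1))"
      using powr_minus[of "L x" "h + 1"] by simp
    then show ?thesis by (simp add: divide_inverse)
  qed
  have d\<alpha>: "(\<alpha> has_real_derivative u * L (\<alpha> t) powr (h + 1)) (at t)" if "t \<in> {0..1}" for t
    using \<alpha>(5)[OF that] unfolding inv u_def .
  have d\<beta>: "(\<beta> has_real_derivative v * L (\<beta> t) powr (h + 1)) (at t)" if "t \<in> {0..1}" for t
    using \<beta>(5)[OF that] unfolding inv v_def .
  have d\<gamma>: "(\<gamma> has_real_derivative w * L (\<gamma> t) powr (h + 1)) (at t)" if "t \<in> {0..1}" for t
    using \<gamma>(5)[OF that] unfolding inv w_def .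
  have nf: "\<not> flat (\<alpha> t) (\<beta> t) (\<gamma> t) (u * L (\<alpha> t) powr (h + 1))
      (v * L (\<beta> t) powr (h + 1)) (w * L (\<gamma> t) powr (h + 1))" if "t \<in> {0..1}" for t
    using nonflat[OF that \<alpha>(3)[OF that] \<beta>(3)[OF that] \<gamma>(3)[OF that] \<alpha>(4)[OF that] \<beta>(4)[OF that] \<gamma>(4)[OF that]]
    by (simp add: u_def v_def w_def)
  have mem: "\<alpha> t \<in> I \<and> \<beta> t \<in> I \<and> \<gamma> t \<in> I" if "t \<in> {0..1}" for t
    using \<alpha>(3) \<beta>(3) \<gamma>(3) that by blast
  obtain P where P: "\<And>x. \<bar>x\<bar> < 1 \<Longrightarrow> P x = sin_power_integral h (arccos x)"
    "\<And>x. \<bar>x\<bar> < 1 \<Longrightarrow> (P has_real_derivative - ((1 - x\<^sup>2) powr ((h - 1) / 2))) (at x)"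
    "h > -1 \<Longrightarrow> continuous_on UNIV P"
    "\<And>x. h > -1 \<Longrightarrow> \<bar>x\<bar> \<ge> 1 \<Longrightarrow> P x \<in> {P 1, P (- 1)}"
    using sin_power_integral_arccos[of h] by blast
  define C1 C2 C3 where "C1 t = co (\<alpha> t) (\<beta> t) (\<gamma> t)" and "C2 t = co (\<beta> t) (\<gamma> t) (\<alpha> t)"
    and "C3 t = co (\<gamma> t) (\<alpha> t) (\<beta> t)" for t
  define G where "G t = u * P (C1 t) + v * P (C2 t) + w * P (C3 t)" for t
  \<comment> \<open>The degenerate times; the other two cosines give the same set.\<close>
  define D where "D = {t \<in> {0..1}. \<bar>C1 t\<bar> \<ge> 1}"
  have Cc: "isCont C1 t" "isCont C2 t" "isCont C3 t" if "t \<in> {0..1}" for t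
    unfolding C1_def C2_def C3_def
    using DERIV_isCont[OF co_deriv[OF d\<alpha>[OF that] d\<beta>[OF that] d\<gamma>[OF that]]]
      DERIV_isCont[OF co_deriv[OF d\<beta>[OF that] d\<gamma>[OF that] d\<alpha>[OF that]]]
      DERIV_isCont[OF co_deriv[OF d\<gamma>[OF that] d\<alpha>[OF that] d\<beta>[OF that]]] mem[OF that]
    by blast+
  have der: "\<exists>d>0. (G has_real_derivative d) (at t)" if "t \<in> {0..1}" "t \<notin> D" for t
    unfolding G_def C1_def C2_def C3_def
    using mem[OF that(1)] d\<alpha>[OF that(1)] d\<beta>[OF that(1)] d\<gamma>[OF that(1)] nf[OF that(1)] that
    by (intro angle_form_positive[OF P(2)]) (auto simp: D_def C1_def)
  have ends: "\<bar>C1 0\<bar> < 1" "\<bar>C1 1\<bar> < 1"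
    using triangle_nondegenerate tri by (auto simp: C1_def \<alpha> \<beta> \<gamma>)
  have "G 0 < G 1"
  proof -
    have "continuous_on {0..1} G \<and> finite (G ` D)"
    proof (cases "h > -1")
      case True
      have "isCont P x" for x using P(3)[OF True] continuous_on_eq_continuous_at by blast
      then have "isCont (\<lambda>t. P (C1 t)) t" "isCont (\<lambda>t. P (C2 t)) t" "isCont (\<lambda>t. P (C3 t)) t"
        if "t \<in> {0..1}" for t
        using Cc[OF that] by (auto intro: isCont_o2)
      then have "isCont G t" if "t \<in> {0..1}" for t
        unfolding G_def using that by (intro isCont_add isCont_mult continuous_const) auto
      then have "continuous_on {0..1} G" by (simp add: continuous_at_imp_continuous_on)
      \<comment> \<open>At a degenerate time each of the three values of \<open>P\<close> is \<open>P 1\<close> or \<open>P (-1)\<close>.\<close>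
      moreover have "G ` D \<subseteq> (\<lambda>(x, y, z). u * x + v * y + w * z) `
          ({P 1, P (-1)} \<times> {P 1, P (-1)} \<times> {P 1, P (-1)})"
      proof
        fix y assume "y \<in> G ` D"
        then obtain t where t: "t \<in> D" "y = G t" by blast
        then have t01: "t \<in> {0..1}" and 1: "\<not> \<bar>C1 t\<bar> < 1" by (auto simp: D_def)
        have 3: "\<not> \<bar>C3 t\<bar> < 1"
          using nondegenerate_rotate[of "\<gamma> t" "\<alpha> t" "\<beta> t"] mem[OF t01] 1 by (auto simp: C1_def C3_def)
        have 2: "\<not> \<bar>C2 t\<bar> < 1"
          using nondegenerate_rotate[of "\<beta> t" "\<gamma> t" "\<alpha> t"] mem[OF t01] 3 by (auto simp: C2_def C3_def)
        have "(P (C1 t), P (C2 t), P (C3 t)) \<in> {P 1, P (-1)} \<times> {P 1, P (-1)} \<times> {P 1, P (-1)}"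
          using P(4)[OF True] 1 2 3 by (intro SigmaI) auto
        then show "y \<in> (\<lambda>(x, y, z). u * x + v * y + w * z) `
          ({P 1, P (-1)} \<times> {P 1, P (-1)} \<times> {P 1, P (-1)})"
          unfolding t(2) G_def by (rule rev_image_eqI) simp
      qed
      ultimately show ?thesis by (auto intro: finite_subset)
    next
      case False
      have "triangle (\<alpha> t) (\<beta> t) (\<gamma> t)" if "t \<in> {0..1}" for t
        by (rule triangles_convex[of h \<alpha> \<beta> \<gamma> u v w])
           (use False mem d\<alpha> d\<beta> d\<gamma> nf tri that in \<open>auto simp: \<alpha> \<beta> \<gamma>\<close>)
      then have "D = {}" using triangle_nondegenerate unfolding D_def C1_def by force
      then show ?thesis
        using der DERIV_isCont by (metis continuous_at_imp_continuous_on empty_iff finite.emptyI image_empty)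
    qed
    \<comment> \<open>Some time after the start is nondegenerate, because the first triangle is.\<close>
    moreover obtain s where "0 < s" "s < 1" "s \<notin> D"
    proof -
      have "isCont (\<lambda>t. \<bar>C1 t\<bar>) 0" using Cc(1)[of 0] by (intro continuous_intros) auto
      then have "\<forall>\<^sub>F t in at 0. \<bar>C1 t\<bar> < 1"
        unfolding isCont_def by (rule order_tendstoD) (rule ends)
      then obtain e where e: "e > 0" "\<And>t. t \<noteq> 0 \<Longrightarrow> dist t 0 < e \<Longrightarrow> \<bar>C1 t\<bar> < 1"
        unfolding eventually_at by auto
      show ?thesis
        by (rule that[of "min (e/2) (1/2)"]) (use e(1) e(2)[of "min (e/2) (1/2)"] in \<open>auto simp: D_def min_def\<close>)
    qed
    ultimately show ?thesis
      using der by (intro strict_mono_off_finite_image[of 0 1 G D s]) auto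
  qed
  moreover have "G 0 = u * sin_power_integral h (arccos (co a b c)) + v * sin_power_integral h (arccos (co b c a))
     + w * sin_power_integral h (arccos (co c a b))"
    using triangle_nondegenerate[OF tri(1)] nondegenerate_rotate[of a b c] nondegenerate_rotate[of b c a] memI
    by (simp add: G_def C1_def C2_def C3_def \<alpha> \<beta> \<gamma> P(1))
  moreover have "G 1 = u * sin_power_integral h (arccos (co a' b' c')) + v * sin_power_integral h (arccos (co b' c' a'))
     + w * sin_power_integral h (arccos (co c' a' b'))"
    using triangle_nondegenerate[OF tri(2)] nondegenerate_rotate[of a' b' c'] nondegenerate_rotate[of b' c' a'] memI
    by (simp add: G_def C1_def C2_def C3_def \<alpha> \<beta> \<gamma> P(1))
  ultimately show ?thesis
    by (simp add: u_def[symmetric] v_def[symmetric] w_def[symmetric] algebra_simps)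
qed

lemma coordinate_inj:
  assumes g: "\<And>x. x \<in> I \<Longrightarrow> (g has_real_derivative L x powr (- h - 1)) (at x)"
    and "x \<in> I" "y \<in> I" "g x = g y"
  shows "x = y"
proof -
  have less: "g x < g y" if "x \<in> I" "y \<in> I" "x < y" for x y
  proof (rule DERIV_pos_imp_increasing[OF \<open>x < y\<close>])
    fix z assume "x \<le> z" "z \<le> y"
    then have "z \<in> I" using interval_I that by (meson mem_is_interval_1_I)
    then show "\<exists>d. (g has_real_derivative d) (at z) \<and> d > 0"
      using g L_pos by (intro exI[of _ "L z powr (- h - 1)"]) (auto dest: less_imp_neq[OF L_pos])
  qed
  then show ?thesis using assms(2-4) by (metis less_irrefl linorder_neqE)
qed

lemma triangle_monotone_distinct:
  assumes flat: "\<And>a b c a' b' c'. flat a b c a' b' c' \<longleftrightarrow> a' = 0 \<and> b' = 0 \<and> c' = 0"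
    and g: "\<And>x. x \<in> I \<Longrightarrow> (g has_real_derivative L x powr (- h - 1)) (at x)"
    and tri: "triangle a b c" "triangle a' b' c'" and neq: "\<not> (a' = a \<and> b' = b \<and> c' = c)"
  shows "0 < (sin_power_integral h (arccos (co a' b' c')) - sin_power_integral h (arccos (co a b c))) * (g a' - g a)
    + (sin_power_integral h (arccos (co b' c' a')) - sin_power_integral h (arccos (co b c a))) * (g b' - g b)
    + (sin_power_integral h (arccos (co c' a' b')) - sin_power_integral h (arccos (co c a b))) * (g c' - g c)"
proof (rule triangle_monotone[OF g tri])
  fix t x y z assume "x \<in> I" "y \<in> I" "z \<in> I"
  then have "L x \<noteq> 0" "L y \<noteq> 0" "L z \<noteq> 0" using L_pos by (metis less_irrefl)+
  moreover have "\<not> (g a' - g a = 0 \<and> g b' - g b = 0 \<and> g c' - g c = 0)"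
    using neq coordinate_inj[of g h, OF g] tri by (auto simp: triangle_def)
  ultimately show "\<not> flat x y z ((g a' - g a) * L x powr (h + 1)) ((g b' - g b) * L y powr (h + 1))
         ((g c' - g c) * L z powr (h + 1))"
    unfolding flat by simp
qed

lemma coordinate_exists:
  assumes I: "I = {x. p < ereal x \<and> ereal x < q}" and "p < q"
  obtains g where "\<And>x. x \<in> I \<Longrightarrow> (g has_real_derivative L x powr (- h - 1)) (at x)"
proof -
  have "\<exists>g. \<forall>x. p < ereal x \<longrightarrow> ereal x < q \<longrightarrow> (g has_vector_derivative L x powr (- h - 1)) (at x)"
  proof (rule einterval_antiderivative[OF \<open>p < q\<close>])
    fix x assume "p < ereal x" "ereal x < q"
    then have x: "x \<in> I" by (simp add: I)
    have "isCont L x" using DERIV_isCont[OF L_deriv[OF x]] .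
    moreover have "L x \<noteq> 0" using L_pos[OF x] by simp
    ultimately show "isCont (\<lambda>x. L x powr (- h - 1)) x" by (intro continuous_intros) auto
  qed
  then show ?thesis using that by (auto simp: I has_real_derivative_iff_has_vector_derivative)
qed

definition angle :: "('f, 'e) triangulation \<Rightarrow> ('e \<Rightarrow> real) \<Rightarrow> 'f \<Rightarrow> 3 \<Rightarrow> real" where
  "angle t l f i = arccos (co (l (side_edge t f i)) (l (side_edge t f (i + 1))) (l (side_edge t f (i + 2))))"

definition triangle_face :: "('f, 'e) triangulation \<Rightarrow> ('e \<Rightarrow> real) \<Rightarrow> 'f \<Rightarrow> bool" where
  "triangle_face t l f \<longleftrightarrow> triangle (l (side_edge t f 0)) (l (side_edge t f 1)) (l (side_edge t f 2))"

lemma face_sum: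
  "(\<Sum>i\<in>UNIV. (sin_power_integral h (angle t l' f i) - sin_power_integral h (angle t l f i)) * w (side_edge t f i))
   = (sin_power_integral h (arccos (co (l' (side_edge t f 0)) (l' (side_edge t f 1)) (l' (side_edge t f 2))))
      - sin_power_integral h (arccos (co (l (side_edge t f 0)) (l (side_edge t f 1)) (l (side_edge t f 2))))) * w (side_edge t f 0)
   + (sin_power_integral h (arccos (co (l' (side_edge t f 1)) (l' (side_edge t f 2)) (l' (side_edge t f 0))))
      - sin_power_integral h (arccos (co (l (side_edge t f 1)) (l (side_edge t f 2)) (l (side_edge t f 0))))) * w (side_edge t f 1)
   + (sin_power_integral h (arccos (co (l' (side_edge t f 2)) (l' (side_edge t f 0)) (l' (side_edge t f 1))))
      - sin_power_integral h (arccos (co (l (side_edge t f 2)) (l (side_edge t f 0)) (l (side_edge t f 1))))) * w (side_edge t f 2)"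
  unfolding sum_index angle_def index_values by (rule refl)

text \<open>
  The spherical and the hyperbolic case of the theorem. In the Euclidean plane, scaling does not change the angles, so that
  the hypothesis \<open>flat\<close> fails.
\<close>

lemma rigidity:
  assumes flat: "\<And>a b c a' b' c'. flat a b c a' b' c' \<longleftrightarrow> a' = 0 \<and> b' = 0 \<and> c' = 0"
    and I: "I = {x. p < ereal x \<and> ereal x < q}" and "p < q"
    and fin: "finite (faces t)"
    and tri: "\<And>f. f \<in> faces t \<Longrightarrow> triangle_face t l f" "\<And>f. f \<in> faces t \<Longrightarrow> triangle_face t l' f"
    and same: "\<And>e. e \<in> edges t \<Longrightarrow> (\<Sum>(f, i)\<in>sides_of t e. sin_power_integral h (angle t l f i))
      = (\<Sum>(f, i)\<in>sides_of t e. sin_power_integral h (angle t l' f i))"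
    and e: "e \<in> edges t"
  shows "l e = l' e"
proof -
  obtain g where g: "\<And>x. x \<in> I \<Longrightarrow> (g has_real_derivative L x powr (- h - 1)) (at x)"
    using coordinate_exists[OF I \<open>p < q\<close>] by blast
  obtain f i where fi: "f \<in> faces t" "e = side_edge t f i" using e by (auto simp: edges_def)
  have "\<forall>i. l' (side_edge t f i) = l (side_edge t f i)"
  proof (rule faces_equal_if_edge_sums_equal[OF fin same _ _ fi(1), where w = "\<lambda>e. g (l' e) - g (l e)"])
    fix f assume f: "f \<in> faces t" and "\<not> (\<forall>i. l' (side_edge t f i) = l (side_edge t f i))"
    then have "\<not> (l' (side_edge t f 0) = l (side_edge t f 0) \<and> l' (side_edge t f 1) = l (side_edge t f 1)
        \<and> l' (side_edge t f 2) = l (side_edge t f 2))"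
      unfolding all_index by auto
    from triangle_monotone_distinct[OF flat g tri(1)[OF f, unfolded triangle_face_def] tri(2)[OF f, unfolded triangle_face_def] this]
    show "0 < (\<Sum>i\<in>UNIV. (sin_power_integral h (angle t l' f i) - sin_power_integral h (angle t l f i))
        * (g (l' (side_edge t f i)) - g (l (side_edge t f i))))"
      unfolding face_sum[where w = "\<lambda>e. g (l' e) - g (l e)"] .
  qed auto
  then show ?thesis by (simp add: fi)
qed

end

section \<open>Euclidean triangles\<close>

definition triangle_walls :: "(real \<times> real \<times> real \<times> real) set" where
  "triangle_walls = {(0, -1, 1, 1), (0, 1, -1, 1), (0, 1, 1, -1)}"

definition euclidean_cos :: "real \<Rightarrow> real \<Rightarrow> real \<Rightarrow> real" where
  "euclidean_cos a b c = (b\<^sup>2 + c\<^sup>2 - a\<^sup>2) / (2 * b * c)"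

text \<open>
  The case \<open>a = b + c\<close> is the Cauchy--Schwarz inequality, and a larger \<open>a\<close> only helps.
  Equality needs \<open>a = b + c\<close> and velocities that are proportional to the lengths.
\<close>

lemma euclidean_wall:
  fixes a b c u v :: real
  assumes "0 < b" "0 < c" "b + c \<le> a" and "\<not> ((u + v) * b = u * a \<and> (u + v) * c = v * a)"
  shows "(u + v)\<^sup>2 / a < u\<^sup>2 / b + v\<^sup>2 / c"
proof -
  have pos: "a > 0" "b + c > 0" using assms by auto
  have id: "u\<^sup>2 / b + v\<^sup>2 / c - (u + v)\<^sup>2 / (b + c) = (u * c - v * b)\<^sup>2 / (b * c * (b + c))"
    using assms pos by (simp add: field_simps power2_eq_square)
  have le: "(u + v)\<^sup>2 / a \<le> (u + v)\<^sup>2 / (b + c)"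
    using assms pos by (intro divide_left_mono) auto
  show ?thesis
  proof (cases "u * c = v * b")
    case False
    then have "(u * c - v * b)\<^sup>2 / (b * c * (b + c)) > 0" using assms pos by simp
    with id le show ?thesis by linarith
  next
    case True
    have "u + v \<noteq> 0"
    proof
      assume "u + v = 0"
      then have "v = - u" by simp
      with True have "u * (b + c) = 0" by (simp add: algebra_simps)
      then have "u = 0" using pos by simp
      with \<open>v = - u\<close> assms(4) show False by simp
    qed
    moreover have "a \<noteq> b + c"
    proof
      assume "a = b + c"
      with True assms(4) show False by (simp add: algebra_simps)
    qed
    ultimately have "(u + v)\<^sup>2 / a < (u + v)\<^sup>2 / (b + c)"
      using assms pos by (intro divide_strict_left_mono) auto
    moreover have "(u * c - v * b)\<^sup>2 / (b * c * (b + c)) = 0" using True by simp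
    ultimately show ?thesis using id by linarith
  qed
qed

text \<open>
  The numerator is sixteen times the square of the area, by Heron's formula.
\<close>

lemma euclidean_sine_law:
  assumes "0 < a" "0 < b" "0 < c"
  shows "1 - (euclidean_cos a b c)\<^sup>2 =
    (2 * (a\<^sup>2 * b\<^sup>2 + b\<^sup>2 * c\<^sup>2 + c\<^sup>2 * a\<^sup>2) - a^4 - b^4 - c^4) / (4 * a\<^sup>2 * b\<^sup>2 * c\<^sup>2) * a\<^sup>2"
  using assms unfolding euclidean_cos_def by (simp add: field_simps) (simp add: eval_nat_numeral algebra_simps)

text \<open>
  The form is \<open>- 1 / (a * b * c)\<close> times the squared length of \<open>a' n\<^sub>a + b' n\<^sub>b + c' n\<^sub>c\<close>, where \<open>n\<^sub>a, n\<^sub>b, n\<^sub>c\<close>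
  are the outer unit normals of the sides, whose mutual inner products are the negative cosines of the angles. These vectors
  have, up to a factor, only the linear relation with coefficients \<open>a, b, c\<close>; so only scaling is excluded.
\<close>

interpretation euclidean: cosine_law "{0<..}" "\<lambda>x. x" "\<lambda>x. 1" euclidean_cos
  "\<lambda>a b c a' b' c'. - (a / (b * c)) * (a' - euclidean_cos c a b * b' - euclidean_cos b c a * c')"
  triangle_walls "\<lambda>a b c a' b' c'. a' * b = b' * a \<and> a' * c = c' * a"
proof (unfold_locales, goal_cases)
  case (5 a b c)
  have "1 - (euclidean_cos b c a)\<^sup>2 =
    (2 * (a\<^sup>2 * b\<^sup>2 + b\<^sup>2 * c\<^sup>2 + c\<^sup>2 * a\<^sup>2) - a^4 - b^4 - c^4) / (4 * a\<^sup>2 * b\<^sup>2 * c\<^sup>2) * b\<^sup>2"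
    using euclidean_sine_law[of b c a] 5 by (simp add: mult_ac add_ac diff_diff_eq)
  with euclidean_sine_law[of a b c] 5 show ?case by simp
next
  case (6 \<alpha> \<beta> \<gamma> a' b' c' t)
  then show ?case
    unfolding euclidean_cos_def
    by (auto intro!: derivative_eq_intros) (simp add: field_simps power2_eq_square)
next
  case (7 a b c a' b' c')
  define p q r where "p = euclidean_cos a b c" and "q = euclidean_cos b c a" and "r = euclidean_cos c a b"
  define K where "K = (2 * (a\<^sup>2 * b\<^sup>2 + b\<^sup>2 * c\<^sup>2 + c\<^sup>2 * a\<^sup>2) - a^4 - b^4 - c^4) / (4 * a\<^sup>2 * b\<^sup>2 * c\<^sup>2)"
  have pos: "0 < a" "0 < b" "0 < c" using 7 by auto
  have "1 - p\<^sup>2 > 0" using 7 by (simp add: p_def abs_square_less_1)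
  then have "K * a\<^sup>2 > 0" using euclidean_sine_law[OF pos] by (simp add: p_def K_def)
  then have K: "K > 0" by (simp add: zero_less_mult_iff)
  have q: "1 - q\<^sup>2 = K * b\<^sup>2" and r: "1 - r\<^sup>2 = K * c\<^sup>2"
    using euclidean_sine_law[of b c a] euclidean_sine_law[of c a b] pos
    by (simp_all add: q_def r_def K_def mult_ac add_ac diff_diff_eq)
  have pqr: "p + q * r = K * (b * c)"
    using pos unfolding p_def q_def r_def K_def euclidean_cos_def
    by (simp add: field_simps) (simp add: eval_nat_numeral algebra_simps)
  have a: "r * b + q * c = a"
    using pos unfolding q_def r_def euclidean_cos_def by (simp add: field_simps power2_eq_square)
  define Q where "Q = a'\<^sup>2 + b'\<^sup>2 + c'\<^sup>2 - 2 * r * a' * b' - 2 * q * a' * c' - 2 * p * b' * c'"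
  have "Q = (a' - r * b' - q * c')\<^sup>2 + (1 - r\<^sup>2) * b'\<^sup>2 + (1 - q\<^sup>2) * c'\<^sup>2 - 2 * (p + q * r) * b' * c'"
    unfolding Q_def by (simp add: power2_eq_square algebra_simps)
  also have "\<dots> = (a' - r * b' - q * c')\<^sup>2 + K * (c * b' - b * c')\<^sup>2"
    unfolding pqr q r by (simp add: power2_eq_square algebra_simps)
  finally have Q: "Q = (a' - r * b' - q * c')\<^sup>2 + K * (c * b' - b * c')\<^sup>2" .
  have "Q > 0"
  proof (cases "c * b' = b * c'")
    case False
    then have "K * (c * b' - b * c')\<^sup>2 > 0" using K by simp
    then show ?thesis unfolding Q by (simp add: add_nonneg_pos)
  next
    case True
    have "a' \<noteq> r * b' + q * c'"
    proof
      assume a': "a' = r * b' + q * c'"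
      have "a' * b = (r * b + q * c) * b'"
        unfolding a' using True by (simp add: algebra_simps)
      moreover have "a' * c = (r * b + q * c) * c'"
        unfolding a' using True by (simp add: algebra_simps)
      ultimately show False using 7(7) True unfolding a by (simp add: mult_ac)
    qed
    then have "(a' - r * b' - q * c')\<^sup>2 > 0" by simp
    then show ?thesis unfolding Q using K by (simp add: add_pos_nonneg)
  qed
  moreover have "a' * (- (a / (b * c)) * (a' - r * b' - q * c')) / a\<^sup>2
      + b' * (- (b / (c * a)) * (b' - p * c' - r * a')) / b\<^sup>2
      + c' * (- (c / (a * b)) * (c' - q * a' - p * b')) / c\<^sup>2 = - Q / (a * b * c)"
    using pos unfolding Q_def by (simp add: field_simps power2_eq_square)
  ultimately show ?case using pos by (simp add: p_def q_def r_def)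
next
  case (8 a b c)
  then have pos: "0 < a" "0 < b" "0 < c" and "a < b + c" "b < a + c" "c < a + b"
    using 8(4)[of 0 "-1" 1 1] 8(4)[of 0 1 "-1" 1] 8(4)[of 0 1 1 "-1"] by (auto simp: triangle_walls_def)
  then have "a\<^sup>2 < (b + c)\<^sup>2" "(b - c)\<^sup>2 < a\<^sup>2"
    using power_strict_mono[of a "b + c" 2] power_strict_mono[of "\<bar>b - c\<bar>" a 2] by auto
  then show ?case
    using pos by (auto simp: euclidean_cos_def abs_less_iff field_simps power2_eq_square)
next
  case (9 k p q r a b c a' b' c')
  then have pos: "0 < a" "0 < b" "0 < c" by auto
  have proportional: "v * z = w * y" if "x \<noteq> 0" "u * y = v * x" "u * z = w * x" for x y z u v w :: real
  proof -
    have "(v * z) * x = (w * y) * x" using that(2,3) by (metis mult.assoc mult.commute)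
    then show ?thesis using \<open>x \<noteq> 0\<close> by simp
  qed
  from 9(1) show ?case
    unfolding triangle_walls_def
  proof (elim insertE emptyE)
    assume 1: "(k, p, q, r) = (0, -1, 1, 1)"
    then have "a' = b' + c'" using 9 by simp
    moreover have "\<not> ((b' + c') * b = b' * a \<and> (b' + c') * c = c' * a)"
      using 9(7) \<open>a' = b' + c'\<close> by simp
    ultimately show ?thesis using euclidean_wall[of b c a b' c'] 1 9(5) pos by simp
  next
    assume 2: "(k, p, q, r) = (0, 1, -1, 1)"
    then have "b' = a' + c'" using 9 by simp
    moreover have "\<not> ((a' + c') * a = a' * b \<and> (a' + c') * c = c' * b)"
      using 9(7) proportional[of b "a' + c'" a a' c c'] pos \<open>b' = a' + c'\<close> by auto
    ultimately show ?thesis using euclidean_wall[of a c b a' c'] 2 9(5) pos by simp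
  next
    assume 3: "(k, p, q, r) = (0, 1, 1, -1)"
    then have "c' = a' + b'" using 9 by simp
    moreover have "\<not> ((a' + b') * a = a' * c \<and> (a' + b') * b = b' * c)"
      using 9(7) proportional[of c "a' + b'" a a' b b'] pos \<open>c' = a' + b'\<close> by auto
    ultimately show ?thesis using euclidean_wall[of a b c a' b'] 3 9(5) pos by simp
  qed
qed (auto intro!: derivative_eq_intros simp: is_interval_convex_1)

definition euclidean_coordinate :: "real \<Rightarrow> real \<Rightarrow> real" where
  "euclidean_coordinate h x = (if h = 0 then ln x else - (x powr (- h) / h))"

lemma euclidean_coordinate_deriv:
  assumes "x > 0"
  shows "(euclidean_coordinate h has_real_derivative x powr (- h - 1)) (at x)"
proof (cases "h = 0")
  case True
  then show ?thesis
    using assms DERIV_ln_divide[OF assms]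
    by (simp add: euclidean_coordinate_def[abs_def] powr_minus_divide)
next
  case False
  have "((\<lambda>x. - (x powr (- h) / h)) has_real_derivative - ((- h) * x powr (- h - 1) / h)) (at x)"
    by (intro DERIV_minus DERIV_cdivide has_real_derivative_powr assms)
  then show ?thesis using False by (simp add: euclidean_coordinate_def[abs_def])
qed

text \<open>
  If at one moment of the path the sides move by pure scaling, then its two ends are similar. For
  \<open>h \<noteq> 0\<close> the coordinate \<open>g x\<close> is a multiple of \<open>x powr (- h)\<close>, so such velocities are proportional to the positions
  in this coordinate, at that moment and therefore on the whole line.
\<close>

lemma euclidean_flat_imp_proportional:
  fixes a a' x :: "'i \<Rightarrow> real" and h t k :: real
  defines "g \<equiv> euclidean_coordinate h"
  assumes pos: "\<And>i. a i > 0" "\<And>i. a' i > 0" "\<And>i. x i > 0"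
    and line: "\<And>i. g (x i) = g (a i) + t * (g (a' i) - g (a i))"
    and flat: "\<And>i. (g (a' i) - g (a i)) * x i powr h = k"
  shows "\<exists>c>0. \<forall>i. a' i = c * a i"
proof (cases "h = 0")
  case True
  have "a' i = exp k * a i" for i
  proof -
    have "ln (a' i) = k + ln (a i)"
      using flat[of i] pos(3)[of i] True by (simp add: g_def euclidean_coordinate_def)
    then have "exp (ln (a' i)) = exp (k + ln (a i))" by simp
    then show ?thesis using pos by (simp add: exp_add)
  qed
  then show ?thesis by (intro exI[of _ "exp k"]) simp
next
  case h: False
  \<comment> \<open>Since \<open>g x\<close> is \<open>- (x powr (- h)) / h\<close>, \<open>flat\<close> says that the velocities are \<open>- h * k\<close> times the positions at
    time \<open>t\<close>. Going back to time 0 introduces the divisor \<open>d\<close>.\<close>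
  define d where "d = 1 + h * k * t"
  have eq: "(g (a' i) - g (a i)) * d = - (h * k) * g (a i)" and nz: "g (a i) \<noteq> 0" for i
  proof -
    have "x i powr h * g (x i) = - (1 / h)"
      using h pos(3)[of i] by (simp add: g_def euclidean_coordinate_def powr_minus field_simps)
    then have "(g (a' i) - g (a i)) * (x i powr h * g (x i)) = (g (a' i) - g (a i)) * (- (1 / h))" by simp
    then have "k * g (x i) = (g (a' i) - g (a i)) * (- (1 / h))"
      using flat[of i] by (simp add: mult.assoc[symmetric])
    then have "g (a' i) - g (a i) = - (h * k) * g (x i)" using h by (simp add: field_simps)
    then show "(g (a' i) - g (a i)) * d = - (h * k) * g (a i)"
      unfolding line d_def by (simp add: algebra_simps)
    show "g (a i) \<noteq> 0" using h pos(1)[of i] by (simp add: g_def euclidean_coordinate_def)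
  qed
  have d: "d \<noteq> 0"
  proof
    assume "d = 0"
    then have "h * k = 0" using eq[of undefined] nz[of undefined] by simp
    then have "d = 1" unfolding d_def by (simp only: mult_zero_left add_0_right)
    with \<open>d = 0\<close> show False by simp
  qed
  define m where "m = 1 - h * k / d"
  have g': "g (a' i) = m * g (a i)" for i
    using eq[of i] d by (simp add: m_def field_simps)
  have powr': "a' i powr (- h) = m * a i powr (- h)" for i
    using g'[of i] h by (simp add: g_def euclidean_coordinate_def)
  have m: "m > 0"
    using powr'[of undefined] pos(1,2)[of undefined] by (metis powr_gt_zero less_irrefl zero_less_mult_pos2)
  have "a' i = m powr (- 1 / h) * a i" for i
  proof -
    have "a' i = (a' i powr (- h)) powr (- 1 / h)" using h pos(2)[of i] by (simp add: powr_powr)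
    also have "\<dots> = m powr (- 1 / h) * (a i powr (- h)) powr (- 1 / h)"
      unfolding powr' using m by (simp add: powr_mult)
    also have "(a i powr (- h)) powr (- 1 / h) = a i" using h pos(1)[of i] by (simp add: powr_powr)
    finally show ?thesis .
  qed
  then show ?thesis using m by (intro exI[of _ "m powr (- 1 / h)"]) simp
qed

lemma euclidean_cos_scale: "c > 0 \<Longrightarrow> euclidean_cos (c * x) (c * y) (c * z) = euclidean_cos x y z"
proof -
  assume "c > 0"
  have "euclidean_cos (c * x) (c * y) (c * z) = (c\<^sup>2 * (y\<^sup>2 + z\<^sup>2 - x\<^sup>2)) / (c\<^sup>2 * (2 * y * z))"
    by (simp add: euclidean_cos_def power2_eq_square algebra_simps)
  then show ?thesis using \<open>c > 0\<close> by (simp add: euclidean_cos_def)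
qed

lemma euclidean_faces_similar:
  assumes fin: "finite (faces t)"
    and tri: "\<And>f. f \<in> faces t \<Longrightarrow> euclidean.triangle_face t l f" "\<And>f. f \<in> faces t \<Longrightarrow> euclidean.triangle_face t l' f"
    and same: "\<And>e. e \<in> edges t \<Longrightarrow> (\<Sum>(f, i)\<in>sides_of t e. sin_power_integral h (euclidean.angle t l f i))
      = (\<Sum>(f, i)\<in>sides_of t e. sin_power_integral h (euclidean.angle t l' f i))"
    and f: "f \<in> faces t"
  shows "\<exists>c>0. \<forall>i. l' (side_edge t f i) = c * l (side_edge t f i)"
proof -
  let ?g = "euclidean_coordinate h"
  show ?thesis
  proof (rule faces_equal_if_edge_sums_equal[OF fin same _ _ f, where w = "\<lambda>e. ?g (l' e) - ?g (l e)"])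
    fix f assume f: "f \<in> faces t" and ne: "\<not> (\<exists>c>0. \<forall>i. l' (side_edge t f i) = c * l (side_edge t f i))"
    note T = tri(1)[OF f, unfolded euclidean.triangle_face_def] tri(2)[OF f, unfolded euclidean.triangle_face_def]
    have "\<forall>i. l (side_edge t f i) > 0 \<and> l' (side_edge t f i) > 0"
      using T unfolding all_index euclidean.triangle_def by simp
    then have pos: "l (side_edge t f i) > 0" "l' (side_edge t f i) > 0" for i by auto
    show "0 < (\<Sum>i\<in>UNIV. (sin_power_integral h (euclidean.angle t l' f i) - sin_power_integral h (euclidean.angle t l f i))
        * (?g (l' (side_edge t f i)) - ?g (l (side_edge t f i))))"
      unfolding euclidean.face_sum[where w = "\<lambda>e. ?g (l' e) - ?g (l e)"]
    proof (rule euclidean.triangle_monotone[OF _ T])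
      fix s x y z
      assume xyz: "x \<in> {0<..}" "y \<in> {0<..}" "z \<in> {0<..}"
        and line: "?g x = ?g (l (side_edge t f 0)) + s * (?g (l' (side_edge t f 0)) - ?g (l (side_edge t f 0)))"
         "?g y = ?g (l (side_edge t f 1)) + s * (?g (l' (side_edge t f 1)) - ?g (l (side_edge t f 1)))"
         "?g z = ?g (l (side_edge t f 2)) + s * (?g (l' (side_edge t f 2)) - ?g (l (side_edge t f 2)))"
      define X where "X i = (if i = 0 then x else if i = 1 then y else z)" for i :: 3
      define v where "v i = ?g (l' (side_edge t f i)) - ?g (l (side_edge t f i))" for i
      have X: "X 0 = x" "X 1 = y" "X 2 = z" by (simp_all add: X_def)
      show "\<not> (v 0 * x powr (h + 1) * y = v 1 * y powr (h + 1) * x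
           \<and> v 0 * x powr (h + 1) * z = v 2 * z powr (h + 1) * x)"
      proof
        assume flat: "v 0 * x powr (h + 1) * y = v 1 * y powr (h + 1) * x
           \<and> v 0 * x powr (h + 1) * z = v 2 * z powr (h + 1) * x"
        have "v 0 * x powr h = v 1 * y powr h" "v 0 * x powr h = v 2 * z powr h"
          using flat xyz by (simp_all add: powr_add)
        then have "\<forall>i. v i * X i powr h = v 0 * x powr h"
          unfolding all_index X by simp
        moreover have "\<forall>i. X i > 0" unfolding all_index X using xyz by simp
        moreover have "\<forall>i. ?g (X i) = ?g (l (side_edge t f i)) + s * (?g (l' (side_edge t f i)) - ?g (l (side_edge t f i)))"
          unfolding all_index X using line by simp
        ultimately have "\<exists>c>0. \<forall>i. l' (side_edge t f i) = c * l (side_edge t f i)"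
          using pos unfolding v_def
          by (intro euclidean_flat_imp_proportional[of "\<lambda>i. l (side_edge t f i)" "\<lambda>i. l' (side_edge t f i)" X h s]) auto
        then show False using ne by simp
      qed
    qed (use euclidean_coordinate_deriv in auto)
  next
    fix f assume "f \<in> faces t" "\<exists>c>0. \<forall>i. l' (side_edge t f i) = c * l (side_edge t f i)"
    then have "euclidean.angle t l' f i = euclidean.angle t l f i" for i
      by (auto simp: euclidean.angle_def euclidean_cos_scale)
    then show "0 \<le> (\<Sum>i\<in>UNIV. (sin_power_integral h (euclidean.angle t l' f i) - sin_power_integral h (euclidean.angle t l f i))
        * (?g (l' (side_edge t f i)) - ?g (l (side_edge t f i))))" by simp
  qed
qed

section \<open>Spherical triangles\<close>

text \<open>
  Sylvester's criterion, by completing squares; the third hypothesis says that the determinant is positive, since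
  the difference of its two sides is \<open>A\<close> times the determinant.
\<close>

lemma ternary_form_positive:
  fixes A B C p q r x y z :: real
  assumes A: "A > 0" and AB: "A * B - r\<^sup>2 > 0"
    and det: "(A * p + q * r)\<^sup>2 < (A * B - r\<^sup>2) * (A * C - q\<^sup>2)"
    and nz: "x \<noteq> 0 \<or> y \<noteq> 0 \<or> z \<noteq> 0"
  shows "A * x\<^sup>2 + B * y\<^sup>2 + C * z\<^sup>2 - 2 * r * x * y - 2 * q * x * z - 2 * p * y * z > 0"
    (is "?Q > 0")
proof -
  define D where "D = A * B - r\<^sup>2"
  define E where "E = (A * B - r\<^sup>2) * (A * C - q\<^sup>2) - (A * p + q * r)\<^sup>2"
  have D: "D > 0" and E: "E > 0" using AB det by (auto simp: D_def E_def)
  have eq: "A * D * ?Q = D * (A * x - r * y - q * z)\<^sup>2 + (D * y - (A * p + q * r) * z)\<^sup>2 + E * z\<^sup>2"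
    unfolding D_def E_def by (simp add: power2_eq_square algebra_simps)
  have "A * D * ?Q > 0"
  proof (cases "z = 0")
    case False
    then have "E * z\<^sup>2 > 0" using E by simp
    then show ?thesis unfolding eq using D by (simp add: add_nonneg_pos)
  next
    case z: True
    show ?thesis
    proof (cases "y = 0")
      case False
      then have "(D * y - (A * p + q * r) * z)\<^sup>2 > 0" using D z by simp
      then show ?thesis unfolding eq using D z by (simp add: add_nonneg_pos)
    next
      case True
      then show ?thesis using z nz A D by simp
    qed
  qed
  then show ?thesis by (rule zero_less_mult_pos) (use A D in simp)
qed

definition spherical_cos :: "real \<Rightarrow> real \<Rightarrow> real \<Rightarrow> real" where
  "spherical_cos a b c = (cos a - cos b * cos c) / (sin b * sin c)"

text \<open>
  The determinant of the symmetric matrix with diagonal entries 1 and off-diagonal entries \<open>x, y, z\<close>. For the cosines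
  of the sides of a spherical triangle it is the Gram determinant of the corners.
\<close>

definition gram :: "real \<Rightarrow> real \<Rightarrow> real \<Rightarrow> real" where
  "gram x y z = 1 - x\<^sup>2 - y\<^sup>2 - z\<^sup>2 + 2 * x * y * z"

lemma spherical_sine_law:
  assumes "sin a \<noteq> 0" "sin b \<noteq> 0" "sin c \<noteq> 0"
  shows "1 - (spherical_cos a b c)\<^sup>2 = gram (cos a) (cos b) (cos c) / (sin b * sin c)\<^sup>2"
proof -
  have "(sin b * sin c)\<^sup>2 - (cos a - cos b * cos c)\<^sup>2 = gram (cos a) (cos b) (cos c)"
    unfolding power_mult_distrib sin_squared_eq gram_def by (simp add: power2_eq_square algebra_simps)
  then show ?thesis using assms
    by (simp add: spherical_cos_def power_divide divide_simps)
qed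

text \<open>
  After multiplication by \<open>sin b * sin c\<close> the left-hand side becomes
  \<open>x\<^sup>2 + y\<^sup>2 - 2 * x * y * cos (b + c)\<close> with \<open>x = u * sin c\<close> and \<open>y = v * sin b\<close>.
\<close>

lemma spherical_wall_aux:
  fixes b c u v :: real
  assumes "sin b > 0" "sin c > 0" "sin (b + c) \<noteq> 0" "u \<noteq> 0 \<or> v \<noteq> 0"
  shows "(u\<^sup>2 * cot b + v\<^sup>2 * cot c - (u + v)\<^sup>2 * cot (b + c)) * sin (b + c) > 0"
proof -
  let ?x = "u * sin c" and ?y = "v * sin b" and ?k = "cos (b + c)"
  have "1 - ?k\<^sup>2 = (sin (b + c))\<^sup>2" by (simp add: sin_squared_eq)
  then have k: "1 - ?k\<^sup>2 > 0" using assms(3) by simp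
  have "?x\<^sup>2 + ?y\<^sup>2 - 2 * ?x * ?y * ?k = (?x - ?k * ?y)\<^sup>2 + (1 - ?k\<^sup>2) * ?y\<^sup>2"
    by (simp add: power2_eq_square algebra_simps)
  also have "\<dots> > 0"
  proof (cases "v = 0")
    case True
    then show ?thesis using assms by simp
  next
    case False
    then have "(1 - ?k\<^sup>2) * ?y\<^sup>2 > 0" using k assms by simp
    then show ?thesis by (simp add: add_nonneg_pos)
  qed
  finally have pos: "?x\<^sup>2 + ?y\<^sup>2 - 2 * ?x * ?y * ?k > 0" .
  have 1: "cos b * sin (b + c) - cos (b + c) * sin b = sin c"
    using sin_diff[of "b + c" b] by (simp add: mult.commute)
  have 2: "cos c * sin (b + c) - cos (b + c) * sin c = sin b"
    using sin_diff[of "b + c" c] by (simp add: mult.commute)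
  have "(u\<^sup>2 * cot b + v\<^sup>2 * cot c - (u + v)\<^sup>2 * cot (b + c)) * sin (b + c) * (sin b * sin c)
    = u\<^sup>2 * (cos b * sin (b + c)) * sin c + v\<^sup>2 * (cos c * sin (b + c)) * sin b - (u + v)\<^sup>2 * ?k * (sin b * sin c)"
    using assms by (simp add: cot_def field_simps)
  also have "\<dots> = u\<^sup>2 * (sin c + ?k * sin b) * sin c + v\<^sup>2 * (sin b + ?k * sin c) * sin b - (u + v)\<^sup>2 * ?k * (sin b * sin c)"
    using 1 2 by (simp add: algebra_simps)
  also have "\<dots> = ?x\<^sup>2 + ?y\<^sup>2 - 2 * ?x * ?y * ?k"
    by (simp add: power2_eq_square algebra_simps)
  finally have "(u\<^sup>2 * cot b + v\<^sup>2 * cot c - (u + v)\<^sup>2 * cot (b + c)) * sin (b + c) * (sin b * sin c) > 0"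
    using pos by simp
  then show ?thesis by (rule zero_less_mult_pos2) (use assms in simp)
qed

lemma cot_antimono:
  assumes "0 < x" "x \<le> y" "y < pi"
  shows "cot y \<le> cot x"
proof -
  have s: "sin x > 0" "sin y > 0" "sin (y - x) \<ge> 0"
    using assms by (auto intro!: sin_gt_zero sin_ge_zero)
  have "cot x - cot y = sin (y - x) / (sin x * sin y)"
    using s by (simp add: cot_def sin_diff field_simps)
  with s show ?thesis by (smt (verit) divide_nonneg_pos mult_pos_pos)
qed

lemma spherical_triangle_wall:
  fixes a b c u v :: real
  assumes "0 < b" "0 < c" "b + c \<le> a" "a < pi" "u \<noteq> 0 \<or> v \<noteq> 0"
  shows "(u + v)\<^sup>2 * cot a < u\<^sup>2 * cot b + v\<^sup>2 * cot c"
proof -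
  have s: "sin b > 0" "sin c > 0" "sin (b + c) > 0"
    using assms by (auto intro!: sin_gt_zero)
  have "u\<^sup>2 * cot b + v\<^sup>2 * cot c - (u + v)\<^sup>2 * cot (b + c) > 0"
    using spherical_wall_aux[of b c u v] s assms by (simp add: zero_less_mult_iff)
  moreover have "(u + v)\<^sup>2 * cot a \<le> (u + v)\<^sup>2 * cot (b + c)"
    using assms by (intro mult_left_mono cot_antimono) auto
  ultimately show ?thesis by linarith
qed

text \<open>
  Compared with \<open>spherical_triangle_wall\<close> the sign is reversed since \<open>b + c\<close> exceeds \<open>\<pi>\<close>.
\<close>

lemma spherical_perimeter_wall:
  fixes a b c u v :: real
  assumes "a < pi" "b < pi" "c < pi" "a + b + c \<ge> 2 * pi" "u \<noteq> 0 \<or> v \<noteq> 0"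
  shows "(u + v)\<^sup>2 * cot a + u\<^sup>2 * cot b + v\<^sup>2 * cot c < 0"
proof -
  have s: "sin b > 0" "sin c > 0"
    using assms by (auto intro!: sin_gt_zero)
  have s': "sin (b + c) < 0"
    using sin_gt_zero[of "b + c - pi"] assms by (simp add: sin_diff)
  have "u\<^sup>2 * cot b + v\<^sup>2 * cot c - (u + v)\<^sup>2 * cot (b + c) < 0"
    using spherical_wall_aux[of b c u v] s s' assms by (simp add: zero_less_mult_iff)
  moreover have "cot a \<le> cot (2 * pi - (b + c))"
    using assms by (intro cot_antimono) auto
  then have "cot a \<le> - cot (b + c)"
    by (simp add: cot_def sin_diff cos_diff)
  then have "(u + v)\<^sup>2 * cot a \<le> (u + v)\<^sup>2 * - cot (b + c)"
    by (intro mult_left_mono) auto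
  ultimately show ?thesis by linarith
qed

text \<open>
  The form is a negative multiple of the squared length of \<open>a' n\<^sub>a + b' n\<^sub>b + c' n\<^sub>c\<close>, where the vectors are now the outer
  unit normals of the three planes through the origin that bound the triangle. They are linearly independent, so
  only the zero velocity is excluded.
\<close>

interpretation spherical: cosine_law "{0<..<pi}" sin cos spherical_cos
  "\<lambda>a b c a' b' c'. - (sin a / (sin b * sin c)) * (a' - spherical_cos c a b * b' - spherical_cos b c a * c')"
  "insert (2 * pi, -1, -1, -1) triangle_walls" "\<lambda>a b c a' b' c'. a' = 0 \<and> b' = 0 \<and> c' = 0"
proof (unfold_locales, goal_cases)
  case (5 a b c)
  then have s: "sin a > 0" "sin b > 0" "sin c > 0" by (auto intro!: sin_gt_zero)
  have rot: "gram (cos b) (cos c) (cos a) = gram (cos a) (cos b) (cos c)" by (simp add: gram_def)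
  have "1 - (spherical_cos a b c)\<^sup>2 = gram (cos a) (cos b) (cos c) / (sin b * sin c)\<^sup>2"
    "1 - (spherical_cos b c a)\<^sup>2 = gram (cos a) (cos b) (cos c) / (sin c * sin a)\<^sup>2"
    using s spherical_sine_law[of a b c] spherical_sine_law[of b c a] rot by auto
  then show ?case using s by (simp only:) (simp add: power_mult_distrib)
next
  case (6 \<alpha> \<beta> \<gamma> a' b' c' t)
  then have s: "sin (\<alpha> t) > 0" "sin (\<beta> t) > 0" "sin (\<gamma> t) > 0" by (auto intro!: sin_gt_zero)
  define x y z X Y Z where "x = cos (\<alpha> t)" and "y = cos (\<beta> t)" and "z = cos (\<gamma> t)"
    and "X = sin (\<alpha> t)" and "Y = sin (\<beta> t)" and "Z = sin (\<gamma> t)"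
  have pos: "X > 0" "Y > 0" "Z > 0" using s by (auto simp: X_def Y_def Z_def)
  have sq: "X * X = 1 - x * x" "Y * Y = 1 - y * y" "Z * Z = 1 - z * z"
    using sin_squared_eq[of "\<alpha> t"] sin_squared_eq[of "\<beta> t"] sin_squared_eq[of "\<gamma> t"]
    by (auto simp: x_def y_def z_def X_def Y_def Z_def power2_eq_square)
  have "((\<lambda>t. (cos (\<alpha> t) - cos (\<beta> t) * cos (\<gamma> t)) / (sin (\<beta> t) * sin (\<gamma> t))) has_real_derivative
     ((- X * a' - (- Y * b' * z + y * (- Z * c'))) * (Y * Z) - (x - y * z) * (y * b' * Z + Y * (z * c'))) / (Y * Z * (Y * Z))) (at t)"
    using 6(1-3) s unfolding x_def y_def z_def X_def Y_def Z_def
    by (auto intro!: derivative_eq_intros simp: mult_ac)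
  moreover have "((- X * a' - (- Y * b' * z + y * (- Z * c'))) * (Y * Z) - (x - y * z) * (y * b' * Z + Y * (z * c'))) / (Y * Z * (Y * Z))
    = - (X / (Y * Z)) * (a' - (z - x * y) / (X * Y) * b' - (y - z * x) / (Z * X) * c')"
  proof -
    have "((- X * a' - (- Y * b' * z + y * (- Z * c'))) * (Y * Z) - (x - y * z) * (y * b' * Z + Y * (z * c')))
      = - X * a' * (Y * Z) + (Y * Y * z - (x - y * z) * y) * b' * Z + (Z * Z * y - (x - y * z) * z) * c' * Y"
      by (simp add: algebra_simps)
    also have "\<dots> = - X * a' * (Y * Z) + (z - x * y) * b' * Z + (y - z * x) * c' * Y"
      unfolding sq by (simp add: algebra_simps)
    finally show ?thesis using pos by (simp add: field_simps)
  qed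
  ultimately show ?case
    unfolding spherical_cos_def x_def y_def z_def X_def Y_def Z_def by simp
next
  case (7 a b c a' b' c')
  then have s: "sin a > 0" "sin b > 0" "sin c > 0" by (auto intro!: sin_gt_zero)
  define p q r where "p = spherical_cos a b c" and "q = spherical_cos b c a" and "r = spherical_cos c a b"
  define K where "K = gram (cos a) (cos b) (cos c)"
  have q: "1 - q\<^sup>2 = K / (sin c * sin a)\<^sup>2" and r: "1 - r\<^sup>2 = K / (sin a * sin b)\<^sup>2"
    using spherical_sine_law[of b c a] spherical_sine_law[of c a b] s
    by (simp_all add: q_def r_def K_def gram_def mult_ac add_ac diff_diff_eq)
  have qr1: "1 - q\<^sup>2 > 0" "1 - r\<^sup>2 > 0" using 7 by (auto simp: q_def r_def abs_square_less_1)
  have num: "(cos a - cos b * cos c) * (sin a)\<^sup>2 + (cos b - cos c * cos a) * (cos c - cos a * cos b) = cos a * K"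
    unfolding sin_squared_eq K_def gram_def by (simp add: power2_eq_square algebra_simps)
  have "p + q * r = ((cos a - cos b * cos c) * (sin a)\<^sup>2 + (cos b - cos c * cos a) * (cos c - cos a * cos b))
     / ((sin a)\<^sup>2 * sin b * sin c)"
    using s unfolding p_def q_def r_def spherical_cos_def by (simp add: field_simps power2_eq_square)
  then have pqr: "p + q * r = cos a * K / ((sin a)\<^sup>2 * sin b * sin c)" unfolding num .
  have "(p + q * r)\<^sup>2 = (cos a)\<^sup>2 * ((1 - r\<^sup>2) * (1 - q\<^sup>2))"
    unfolding pqr q r by (simp add: power2_eq_square mult_ac)
  also have "\<dots> < (1 - r\<^sup>2) * (1 - q\<^sup>2)"
  proof -
    have "(cos a)\<^sup>2 < 1" using s(1) sin_squared_eq[of a] by (smt (verit) zero_less_power)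
    then show ?thesis using mult_strict_right_mono[of "(cos a)\<^sup>2" 1] qr1 by simp
  qed
  finally have pqr_less: "(p + q * r)\<^sup>2 < (1 - r\<^sup>2) * (1 - q\<^sup>2)" .
  define Q where "Q = a'\<^sup>2 + b'\<^sup>2 + c'\<^sup>2 - 2 * r * a' * b' - 2 * q * a' * c' - 2 * p * b' * c'"
  have "Q > 0"
    using ternary_form_positive[of 1 1 r p q 1 a' b' c'] qr1 pqr_less 7 by (auto simp: Q_def)
  moreover have "a' * (- (sin a / (sin b * sin c)) * (a' - r * b' - q * c')) / (sin a)\<^sup>2
      + b' * (- (sin b / (sin c * sin a)) * (b' - p * c' - r * a')) / (sin b)\<^sup>2
      + c' * (- (sin c / (sin a * sin b)) * (c' - q * a' - p * b')) / (sin c)\<^sup>2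
    = - Q / (sin a * sin b * sin c)"
    using s unfolding Q_def by (simp add: field_simps power2_eq_square)
  ultimately show ?case using s by (simp add: p_def q_def r_def)
next
  case (8 a b c)
  then have s: "sin a > 0" "sin b > 0" "sin c > 0" by (auto intro!: sin_gt_zero)
  have ineq: "a < b + c" "b < a + c" "c < a + b" "a + b + c < 2 * pi"
    using 8(4)[of 0 "-1" 1 1] 8(4)[of 0 1 "-1" 1] 8(4)[of 0 1 1 "-1"] 8(4)[of "2*pi" "-1" "-1" "-1"]
    by (auto simp: triangle_walls_def)
  have "cos (b + c) < cos a"
  proof (cases "b + c \<le> pi")
    case True
    then show ?thesis using ineq 8 by (intro cos_monotone_0_pi) auto
  next
    case False
    then have "cos (2 * pi - (b + c)) < cos a" using ineq 8 by (intro cos_monotone_0_pi) auto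
    then show ?thesis by (simp add: cos_diff)
  qed
  moreover have "cos a < cos \<bar>b - c\<bar>" using ineq 8 by (intro cos_monotone_0_pi) auto
  ultimately show ?case
    using s by (auto simp: spherical_cos_def abs_less_iff field_simps cos_add cos_diff)
next
  case (9 k p q r a b c a' b' c')
  from 9(1) consider "(k, p, q, r) = (0, -1, 1, 1)" | "(k, p, q, r) = (0, 1, -1, 1)"
    | "(k, p, q, r) = (0, 1, 1, -1)" | "(k, p, q, r) = (2 * pi, -1, -1, -1)"
    by (auto simp: triangle_walls_def)
  then show ?case
  proof cases
    case 1
    then have "a' = b' + c'" using 9 by simp
    then show ?thesis using spherical_triangle_wall[of b c a b' c'] 1 9 by (auto simp: cot_def mult.commute)
  next
    case 2
    then have "b' = a' + c'" using 9 by simp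
    then show ?thesis using spherical_triangle_wall[of a c b a' c'] 2 9 by (auto simp: cot_def mult.commute)
  next
    case 3
    then have "c' = a' + b'" using 9 by simp
    then show ?thesis using spherical_triangle_wall[of a b c a' b'] 3 9 by (auto simp: cot_def mult.commute)
  next
    case 4
    then have "a' = - (b' + c')" using 9 by simp
    moreover have "(b' + c')\<^sup>2 = (- b' - c')\<^sup>2" by (simp add: power2_eq_square algebra_simps)
    ultimately show ?thesis using spherical_perimeter_wall[of a b c b' c'] 4 9 by (auto simp: cot_def mult.commute)
  qed
qed (auto intro!: derivative_eq_intros sin_gt_zero simp: is_interval_convex_1)

section \<open>Hyperbolic triangles\<close>

text \<open>
  For a hyperbolic triangle this is the sine of \<open>(\<beta> + \<gamma> - \<alpha>) / 2\<close>, where \<open>\<alpha>, \<beta>, \<gamma>\<close> are the inner angles opposite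
  to \<open>a, b, c\<close> (\<open>hyperbolic_pseudoangle\<close> below). The inner angles themselves cannot be used: for them the normals
  of the sides span a Lorentzian space, and the quadratic form is indefinite.
\<close>

definition hyperbolic_pseudocos :: "real \<Rightarrow> real \<Rightarrow> real \<Rightarrow> real" where
  "hyperbolic_pseudocos a b c =
     ((sinh (b / 2))\<^sup>2 + (sinh (c / 2))\<^sup>2 - (sinh (a / 2))\<^sup>2)
       / (2 * sinh (b / 2) * sinh (c / 2) * cosh (a / 2))"

text \<open>
  For \<open>x = sinh\<^sup>2 (a / 2)\<close> and likewise \<open>y\<close> and \<open>z\<close>, four times this number is the Gram determinant
  \<open>gram (cosh a) (cosh b) (cosh c)\<close>, which is positive exactly for triangles. Without the cubic term it is Heron's
  expression for the Euclidean triangle with sides \<open>sinh (a / 2), sinh (b / 2), sinh (c / 2)\<close>.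
\<close>

definition heron :: "real \<Rightarrow> real \<Rightarrow> real \<Rightarrow> real" where
  "heron x y z = 2 * (x * y + y * z + z * x) - x\<^sup>2 - y\<^sup>2 - z\<^sup>2 + 4 * x * y * z"

lemma cosh_sq: "(cosh x)\<^sup>2 = 1 + (sinh x)\<^sup>2" for x :: real
  using hyperbolic_pythagoras[of x] by simp

lemma hyperbolic_sine_law:
  assumes "a > 0" "b > 0" "c > 0"
  shows "1 - (hyperbolic_pseudocos a b c)\<^sup>2 =
    heron ((sinh (a/2))\<^sup>2) ((sinh (b/2))\<^sup>2) ((sinh (c/2))\<^sup>2)
      / (2 * sinh (a/2) * sinh (b/2) * sinh (c/2))\<^sup>2 * (tanh (a/2))\<^sup>2"
proof -
  let ?x = "(sinh (a/2))\<^sup>2" and ?y = "(sinh (b/2))\<^sup>2" and ?z = "(sinh (c/2))\<^sup>2"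
  have pos: "sinh (a/2) > 0" "sinh (b/2) > 0" "sinh (c/2) > 0" "cosh (a/2) > 0"
    using assms by auto
  have "4 * ?y * ?z * (cosh (a/2))\<^sup>2 - (?y + ?z - ?x)\<^sup>2 = heron ?x ?y ?z"
    unfolding cosh_sq heron_def by (simp add: power2_eq_square algebra_simps)
  moreover have "1 - (hyperbolic_pseudocos a b c)\<^sup>2
    = (4 * ?y * ?z * (cosh (a/2))\<^sup>2 - (?y + ?z - ?x)\<^sup>2) / (4 * ?y * ?z * (cosh (a/2))\<^sup>2)"
    using pos unfolding hyperbolic_pseudocos_def power_divide power_mult_distrib
    by (simp add: diff_divide_distrib[of "4 * _ * _ * _"])
  ultimately show ?thesis
    using pos by (simp add: tanh_def power_divide power_mult_distrib)
qed

lemma heron_rotate: "heron y z x = heron x y z"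
  by (simp add: heron_def)

text \<open>
  The Gram determinant is \<open>(cosh (b + c) - cosh a) * (cosh a - cosh (b - c))\<close>, and the triangle inequalities make both
  factors positive.
\<close>

lemma heron_positive:
  fixes a b c :: real
  assumes "0 < a" "0 < b" "0 < c" "a < b + c" "b < a + c" "c < a + b"
  shows "heron ((sinh (a/2))\<^sup>2) ((sinh (b/2))\<^sup>2) ((sinh (c/2))\<^sup>2) > 0"
proof -
  let ?C = "cosh a" and ?x = "(sinh (a/2))\<^sup>2" and ?y = "(sinh (b/2))\<^sup>2" and ?z = "(sinh (c/2))\<^sup>2"
  have C: "cosh l = 1 + 2 * (sinh (l/2))\<^sup>2" for l :: real
    using cosh_double[of "l/2"] by (simp add: cosh_sq)
  have "cosh a < cosh (b + c)" using assms by (intro cosh_real_strict_mono) auto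
  then have 1: "cosh b * cosh c + sinh b * sinh c - ?C > 0" by (simp add: cosh_add)
  have "cosh \<bar>b - c\<bar> < cosh a" using assms by (intro cosh_real_strict_mono) auto
  then have 2: "?C - (cosh b * cosh c - sinh b * sinh c) > 0" by (simp add: cosh_diff)
  have "0 < (cosh b * cosh c + sinh b * sinh c - ?C) * (?C - (cosh b * cosh c - sinh b * sinh c))"
    using 1 2 by simp
  also have "\<dots> = (sinh b)\<^sup>2 * (sinh c)\<^sup>2 - (?C - cosh b * cosh c)\<^sup>2"
    by (simp add: power2_eq_square algebra_simps)
  also have "\<dots> = ((cosh b)\<^sup>2 - 1) * ((cosh c)\<^sup>2 - 1) - (?C - cosh b * cosh c)\<^sup>2"
    by (simp add: cosh_sq)
  also have "\<dots> = 4 * heron ?x ?y ?z"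
    unfolding C[of a] C[of b] C[of c] heron_def by (simp add: power2_eq_square algebra_simps)
  finally show ?thesis by simp
qed

text \<open>
  The hyperbolic sine is strictly superadditive, so the Euclidean inequality applies to the sines with
  room to spare.
\<close>

lemma hyperbolic_wall:
  fixes a b c u v :: real
  assumes "0 < b" "0 < c" "b + c \<le> a" "u \<noteq> 0 \<or> v \<noteq> 0"
  shows "(u + v)\<^sup>2 / sinh a < u\<^sup>2 / sinh b + v\<^sup>2 / sinh c"
proof (rule euclidean_wall)
  have "cosh b > 1" "cosh c > 1"
    using assms cosh_real_strict_mono[of 0 b] cosh_real_strict_mono[of 0 c] by auto
  then have "sinh b * 1 + 1 * sinh c < sinh b * cosh c + cosh b * sinh c"
    using assms by (intro add_strict_mono mult_strict_left_mono mult_strict_right_mono) auto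
  then have "sinh b + sinh c < sinh (b + c)" by (simp add: sinh_add)
  also have "\<dots> \<le> sinh a" using assms by simp
  finally have less: "sinh b + sinh c < sinh a" .
  then show "sinh b + sinh c \<le> sinh a" by simp
  show "\<not> ((u + v) * sinh b = u * sinh a \<and> (u + v) * sinh c = v * sinh a)"
  proof
    assume eq: "(u + v) * sinh b = u * sinh a \<and> (u + v) * sinh c = v * sinh a"
    then have "(u + v) * (sinh b + sinh c) = (u + v) * sinh a" by (simp add: algebra_simps)
    then have "u + v = 0" using less by simp
    moreover have "sinh a > 0" using assms by simp
    ultimately show False using eq assms by simp
  qed
qed (use assms in auto)

text \<open>
  Sylvester's criterion applies: the second leading minor of the matrix is a positive multiple of \<open>heron X Y Z\<close>, and the
  determinant one of its square.
\<close>

lemma hyperbolic_form: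
  fixes X Y Z x y z :: real
  assumes pos: "X > 0" "Y > 0" "Z > 0" and heron: "heron X Y Z > 0"
    and nz: "x \<noteq> 0 \<or> y \<noteq> 0 \<or> z \<noteq> 0"
  shows "X * (2 + X + Y + Z) / (1 + X) * x\<^sup>2 + Y * (2 + X + Y + Z) / (1 + Y) * y\<^sup>2
    + Z * (2 + X + Y + Z) / (1 + Z) * z\<^sup>2
    - 2 * (X + Y - Z) * x * y - 2 * (X + Z - Y) * x * z - 2 * (Y + Z - X) * y * z > 0"
proof (rule ternary_form_positive[OF _ _ _ nz])
  define s where "s = 2 + X + Y + Z"
  have s: "s > 0" using pos by (simp add: s_def)
  have minor: "P * Q * s\<^sup>2 - (P + Q - R)\<^sup>2 * ((1 + P) * (1 + Q)) = heron P Q R * (1 + P + Q)"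
    if "s = 2 + P + Q + R" for P Q R
    unfolding heron_def that by (simp add: power2_eq_square algebra_simps)
  have m: "P * s / (1 + P) * (Q * s / (1 + Q)) - (P + Q - R)\<^sup>2 = heron P Q R * (1 + P + Q) / ((1 + P) * (1 + Q))"
    if "s = 2 + P + Q + R" "P > 0" "Q > 0" for P Q R
  proof -
    have "P * s / (1 + P) * (Q * s / (1 + Q)) - (P + Q - R)\<^sup>2
      = (P * Q * s\<^sup>2 - (P + Q - R)\<^sup>2 * ((1 + P) * (1 + Q))) / ((1 + P) * (1 + Q))"
    proof -
      have "P * s / (1 + P) * (Q * s / (1 + Q)) = P * Q * s\<^sup>2 / ((1 + P) * (1 + Q))"
        by (simp add: power2_eq_square mult_ac)
      moreover have "(P + Q - R)\<^sup>2 = (P + Q - R)\<^sup>2 * ((1 + P) * (1 + Q)) / ((1 + P) * (1 + Q))"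
        using that(2,3) by simp
      ultimately show ?thesis by (simp only: diff_divide_distrib)
    qed
    then show ?thesis unfolding minor[OF that(1)] .
  qed
  show "X * (2 + X + Y + Z) / (1 + X) > 0" using pos by simp
  have m1: "X * s / (1 + X) * (Y * s / (1 + Y)) - (X + Y - Z)\<^sup>2 = heron X Y Z * (1 + X + Y) / ((1 + X) * (1 + Y))"
    by (rule m) (use pos in \<open>auto simp: s_def\<close>)
  have m2: "X * s / (1 + X) * (Z * s / (1 + Z)) - (X + Z - Y)\<^sup>2 = heron X Y Z * (1 + X + Z) / ((1 + X) * (1 + Z))"
    using m[of X Z Y] pos by (simp add: s_def heron_def algebra_simps)
  show "X * (2 + X + Y + Z) / (1 + X) * (Y * (2 + X + Y + Z) / (1 + Y)) - (X + Y - Z)\<^sup>2 > 0"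
    using m1 pos heron by (simp add: s_def)
  have m3: "X * s / (1 + X) * (Y + Z - X) + (X + Z - Y) * (X + Y - Z)
     = heron X Y Z / (1 + X)"
    using pos by (simp add: s_def heron_def field_simps power2_eq_square)
  have "(heron X Y Z / (1 + X))\<^sup>2 < heron X Y Z * (1 + X + Y) / ((1 + X) * (1 + Y)) * (heron X Y Z * (1 + X + Z) / ((1 + X) * (1 + Z)))"
  proof -
    have "(1 + Y) * (1 + Z) < (1 + X + Y) * (1 + X + Z)"
      using pos by (intro mult_strict_mono) auto
    then have "1 < (1 + X + Y) * (1 + X + Z) / ((1 + Y) * (1 + Z))"
      using pos by (simp only: less_divide_eq_1_pos mult_pos_pos add_pos_pos zero_less_one)
    then have "(heron X Y Z / (1 + X))\<^sup>2 * 1 < (heron X Y Z / (1 + X))\<^sup>2 * ((1 + X + Y) * (1 + X + Z) / ((1 + Y) * (1 + Z)))"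
      using heron pos by (intro mult_strict_left_mono) auto
    then show ?thesis by (simp add: power2_eq_square mult_ac)
  qed
  then show "(X * (2 + X + Y + Z) / (1 + X) * (Y + Z - X) + (X + Z - Y) * (X + Y - Z))\<^sup>2
    < (X * (2 + X + Y + Z) / (1 + X) * (Y * (2 + X + Y + Z) / (1 + Y)) - (X + Y - Z)\<^sup>2)
      * (X * (2 + X + Y + Z) / (1 + X) * (Z * (2 + X + Y + Z) / (1 + Z)) - (X + Z - Y)\<^sup>2)"
    unfolding m1[unfolded s_def] m2[unfolded s_def] m3[unfolded s_def] .
qed

text \<open>
  The velocities \<open>x, y, z\<close> are the logarithmic derivatives of the hyperbolic sines of the half sides; in terms of these all
  the expressions become rational.
\<close>

definition pseudocos_deriv :: "real \<Rightarrow> real \<Rightarrow> real \<Rightarrow> real \<Rightarrow> real \<Rightarrow> real \<Rightarrow> real" where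
  "pseudocos_deriv a b c x y z =
     ((sinh (b / 2))\<^sup>2 * y + (sinh (c / 2))\<^sup>2 * z - (sinh (a / 2))\<^sup>2 * x)
       / (sinh (b / 2) * sinh (c / 2) * cosh (a / 2))
     - hyperbolic_pseudocos a b c * (y + z + (sinh (a / 2))\<^sup>2 * x / (cosh (a / 2))\<^sup>2)"

lemma pseudocos_has_derivative:
  fixes \<alpha> \<beta> \<gamma> :: "real \<Rightarrow> real"
  assumes der: "(\<alpha> has_real_derivative a') (at t)" "(\<beta> has_real_derivative b') (at t)"
      "(\<gamma> has_real_derivative c') (at t)"
    and pos: "\<alpha> t > 0" "\<beta> t > 0" "\<gamma> t > 0"
  shows "((\<lambda>t. hyperbolic_pseudocos (\<alpha> t) (\<beta> t) (\<gamma> t)) has_real_derivative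
    pseudocos_deriv (\<alpha> t) (\<beta> t) (\<gamma> t) (a' / (2 * tanh (\<alpha> t / 2)))
      (b' / (2 * tanh (\<beta> t / 2))) (c' / (2 * tanh (\<gamma> t / 2)))) (at t)"
proof -
  define A B C H where "A = sinh (\<alpha> t / 2)" and "B = sinh (\<beta> t / 2)" and "C = sinh (\<gamma> t / 2)"
    and "H = cosh (\<alpha> t / 2)"
  define x y z where "x = a' / (2 * tanh (\<alpha> t / 2))" and "y = b' / (2 * tanh (\<beta> t / 2))"
    and "z = c' / (2 * tanh (\<gamma> t / 2))"
  have nz: "A > 0" "B > 0" "C > 0" "H > 0" using pos by (auto simp: A_def B_def C_def H_def)
  have dsinh: "((\<lambda>t. sinh (f t / 2)) has_real_derivative sinh (f t / 2) * (f' / (2 * tanh (f t / 2)))) (at t)"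
    if "(f has_real_derivative f') (at t)" "f t > 0" for f :: "real \<Rightarrow> real" and f'
  proof -
    have "((\<lambda>t. sinh (f t / 2)) has_real_derivative cosh (f t / 2) * (f' / 2)) (at t)"
      by (rule DERIV_chain2) (use that in \<open>auto intro!: derivative_eq_intros\<close>)
    then show ?thesis using that(2) by (simp add: tanh_def mult.commute)
  qed
  have "((\<lambda>t. cosh (\<alpha> t / 2)) has_real_derivative sinh (\<alpha> t / 2) * (a' / 2)) (at t)"
    by (rule DERIV_chain2) (use der in \<open>auto intro!: derivative_eq_intros\<close>)
  moreover have "sinh (\<alpha> t / 2) * (a' / 2) = A\<^sup>2 * x / H"
    using nz by (simp add: A_def H_def x_def tanh_def power2_eq_square)
  ultimately have dcosh: "((\<lambda>t. cosh (\<alpha> t / 2)) has_real_derivative A\<^sup>2 * x / H) (at t)" by simp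
  have ds: "((\<lambda>t. sinh (\<alpha> t / 2)) has_real_derivative A * x) (at t)"
    "((\<lambda>t. sinh (\<beta> t / 2)) has_real_derivative B * y) (at t)"
    "((\<lambda>t. sinh (\<gamma> t / 2)) has_real_derivative C * z) (at t)"
    unfolding A_def B_def C_def x_def y_def z_def using dsinh der pos by auto
  have N: "((\<lambda>t. (sinh (\<beta> t / 2))\<^sup>2 + (sinh (\<gamma> t / 2))\<^sup>2 - (sinh (\<alpha> t / 2))\<^sup>2) has_real_derivative
      2 * (B\<^sup>2 * y + C\<^sup>2 * z - A\<^sup>2 * x)) (at t)"
    by (rule DERIV_cong[OF DERIV_diff[OF DERIV_add[OF DERIV_power[OF ds(2), of 2] DERIV_power[OF ds(3), of 2]]
          DERIV_power[OF ds(1), of 2]]])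
       (simp add: A_def B_def C_def power2_eq_square algebra_simps)
  have D: "((\<lambda>t. 2 * sinh (\<beta> t / 2) * sinh (\<gamma> t / 2) * cosh (\<alpha> t / 2)) has_real_derivative
      2 * B * C * H * (y + z + A\<^sup>2 * x / H\<^sup>2)) (at t)"
    by (rule DERIV_cong[OF DERIV_mult[OF DERIV_mult[OF DERIV_cmult[OF ds(2), of 2] ds(3)] dcosh]])
       (use nz in \<open>simp add: A_def[symmetric] B_def[symmetric] C_def[symmetric] H_def[symmetric]
          field_simps power2_eq_square\<close>)
  have deriv: "((\<lambda>t. hyperbolic_pseudocos (\<alpha> t) (\<beta> t) (\<gamma> t)) has_real_derivative
      (2 * (B\<^sup>2 * y + C\<^sup>2 * z - A\<^sup>2 * x) * (2 * B * C * H)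
       - (B\<^sup>2 + C\<^sup>2 - A\<^sup>2) * (2 * B * C * H * (y + z + A\<^sup>2 * x / H\<^sup>2))) / (2 * B * C * H * (2 * B * C * H))) (at t)"
    unfolding hyperbolic_pseudocos_def
    using DERIV_divide[OF N D] nz by (simp add: A_def B_def C_def H_def)
  have quot: "(2 * N' * K - M * (K * W)) / (K * K) = N' / (K / 2) - M / K * W"
    if "K \<noteq> 0" for N' K M W :: real
    using that by (simp add: field_simps)
  have "pseudocos_deriv (\<alpha> t) (\<beta> t) (\<gamma> t) x y z
    = (B\<^sup>2 * y + C\<^sup>2 * z - A\<^sup>2 * x) / (2 * B * C * H / 2)
      - (B\<^sup>2 + C\<^sup>2 - A\<^sup>2) / (2 * B * C * H) * (y + z + A\<^sup>2 * x / H\<^sup>2)"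
    unfolding pseudocos_deriv_def hyperbolic_pseudocos_def A_def[symmetric] B_def[symmetric]
      C_def[symmetric] H_def[symmetric] by simp
  also have "\<dots> = (2 * (B\<^sup>2 * y + C\<^sup>2 * z - A\<^sup>2 * x) * (2 * B * C * H)
       - (B\<^sup>2 + C\<^sup>2 - A\<^sup>2) * (2 * B * C * H * (y + z + A\<^sup>2 * x / H\<^sup>2))) / (2 * B * C * H * (2 * B * C * H))"
    using nz by (intro quot[symmetric]) simp
  finally show ?thesis
    using deriv unfolding x_def[symmetric] y_def[symmetric] z_def[symmetric] by (simp only:)
qed

lemma pseudocos_form_term:
  assumes "a > 0" "b > 0" "c > 0"
  shows "a' * pseudocos_deriv a b c (a' / (2 * tanh (a / 2))) y z / (tanh (a / 2))\<^sup>2 =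
    (let X = (sinh (a / 2))\<^sup>2; Y = (sinh (b / 2))\<^sup>2; Z = (sinh (c / 2))\<^sup>2; x = a' / (2 * tanh (a / 2))
     in x * (2 * (Y * y + Z * z - X * x) - (Y + Z - X) * (y + z + X * x / (1 + X)))
       / (sinh (a / 2) * sinh (b / 2) * sinh (c / 2)))"
proof -
  define A B C H where "A = sinh (a / 2)" and "B = sinh (b / 2)" and "C = sinh (c / 2)"
    and "H = cosh (a / 2)"
  define x where "x = a' / (2 * tanh (a / 2))"
  have nz: "A > 0" "B > 0" "C > 0" "H > 0" using assms by (auto simp: A_def B_def C_def H_def)
  have tanh: "tanh (a / 2) = A / H" by (simp add: tanh_def A_def H_def)
  have a': "a' = 2 * x * (A / H)" using nz by (simp add: x_def tanh)
  define W where "W = y + z + A\<^sup>2 * x / H\<^sup>2"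
  have "a' * pseudocos_deriv a b c x y z / (tanh (a / 2))\<^sup>2
    = 2 * x * (H / A) * ((B\<^sup>2 * y + C\<^sup>2 * z - A\<^sup>2 * x) / (B * C * H) - (B\<^sup>2 + C\<^sup>2 - A\<^sup>2) / (2 * B * C * H) * W)"
    unfolding pseudocos_deriv_def hyperbolic_pseudocos_def A_def[symmetric] B_def[symmetric]
      C_def[symmetric] H_def[symmetric] W_def[symmetric] tanh
    using nz by (simp add: a' power2_eq_square)
  also have "\<dots> = x * (2 * (B\<^sup>2 * y + C\<^sup>2 * z - A\<^sup>2 * x) - (B\<^sup>2 + C\<^sup>2 - A\<^sup>2) * W) / (A * B * C)"
    using nz by (simp add: field_simps)
  finally show ?thesis
    by (simp add: W_def H_def cosh_sq A_def B_def C_def x_def Let_def)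
qed

text \<open>
  Up to a negative factor the form is the one in \<open>hyperbolic_form\<close>, evaluated at the logarithmic derivatives of
  \<open>sinh (a / 2), sinh (b / 2), sinh (c / 2)\<close>.
\<close>

interpretation hyperbolic: cosine_law "{0<..}" "\<lambda>x. tanh (x / 2)" "\<lambda>x. (1 - (tanh (x / 2))\<^sup>2) / 2"
  hyperbolic_pseudocos
  "\<lambda>a b c a' b' c'. pseudocos_deriv a b c (a' / (2 * tanh (a / 2))) (b' / (2 * tanh (b / 2))) (c' / (2 * tanh (c / 2)))"
  triangle_walls "\<lambda>a b c a' b' c'. a' = 0 \<and> b' = 0 \<and> c' = 0"
proof (unfold_locales, goal_cases)
  case (4 x)
  then show ?case
    by (auto intro!: derivative_eq_intros)
next
  case (5 a b c)
  then have pos: "a > 0" "b > 0" "c > 0" by auto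
  show ?case
    using hyperbolic_sine_law[OF pos] hyperbolic_sine_law[OF pos(2,3,1)]
    by (simp add: heron_rotate mult_ac)
next
  case (6 \<alpha> \<beta> \<gamma> a' b' c' t)
  then show ?case by (intro pseudocos_has_derivative) auto
next
  case (7 a b c a' b' c')
  then have pos: "a > 0" "b > 0" "c > 0" by auto
  define A B C where "A = sinh (a / 2)" and "B = sinh (b / 2)" and "C = sinh (c / 2)"
  define X Y Z where "X = A\<^sup>2" and "Y = B\<^sup>2" and "Z = C\<^sup>2"
  define x y z where "x = a' / (2 * tanh (a / 2))" and "y = b' / (2 * tanh (b / 2))"
    and "z = c' / (2 * tanh (c / 2))"
  have ABC: "A > 0" "B > 0" "C > 0" using pos by (auto simp: A_def B_def C_def)
  then have XYZ: "X > 0" "Y > 0" "Z > 0" by (auto simp: X_def Y_def Z_def)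
  have nz: "x \<noteq> 0 \<or> y \<noteq> 0 \<or> z \<noteq> 0"
    using 7(7) pos by (auto simp: x_def y_def z_def)
  have "1 - (hyperbolic_pseudocos a b c)\<^sup>2 > 0" using 7(4) by (simp add: abs_square_less_1)
  then have heron: "heron X Y Z > 0"
    unfolding hyperbolic_sine_law[OF pos] X_def Y_def Z_def A_def B_def C_def
    by (simp add: zero_less_mult_iff zero_less_divide_iff)
  define Q where "Q = X * (2 + X + Y + Z) / (1 + X) * x\<^sup>2 + Y * (2 + X + Y + Z) / (1 + Y) * y\<^sup>2
    + Z * (2 + X + Y + Z) / (1 + Z) * z\<^sup>2
    - 2 * (X + Y - Z) * x * y - 2 * (X + Z - Y) * x * z - 2 * (Y + Z - X) * y * z"
  have "Q > 0" unfolding Q_def by (rule hyperbolic_form[OF XYZ heron nz])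
  have t1: "a' * pseudocos_deriv a b c x y z / (tanh (a / 2))\<^sup>2
    = x * (2 * (Y * y + Z * z - X * x) - (Y + Z - X) * (y + z + X * x / (1 + X))) / (A * B * C)"
    using pseudocos_form_term[OF pos, of a' y z]
    by (simp add: Let_def A_def B_def C_def X_def Y_def Z_def x_def)
  have t2: "b' * pseudocos_deriv b c a y z x / (tanh (b / 2))\<^sup>2
    = y * (2 * (Z * z + X * x - Y * y) - (Z + X - Y) * (z + x + Y * y / (1 + Y))) / (A * B * C)"
    using pseudocos_form_term[OF pos(2,3,1), of b' z x]
    by (simp add: Let_def A_def B_def C_def X_def Y_def Z_def y_def mult_ac)
  have t3: "c' * pseudocos_deriv c a b z x y / (tanh (c / 2))\<^sup>2
    = z * (2 * (X * x + Y * y - Z * z) - (X + Y - Z) * (x + y + Z * z / (1 + Z))) / (A * B * C)"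
    using pseudocos_form_term[OF pos(3,1,2), of c' x y]
    by (simp add: Let_def A_def B_def C_def X_def Y_def Z_def z_def mult_ac)
  have diag: "P * (2 + P + R) / (1 + P) = 2 * P + (R - P) * (P / (1 + P))" if "P > 0" for P R :: real
    using that by (simp add: field_simps)
  have "x * (2 * (Y * y + Z * z - X * x) - (Y + Z - X) * (y + z + X * x / (1 + X)))
    + y * (2 * (Z * z + X * x - Y * y) - (Z + X - Y) * (z + x + Y * y / (1 + Y)))
    + z * (2 * (X * x + Y * y - Z * z) - (X + Y - Z) * (x + y + Z * z / (1 + Z))) = - Q"
  proof -
    have "X * (2 + X + Y + Z) / (1 + X) = 2 * X + (Y + Z - X) * (X / (1 + X))"
      "Y * (2 + X + Y + Z) / (1 + Y) = 2 * Y + (Z + X - Y) * (Y / (1 + Y))"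
      "Z * (2 + X + Y + Z) / (1 + Z) = 2 * Z + (X + Y - Z) * (Z / (1 + Z))"
      using diag[of X "Y + Z"] diag[of Y "Z + X"] diag[of Z "X + Y"] XYZ by (auto simp: add_ac)
    moreover define \<xi> \<eta> \<zeta> where "\<xi> = X / (1 + X)" and "\<eta> = Y / (1 + Y)" and "\<zeta> = Z / (1 + Z)"
    moreover have "X * x / (1 + X) = \<xi> * x" "Y * y / (1 + Y) = \<eta> * y" "Z * z / (1 + Z) = \<zeta> * z"
      by (auto simp: \<xi>_def \<eta>_def \<zeta>_def)
    ultimately show ?thesis
      unfolding Q_def by (simp only:) (simp add: algebra_simps power2_eq_square)
  qed
  then have "a' * pseudocos_deriv a b c x y z / (tanh (a / 2))\<^sup>2 + b' * pseudocos_deriv b c a y z x / (tanh (b / 2))\<^sup>2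
    + c' * pseudocos_deriv c a b z x y / (tanh (c / 2))\<^sup>2 = - Q / (A * B * C)"
    unfolding t1 t2 t3 by (simp add: add_divide_distrib[symmetric])
  then show ?case using \<open>Q > 0\<close> ABC by (simp add: x_def y_def z_def)
next
  case (8 a b c)
  then have pos: "0 < a" "0 < b" "0 < c" and "a < b + c" "b < a + c" "c < a + b"
    using 8(4)[of 0 "-1" 1 1] 8(4)[of 0 1 "-1" 1] 8(4)[of 0 1 1 "-1"] by (auto simp: triangle_walls_def)
  then have "1 - (hyperbolic_pseudocos a b c)\<^sup>2 > 0"
    unfolding hyperbolic_sine_law[OF pos] using heron_positive[of a b c] by (intro mult_pos_pos divide_pos_pos) auto
  then show ?case by (simp add: abs_square_less_1)
next
  case (9 k p q r a b c a' b' c')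
  then have pos: "0 < a" "0 < b" "0 < c" by auto
  have log_deriv: "(1 - (tanh (x / 2))\<^sup>2) / 2 / tanh (x / 2) = 1 / sinh x" if "x > 0" for x :: real
  proof -
    have "1 - (tanh (x / 2))\<^sup>2 = ((cosh (x / 2))\<^sup>2 - (sinh (x / 2))\<^sup>2) / (cosh (x / 2))\<^sup>2"
      by (simp add: tanh_def power_divide diff_divide_distrib del: hyperbolic_pythagoras)
    then have "1 - (tanh (x / 2))\<^sup>2 = 1 / (cosh (x / 2))\<^sup>2"
      by (simp only: hyperbolic_pythagoras)
    moreover have "sinh x = 2 * sinh (x / 2) * cosh (x / 2)" using sinh_double[of "x / 2"] by simp
    ultimately show ?thesis using that by (simp add: tanh_def power2_eq_square)
  qed
  from 9(1) show ?case
    unfolding triangle_walls_def log_deriv[OF pos(1)] log_deriv[OF pos(2)] log_deriv[OF pos(3)]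
  proof (elim insertE emptyE)
    assume 1: "(k, p, q, r) = (0, -1, 1, 1)"
    then have "a' = b' + c'" using 9 by simp
    then show "0 < p * (1 / sinh a * a'\<^sup>2) + q * (1 / sinh b * b'\<^sup>2) + r * (1 / sinh c * c'\<^sup>2)"
      using hyperbolic_wall[of b c a b' c'] 1 9 pos by auto
  next
    assume 2: "(k, p, q, r) = (0, 1, -1, 1)"
    then have "b' = a' + c'" using 9 by simp
    then show "0 < p * (1 / sinh a * a'\<^sup>2) + q * (1 / sinh b * b'\<^sup>2) + r * (1 / sinh c * c'\<^sup>2)"
      using hyperbolic_wall[of a c b a' c'] 2 9 pos by auto
  next
    assume 3: "(k, p, q, r) = (0, 1, 1, -1)"
    then have "c' = a' + b'" using 9 by simp
    then show "0 < p * (1 / sinh a * a'\<^sup>2) + q * (1 / sinh b * b'\<^sup>2) + r * (1 / sinh c * c'\<^sup>2)"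
      using hyperbolic_wall[of a b c a' b'] 3 9 pos by auto
  qed
qed (auto simp: is_interval_convex_1)

section \<open>Inner angles in the three planes\<close>

lemma polar_norm: "(r * cos A)\<^sup>2 + (r * sin A)\<^sup>2 = r\<^sup>2" for r A :: real
  by (simp add: power_mult_distrib flip: distrib_left)

lemma realizes_three_points:
  assumes "p0 \<in> points K" "p1 \<in> points K" "p2 \<in> points K"
    and "pdist K p1 p2 = len 0" "pdist K p2 p0 = len 1" "pdist K p0 p1 = len 2"
  shows "\<exists>P. realizes K len P"
proof -
  define P where "P i = (if i = 0 then p0 else if i = 1 then p1 else p2)" for i :: 3
  have three: "(3::3) = 0" by simp
  have "realizes K len P"
    using assms unfolding realizes_def forall_3 three by (simp add: P_def)
  then show ?thesis by blast
qed

lemma realization_realizes: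
  assumes "\<exists>P. realizes K (\<lambda>i. l (side_edge t f i)) P"
  shows "realizes K (\<lambda>i. l (side_edge t f i)) (realization K t l f)"
  unfolding realization_def using assms by (rule someI_ex)

lemma realizes_sides:
  assumes "realizes K len P"
  shows "pdist K (P (i + 1)) (P (i + 2)) = len i" "pdist K (P (i + 2)) (P i) = len (i + 1)"
    "pdist K (P i) (P (i + 1)) = len (i + 2)" "P i \<in> points K"
  using assms unfolding realizes_def by (metis index_arith)+

text \<open>
  The first corner is put at the origin, the second one on the first axis, and the third one where the cosine law wants it.
  The other two planes are treated in the same way.
\<close>

lemma euclidean_realizable:
  assumes "euclidean.triangle (len 0) (len 1) (len 2)"
  shows "\<exists>P. realizes E2 len P"
proof -
  define a b c where "a = len 0" and "b = len 1" and "c = len 2"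
  define A where "A = arccos (euclidean_cos a b c)"
  have pos: "a > 0" "b > 0" "c > 0" and "\<bar>euclidean_cos a b c\<bar> < 1"
    using assms euclidean.triangle_nondegenerate[OF assms]
    by (auto simp: euclidean.triangle_def a_def b_def c_def)
  then have "cos A = euclidean_cos a b c" by (simp add: A_def cos_arccos_abs)
  then have cosA: "b\<^sup>2 + c\<^sup>2 - 2 * b * c * cos A = a\<^sup>2"
    using pos by (simp add: euclidean_cos_def)
  have "norm (vector [c - b * cos A, - b * sin A] :: real^2) = a"
  proof -
    have "(c - b * cos A)\<^sup>2 + (- b * sin A)\<^sup>2 = ((b * cos A)\<^sup>2 + (b * sin A)\<^sup>2) + c\<^sup>2 - 2 * b * c * cos A"
      by (simp add: power2_eq_square algebra_simps)
    also have "\<dots> = a\<^sup>2" unfolding polar_norm using cosA by simp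
    finally show ?thesis
      using pos by (simp add: norm_eq_sqrt_inner inner_vec_def sum_2 power2_eq_square)
  qed
  moreover have "(vector [c, 0] :: real^2) - vector [b * cos A, b * sin A] = vector [c - b * cos A, - b * sin A]"
    by (simp add: vec_eq_iff forall_2)
  moreover have "norm (vector [b * cos A, b * sin A] :: real^2) = b"
  proof -
    have "(b * cos A)\<^sup>2 + (b * sin A)\<^sup>2 = b\<^sup>2" by (rule polar_norm)
    then show ?thesis
      using pos by (simp add: norm_eq_sqrt_inner inner_vec_def sum_2 power2_eq_square)
  qed
  moreover have "norm (vector [c, 0] :: real^2) = c"
    using pos by (simp add: norm_eq_sqrt_inner inner_vec_def sum_2)
  ultimately show ?thesis
    by (intro realizes_three_points[of 0 _ "vector [c, 0]" "vector [b * cos A, b * sin A]"])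
       (auto simp: E2_def dist_norm a_def b_def c_def)
qed

lemma euclidean_angle:
  assumes "realizes E2 len P" "len (i + 1) > 0" "len (i + 2) > 0"
  shows "pangle E2 (P i) (P (i + 1)) (P (i + 2)) = arccos (euclidean_cos (len i) (len (i + 1)) (len (i + 2)))"
proof -
  define u v where "u = P (i + 1) - P i" and "v = P (i + 2) - P i"
  have n: "norm (u - v) = len i" "norm v = len (i + 1)" "norm u = len (i + 2)"
    using realizes_sides(1-3)[OF assms(1), of i]
    by (simp_all add: E2_def dist_norm u_def v_def norm_minus_commute)
  have "2 * (u \<bullet> v) = (norm u)\<^sup>2 + (norm v)\<^sup>2 - (norm (u - v))\<^sup>2"
    by (simp add: power2_norm_eq_inner inner_diff inner_commute)
  then have I: "u \<bullet> v = ((len (i + 1))\<^sup>2 + (len (i + 2))\<^sup>2 - (len i)\<^sup>2) / 2"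
    by (simp add: n)
  have "vangle u v = arccos (euclidean_cos (len i) (len (i + 1)) (len (i + 2)))"
    unfolding vangle_def n I by (simp add: euclidean_cos_def mult_ac)
  then show ?thesis by (simp add: E2_def u_def v_def)
qed

lemma inner_angle_euclidean:
  assumes "euclidean.triangle (l (side_edge t f 0)) (l (side_edge t f 1)) (l (side_edge t f 2))"
    and "\<And>i. l (side_edge t f i) > 0"
  shows "inner_angle E2 t l f i = arccos (euclidean_cos (l (side_edge t f i))
    (l (side_edge t f (i + 1))) (l (side_edge t f (i + 2))))"
  unfolding inner_angle_def Let_def
  by (rule euclidean_angle[OF realization_realizes[OF euclidean_realizable]]) (use assms in auto)

lemma spherical_realizable:
  assumes "spherical.triangle (len 0) (len 1) (len 2)"
  shows "\<exists>P. realizes S2 len P"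
proof -
  define a b c where "a = len 0" and "b = len 1" and "c = len 2"
  define A where "A = arccos (spherical_cos a b c)"
  have bounds: "0 < a" "a < pi" "0 < b" "b < pi" "0 < c" "c < pi" and "\<bar>spherical_cos a b c\<bar> < 1"
    using assms spherical.triangle_nondegenerate[OF assms]
    by (auto simp: spherical.triangle_def a_def b_def c_def)
  then have "cos A = spherical_cos a b c" by (simp add: A_def cos_arccos_abs)
  moreover have "sin b > 0" "sin c > 0" using bounds by (auto intro!: sin_gt_zero)
  ultimately have cosA: "cos b * cos c + sin b * sin c * cos A = cos a"
    by (simp add: spherical_cos_def)
  have "(sin b * cos A) * (sin b * cos A) + (sin b * sin A) * (sin b * sin A) = (sin b)\<^sup>2"
    using polar_norm[of "sin b" A] by (simp only: power2_eq_square)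
  then have unit: "cos b * cos b + ((sin b * cos A) * (sin b * cos A) + (sin b * sin A) * (sin b * sin A)) = 1"
    using sin_cos_squared_add[of b] by (simp add: power2_eq_square)
  have unit': "cos c * cos c + sin c * sin c = 1"
    using sin_cos_squared_add[of c] by (simp add: power2_eq_square)
  let ?p = "vector [1, 0, 0] :: real^3" and ?q = "vector [cos c, sin c, 0] :: real^3"
    and ?r = "vector [cos b, sin b * cos A, sin b * sin A] :: real^3"
  have "?r \<bullet> ?r = 1"
    unfolding inner_vec_def sum_3 vector_3 inner_real_def add.assoc by (rule unit)
  moreover have "?q \<bullet> ?q = 1"
    unfolding inner_vec_def sum_3 vector_3 inner_real_def using unit' by (simp only: mult_zero_left add_0_right)
  moreover have "?p \<bullet> ?p = 1" unfolding inner_vec_def sum_3 vector_3 inner_real_def by simp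
  ultimately have norms: "norm ?p = 1" "norm ?q = 1" "norm ?r = 1"
    by (simp_all only: norm_eq_sqrt_inner real_sqrt_one)
  have "?q \<bullet> ?r = cos c * cos b + sin c * (sin b * cos A)" "?r \<bullet> ?p = cos b" "?p \<bullet> ?q = cos c"
    unfolding inner_vec_def sum_3 vector_3 inner_real_def by simp_all
  moreover have "cos c * cos b + sin c * (sin b * cos A) = cos a" using cosA by (simp add: mult_ac)
  ultimately have inners: "arccos (?q \<bullet> ?r) = a" "arccos (?r \<bullet> ?p) = b" "arccos (?p \<bullet> ?q) = c"
    using bounds by (simp_all add: arccos_cos)
  show ?thesis
    by (rule realizes_three_points[of ?p _ ?q ?r])
       (use norms inners in \<open>simp_all add: S2_def a_def b_def c_def\<close>)
qed

lemma spherical_angle: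
  assumes "realizes S2 len P" and len: "\<And>i. 0 < len i" "\<And>i. len i < pi"
  shows "pangle S2 (P i) (P (i + 1)) (P (i + 2)) = arccos (spherical_cos (len i) (len (i + 1)) (len (i + 2)))"
proof -
  define p q r where "p = P i" and "q = P (i + 1)" and "r = P (i + 2)"
  have unit: "norm (P j) = 1" for j using realizes_sides(4)[OF assms(1), of j] by (simp add: S2_def)
  have inner: "x \<bullet> y = cos (arccos (x \<bullet> y))" if "norm x = 1" "norm y = 1" for x y :: "real^3"
    using Cauchy_Schwarz_ineq2[of x y] that by (simp add: cos_arccos_abs)
  have "arccos (q \<bullet> r) = len i" "arccos (r \<bullet> p) = len (i + 1)" "arccos (p \<bullet> q) = len (i + 2)"
    using realizes_sides(1-3)[OF assms(1), of i] by (simp_all add: S2_def p_def q_def r_def)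
  moreover have "norm p = 1" "norm q = 1" "norm r = 1" using unit by (simp_all add: p_def q_def r_def)
  ultimately have "q \<bullet> r = cos (len i)" "r \<bullet> p = cos (len (i + 1))" "p \<bullet> q = cos (len (i + 2))"
    using inner[of q r] inner[of r p] inner[of p q] by simp_all
  then have I: "q \<bullet> r = cos (len i)" "p \<bullet> r = cos (len (i + 1))" "p \<bullet> q = cos (len (i + 2))"
    by (simp_all add: inner_commute)
  have self: "p \<bullet> p = 1" "q \<bullet> q = 1" "r \<bullet> r = 1"
    using unit by (simp_all add: p_def q_def r_def dot_square_norm)
  have n: "norm (y - (p \<bullet> y) *\<^sub>R p) = sin s" if "p \<bullet> y = cos s" "y \<bullet> y = 1" "0 < s" "s < pi" for y s
  proof -
    have "(y - (p \<bullet> y) *\<^sub>R p) \<bullet> (y - (p \<bullet> y) *\<^sub>R p) = 1 - (cos s)\<^sup>2"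
      using that(1,2) self(1) by (simp add: inner_diff inner_commute power2_eq_square)
    also have "\<dots> = (sin s)\<^sup>2" by (simp add: sin_squared_eq)
    finally show ?thesis using that sin_gt_zero[of s] by (simp add: norm_eq_sqrt_inner)
  qed
  have "(q - (p \<bullet> q) *\<^sub>R p) \<bullet> (r - (p \<bullet> r) *\<^sub>R p) = cos (len i) - cos (len (i + 1)) * cos (len (i + 2))"
    using I self by (simp add: inner_diff inner_commute)
  moreover have "norm (q - (p \<bullet> q) *\<^sub>R p) = sin (len (i + 2))" by (rule n[OF I(3) self(2) len])
  moreover have "norm (r - (p \<bullet> r) *\<^sub>R p) = sin (len (i + 1))" by (rule n[OF I(2) self(3) len])
  ultimately have "vangle (q - (p \<bullet> q) *\<^sub>R p) (r - (p \<bullet> r) *\<^sub>R p)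
      = arccos (spherical_cos (len i) (len (i + 1)) (len (i + 2)))"
    unfolding vangle_def spherical_cos_def by (simp only: mult.commute)
  then show ?thesis by (simp add: S2_def p_def q_def r_def)
qed

lemma inner_angle_spherical:
  assumes "spherical.triangle (l (side_edge t f 0)) (l (side_edge t f 1)) (l (side_edge t f 2))"
    and "\<And>i. l (side_edge t f i) > 0" "\<And>i. l (side_edge t f i) < pi"
  shows "inner_angle S2 t l f i = arccos (spherical_cos (l (side_edge t f i))
    (l (side_edge t f (i + 1))) (l (side_edge t f (i + 2))))"
  unfolding inner_angle_def Let_def
  by (rule spherical_angle[OF realization_realizes[OF spherical_realizable]]) (use assms in auto)

definition hyperbolic_cos :: "real \<Rightarrow> real \<Rightarrow> real \<Rightarrow> real" where
  "hyperbolic_cos a b c = (cosh b * cosh c - cosh a) / (sinh b * sinh c)"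

lemma hyperbolic_cos_bound:
  fixes a b c :: real
  assumes "0 < a" "0 < b" "0 < c" "a < b + c" "b < a + c" "c < a + b"
  shows "\<bar>hyperbolic_cos a b c\<bar> < 1"
proof -
  have "cosh a < cosh (b + c)" using assms by (intro cosh_real_strict_mono) auto
  moreover have "cosh \<bar>b - c\<bar> < cosh a" using assms by (intro cosh_real_strict_mono) auto
  ultimately show ?thesis
    using assms by (auto simp: hyperbolic_cos_def abs_less_iff field_simps cosh_add cosh_diff)
qed

lemma hyperbolic_triangle_iff:
  "hyperbolic.triangle a b c \<longleftrightarrow> 0 < a \<and> 0 < b \<and> 0 < c \<and> a < b + c \<and> b < a + c \<and> c < a + b"
  unfolding hyperbolic.triangle_def by (auto simp: triangle_walls_def)

lemma hyperbolic_realizable: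
  assumes "hyperbolic.triangle (len 0) (len 1) (len 2)"
  shows "\<exists>P. realizes H2 len P"
proof -
  define a b c where "a = len 0" and "b = len 1" and "c = len 2"
  define A where "A = arccos (hyperbolic_cos a b c)"
  have pos: "0 < a" "0 < b" "0 < c" and "\<bar>hyperbolic_cos a b c\<bar> < 1"
    using assms hyperbolic_cos_bound[of a b c] unfolding hyperbolic_triangle_iff
    by (auto simp: a_def b_def c_def)
  then have "cos A = hyperbolic_cos a b c" by (simp add: A_def cos_arccos_abs)
  then have cosA: "cosh b * cosh c - sinh b * sinh c * cos A = cosh a"
    using pos by (simp add: hyperbolic_cos_def)
  have "(sinh b * cos A) * (sinh b * cos A) + (sinh b * sin A) * (sinh b * sin A) = (sinh b)\<^sup>2"
    using polar_norm[of "sinh b" A] by (simp only: power2_eq_square)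
  then have unit: "(sinh b * cos A) * (sinh b * cos A) + (sinh b * sin A) * (sinh b * sin A) - cosh b * cosh b = -1"
    using cosh_sq[of b] by (simp add: power2_eq_square)
  have unit': "sinh c * sinh c - cosh c * cosh c = -1"
    using cosh_sq[of c] by (simp add: power2_eq_square)
  let ?p = "vector [0, 0, 1] :: real^3" and ?q = "vector [sinh c, 0, cosh c] :: real^3"
    and ?r = "vector [sinh b * cos A, sinh b * sin A, cosh b] :: real^3"
  have self: "lorentz ?p ?p = -1" "lorentz ?q ?q = -1" "lorentz ?r ?r = -1"
    unfolding lorentz_def vector_3 using unit unit' by simp_all
  have "- lorentz ?q ?r = cosh b * cosh c - sinh b * sinh c * cos A" "- lorentz ?r ?p = cosh b"
    "- lorentz ?p ?q = cosh c"
    unfolding lorentz_def vector_3 by simp_all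
  then have dists: "arcosh (- lorentz ?q ?r) = a" "arcosh (- lorentz ?r ?p) = b" "arcosh (- lorentz ?p ?q) = c"
    unfolding cosA using pos by (simp_all add: arcosh_cosh_real)
  show ?thesis
    by (rule realizes_three_points[of ?p _ ?q ?r])
       (use self dists in \<open>simp_all add: H2_def a_def b_def c_def\<close>)
qed

text \<open>
  Needed to recover \<open>- lorentz x y\<close> from its inverse hyperbolic cosine, which is determined only from \<open>1\<close> on.
\<close>

lemma lorentz_reverse_Cauchy_Schwarz:
  assumes "lorentz x x = -1" "x $ 3 > 0" "lorentz y y = -1" "y $ 3 > 0"
  shows "- lorentz x y \<ge> 1"
proof -
  let ?s = "1 + x $ 1 * y $ 1 + x $ 2 * y $ 2"
  have x: "(x $ 3)\<^sup>2 = 1 + (x $ 1)\<^sup>2 + (x $ 2)\<^sup>2" and y: "(y $ 3)\<^sup>2 = 1 + (y $ 1)\<^sup>2 + (y $ 2)\<^sup>2"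
    using assms(1,3) by (auto simp: lorentz_def power2_eq_square)
  have "(x $ 3 * y $ 3)\<^sup>2 - ?s\<^sup>2 = (x $ 1 - y $ 1)\<^sup>2 + (x $ 2 - y $ 2)\<^sup>2 + (x $ 1 * y $ 2 - x $ 2 * y $ 1)\<^sup>2"
    unfolding power_mult_distrib x y by (simp add: power2_eq_square algebra_simps)
  then have "?s\<^sup>2 \<le> (x $ 3 * y $ 3)\<^sup>2" by (smt (verit) zero_le_power2)
  then have "?s \<le> x $ 3 * y $ 3"
    by (rule power2_le_imp_le) (use assms in simp)
  then show ?thesis by (simp add: lorentz_def)
qed

lemma hyperbolic_angle:
  assumes "realizes H2 len P" and len: "\<And>i. 0 < len i"
  shows "pangle H2 (P i) (P (i + 1)) (P (i + 2)) = arccos (hyperbolic_cos (len i) (len (i + 1)) (len (i + 2)))"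
proof -
  define p q r where "p = P i" and "q = P (i + 1)" and "r = P (i + 2)"
  have pts: "lorentz (P j) (P j) = -1" "P j $ 3 > 0" for j
    using realizes_sides(4)[OF assms(1), of j] by (simp_all add: H2_def)
  have inner: "lorentz (P j) (P k) = - cosh (arcosh (- lorentz (P j) (P k)))" for j k
    using lorentz_reverse_Cauchy_Schwarz[OF pts[of j] pts[of k]] by simp
  have "arcosh (- lorentz q r) = len i" "arcosh (- lorentz r p) = len (i + 1)" "arcosh (- lorentz p q) = len (i + 2)"
    using realizes_sides(1-3)[OF assms(1), of i] by (simp_all add: H2_def p_def q_def r_def)
  then have "lorentz q r = - cosh (len i)" "lorentz r p = - cosh (len (i + 1))" "lorentz p q = - cosh (len (i + 2))"
    using inner[of "i + 1" "i + 2"] inner[of "i + 2" i] inner[of i "i + 1"]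
    unfolding p_def q_def r_def by (simp_all only:)
  then have I: "lorentz q r = - cosh (len i)" "lorentz p r = - cosh (len (i + 1))" "lorentz p q = - cosh (len (i + 2))"
    by (simp_all add: lorentz_def mult.commute)
  have self: "lorentz p p = -1" "lorentz q q = -1" "lorentz r r = -1"
    using pts by (simp_all add: p_def q_def r_def)
  have bilinear: "lorentz (x + lorentz p x *\<^sub>R p) (y + lorentz p y *\<^sub>R p)
      = lorentz x y + lorentz p x * lorentz p y" for x y
  proof -
    have "lorentz (x + lorentz p x *\<^sub>R p) (y + lorentz p y *\<^sub>R p)
      = lorentz x y + 2 * (lorentz p x * lorentz p y) + lorentz p x * lorentz p y * lorentz p p"
      unfolding lorentz_def by (simp add: algebra_simps)
    then show ?thesis by (simp add: self)
  qed
  have n: "sqrt (lorentz (y + lorentz p y *\<^sub>R p) (y + lorentz p y *\<^sub>R p)) = sinh s"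
    if "lorentz p y = - cosh s" "lorentz y y = -1" "0 < s" for y s
    unfolding bilinear using that cosh_sq[of s] by (simp add: power2_eq_square[symmetric])
  have "lorentz_angle (q + lorentz p q *\<^sub>R p) (r + lorentz p r *\<^sub>R p)
      = arccos (hyperbolic_cos (len i) (len (i + 1)) (len (i + 2)))"
    unfolding lorentz_angle_def hyperbolic_cos_def n[OF I(3) self(2) len] n[OF I(2) self(3) len]
    unfolding bilinear unfolding I by (simp add: mult.commute)
  then show ?thesis by (simp add: H2_def p_def q_def r_def)
qed

lemma inner_angle_hyperbolic:
  assumes "hyperbolic.triangle (l (side_edge t f 0)) (l (side_edge t f 1)) (l (side_edge t f 2))"
    and "\<And>i. l (side_edge t f i) > 0"
  shows "inner_angle H2 t l f i = arccos (hyperbolic_cos (l (side_edge t f i))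
    (l (side_edge t f (i + 1))) (l (side_edge t f (i + 2))))"
  unfolding inner_angle_def Let_def
  by (rule hyperbolic_angle[OF realization_realizes[OF hyperbolic_realizable]]) (use assms in auto)

text \<open>
  The half-angle formulas. The roots are kept apart because in products of these quantities for the three angles
  they combine to squares.
\<close>

lemma hyperbolic_half_angle:
  fixes a b c :: real
  defines "s \<equiv> (a + b + c) / 2"
  assumes tri: "0 < a" "0 < b" "0 < c" "a < b + c" "b < a + c" "c < a + b"
  shows "sin (arccos (hyperbolic_cos a b c) / 2) = sqrt (sinh (s - b)) * sqrt (sinh (s - c)) / (sqrt (sinh b) * sqrt (sinh c))"
    and "cos (arccos (hyperbolic_cos a b c) / 2) = sqrt (sinh s) * sqrt (sinh (s - a)) / (sqrt (sinh b) * sqrt (sinh c))"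
proof -
  define \<theta> where "\<theta> = arccos (hyperbolic_cos a b c)"
  have bound: "\<bar>hyperbolic_cos a b c\<bar> < 1" by (rule hyperbolic_cos_bound[OF tri])
  then have \<theta>: "0 < \<theta>" "\<theta> < pi" "cos \<theta> = hyperbolic_cos a b c"
    using arccos_lt_bounded[of "hyperbolic_cos a b c"] by (auto simp: \<theta>_def cos_arccos_abs)
  have sc: "sinh b > 0" "sinh c > 0" using tri by auto
  have prod: "2 * (sinh u * sinh v) = cosh (u + v) - cosh (u - v)" for u v :: real
    by (simp add: cosh_add cosh_diff)
  have "2 * (sinh (s - b) * sinh (s - c)) = cosh a - cosh (b - c)"
  proof -
    have "(s - b) + (s - c) = a" "(s - b) - (s - c) = - (b - c)" by (simp_all add: s_def field_simps)
    then show ?thesis unfolding prod by (simp only: cosh_minus)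
  qed
  then have num: "sinh (s - b) * sinh (s - c) = (sinh b * sinh c - cosh b * cosh c + cosh a) / 2"
    by (simp add: cosh_diff)
  have "(1 - cos \<theta>) / 2 = sinh (s - b) * sinh (s - c) / (sinh b * sinh c)"
    unfolding num \<theta>(3) hyperbolic_cos_def using sc by (simp add: field_simps)
  moreover have "(sin (\<theta> / 2))\<^sup>2 = (1 - cos \<theta>) / 2" using cos_double_sin[of "\<theta> / 2"] by simp
  moreover have "sin (\<theta> / 2) > 0" using \<theta> by (intro sin_gt_zero) auto
  ultimately have "sin (\<theta> / 2) = sqrt (sinh (s - b) * sinh (s - c) / (sinh b * sinh c))"
    by (metis less_imp_le real_sqrt_unique)
  then show "sin (arccos (hyperbolic_cos a b c) / 2) = sqrt (sinh (s - b)) * sqrt (sinh (s - c)) / (sqrt (sinh b) * sqrt (sinh c))"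
    by (simp add: \<theta>_def real_sqrt_mult real_sqrt_divide)
  have "2 * (sinh s * sinh (s - a)) = cosh (b + c) - cosh a"
  proof -
    have "s + (s - a) = b + c" "s - (s - a) = a" by (simp_all add: s_def field_simps)
    then show ?thesis unfolding prod by (simp only:)
  qed
  then have num': "sinh s * sinh (s - a) = (cosh b * cosh c + sinh b * sinh c - cosh a) / 2"
    by (simp add: cosh_add)
  have "(1 + cos \<theta>) / 2 = sinh s * sinh (s - a) / (sinh b * sinh c)"
    unfolding num' \<theta>(3) hyperbolic_cos_def using sc by (simp add: field_simps)
  moreover have "(cos (\<theta> / 2))\<^sup>2 = (1 + cos \<theta>) / 2" using cos_double_cos[of "\<theta> / 2"] by simp
  moreover have "cos (\<theta> / 2) > 0" using \<theta> by (intro cos_gt_zero) auto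
  ultimately have "cos (\<theta> / 2) = sqrt (sinh s * sinh (s - a) / (sinh b * sinh c))"
    by (metis less_imp_le real_sqrt_unique)
  then show "cos (arccos (hyperbolic_cos a b c) / 2) = sqrt (sinh s) * sqrt (sinh (s - a)) / (sqrt (sinh b) * sqrt (sinh c))"
    by (simp add: \<theta>_def real_sqrt_mult real_sqrt_divide)
qed

lemma sinh_add_mult_sinh_diff: "sinh (u + v) * sinh (u - v) = (sinh u)\<^sup>2 - (sinh v)\<^sup>2" for u v :: real
proof -
  have "sinh (u + v) * sinh (u - v) = (sinh u)\<^sup>2 * (cosh v)\<^sup>2 - (cosh u)\<^sup>2 * (sinh v)\<^sup>2"
    by (simp add: sinh_add sinh_diff power2_eq_square algebra_simps)
  then show ?thesis by (simp add: cosh_sq algebra_simps)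
qed

text \<open>
  The left-hand side is \<open>(S * A) * (B + C) - (B * C) * (S - A)\<close>, and the sum, the difference and the products in
  brackets have simple closed forms.
\<close>

lemma pseudocos_numerator:
  fixes x y z :: real
  defines "S \<equiv> sinh (x + y + z)" and "A \<equiv> sinh (y + z - x)" and "B \<equiv> sinh (x + z - y)" and "C \<equiv> sinh (x + y - z)"
  shows "S * A * C + S * A * B - S * B * C + A * B * C
    = 4 * sinh x * cosh y * cosh z * ((sinh y)\<^sup>2 + (sinh z)\<^sup>2 - (sinh x)\<^sup>2)"
proof -
  have SA: "S * A = (sinh (y + z))\<^sup>2 - (sinh x)\<^sup>2"
    using sinh_add_mult_sinh_diff[of "y + z" x] by (simp add: S_def A_def algebra_simps)
  have BC: "B * C = (sinh x)\<^sup>2 - (sinh (y - z))\<^sup>2"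
    using sinh_add_mult_sinh_diff[of x "y - z"] by (simp add: B_def C_def algebra_simps)
  have B_C: "B + C = 2 * sinh x * cosh (y - z)"
    using sinh_add[of x "y - z"] sinh_diff[of x "y - z"] by (simp add: B_def C_def algebra_simps)
  have S_A: "S - A = 2 * sinh x * cosh (y + z)"
    using sinh_add[of "y + z" x] sinh_diff[of "y + z" x] by (simp add: S_def A_def algebra_simps)
  have core: "(sinh (y + z))\<^sup>2 * cosh (y - z) + (sinh (y - z))\<^sup>2 * cosh (y + z)
    = 2 * cosh y * cosh z * ((sinh y)\<^sup>2 + (sinh z)\<^sup>2)"
  proof -
    have "(sinh (y + z))\<^sup>2 * cosh (y - z) + (sinh (y - z))\<^sup>2 * cosh (y + z)
      = 2 * cosh y * cosh z * ((sinh y)\<^sup>2 * (cosh z)\<^sup>2 + (cosh y)\<^sup>2 * (sinh z)\<^sup>2 - 2 * (sinh y)\<^sup>2 * (sinh z)\<^sup>2)"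
      by (simp add: sinh_add sinh_diff cosh_add cosh_diff power2_eq_square algebra_simps)
    then show ?thesis by (simp add: cosh_sq algebra_simps)
  qed
  have "S * A * C + S * A * B - S * B * C + A * B * C = (S * A) * (B + C) - (B * C) * (S - A)"
    by (simp add: algebra_simps)
  also have "\<dots> = 2 * sinh x * (((sinh (y + z))\<^sup>2 * cosh (y - z) + (sinh (y - z))\<^sup>2 * cosh (y + z))
      - (sinh x)\<^sup>2 * (cosh (y - z) + cosh (y + z)))"
    unfolding SA BC B_C S_A by (simp add: algebra_simps)
  also have "cosh (y - z) + cosh (y + z) = 2 * cosh y * cosh z"
    by (simp add: cosh_add cosh_diff)
  finally show ?thesis unfolding core by (simp add: algebra_simps)
qed

text \<open>
  Expanding \<open>sin (\<beta> + \<gamma> - \<alpha>)\<close> for the half angles gives the value of \<open>hyperbolic_pseudocos\<close>. Expanding the cosine shows that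
  it is positive, so that \<open>\<beta> + \<gamma> - \<alpha>\<close> lies in the range where the sine determines it.
\<close>

lemma hyperbolic_pseudoangle:
  fixes a b c :: real
  assumes tri: "0 < a" "0 < b" "0 < c" "a < b + c" "b < a + c" "c < a + b"
  shows "(arccos (hyperbolic_cos b c a) + arccos (hyperbolic_cos c a b) - arccos (hyperbolic_cos a b c)) / 2
    = pi / 2 - arccos (hyperbolic_pseudocos a b c)"
proof -
  define s where "s = (a + b + c) / 2"
  define S A B C where "S = sinh s" and "A = sinh (s - a)" and "B = sinh (s - b)" and "C = sinh (s - c)"
  define \<alpha> \<beta> \<gamma> where "\<alpha> = arccos (hyperbolic_cos a b c) / 2" and "\<beta> = arccos (hyperbolic_cos b c a) / 2"
    and "\<gamma> = arccos (hyperbolic_cos c a b) / 2"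
  have pos: "S > 0" "A > 0" "B > 0" "C > 0" "S > A"
    using tri by (auto simp: S_def A_def B_def C_def s_def)
  have abc: "sinh a > 0" "sinh b > 0" "sinh c > 0" using tri by auto
  define D where "D = sinh a * sinh b * sinh c"
  have D: "D > 0" using abc by (simp add: D_def)
  have perm: "(b + c + a) / 2 = s" "(c + a + b) / 2 = s" by (simp_all add: s_def)
  note H1 = hyperbolic_half_angle[OF tri, folded s_def \<alpha>_def S_def A_def B_def C_def]
  have H2: "sin \<beta> = sqrt C * sqrt A / (sqrt (sinh c) * sqrt (sinh a))"
    "cos \<beta> = sqrt S * sqrt B / (sqrt (sinh c) * sqrt (sinh a))"
    using hyperbolic_half_angle[of b c a] tri unfolding perm \<beta>_def S_def A_def B_def C_def by auto
  have H3: "sin \<gamma> = sqrt A * sqrt B / (sqrt (sinh a) * sqrt (sinh b))"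
    "cos \<gamma> = sqrt S * sqrt C / (sqrt (sinh a) * sqrt (sinh b))"
    using hyperbolic_half_angle[of c a b] tri unfolding perm \<gamma>_def S_def A_def B_def C_def by auto
  define x where "x = \<beta> + \<gamma> - \<alpha>"
  have sinx: "sin x = sin \<beta> * cos \<gamma> * cos \<alpha> + cos \<beta> * sin \<gamma> * cos \<alpha> - cos \<beta> * cos \<gamma> * sin \<alpha> + sin \<beta> * sin \<gamma> * sin \<alpha>"
    unfolding x_def by (simp add: sin_diff sin_add cos_add algebra_simps)
  have cosx: "cos x = cos \<beta> * cos \<gamma> * cos \<alpha> - sin \<beta> * sin \<gamma> * cos \<alpha> + sin \<beta> * cos \<gamma> * sin \<alpha> + cos \<beta> * sin \<gamma> * sin \<alpha>"
    unfolding x_def by (simp add: cos_diff sin_add cos_add algebra_simps)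
  define p q r u v w y where "p = sqrt (sinh a)" and "q = sqrt (sinh b)" and "r = sqrt (sinh c)"
    and "u = sqrt S" and "v = sqrt A" and "w = sqrt B" and "y = sqrt C"
  have roots: "p\<^sup>2 = sinh a" "q\<^sup>2 = sinh b" "r\<^sup>2 = sinh c" "u\<^sup>2 = S" "v\<^sup>2 = A" "w\<^sup>2 = B" "y\<^sup>2 = C"
    using pos abc by (simp_all add: p_def q_def r_def u_def v_def w_def y_def)
  have rpos: "p > 0" "q > 0" "r > 0" "u > 0" "v > 0" "w > 0" "y > 0"
    using pos abc by (simp_all add: p_def q_def r_def u_def v_def w_def y_def)
  note H = H1 H2 H3
  note H' = H[folded p_def q_def r_def u_def v_def w_def y_def]
  have "sin x = (u\<^sup>2 * v\<^sup>2 * y\<^sup>2 + u\<^sup>2 * v\<^sup>2 * w\<^sup>2 - u\<^sup>2 * w\<^sup>2 * y\<^sup>2 + v\<^sup>2 * w\<^sup>2 * y\<^sup>2) / (p\<^sup>2 * q\<^sup>2 * r\<^sup>2)"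
    unfolding sinx H' using rpos by (simp add: field_simps power2_eq_square)
  then have "sin x = (S * A * C + S * A * B - S * B * C + A * B * C) / D"
    by (simp add: roots D_def)
  also have "S * A * C + S * A * B - S * B * C + A * B * C = 4 * sinh (a/2) * cosh (b/2) * cosh (c/2)
      * ((sinh (b/2))\<^sup>2 + (sinh (c/2))\<^sup>2 - (sinh (a/2))\<^sup>2)"
    using pseudocos_numerator[of "a/2" "b/2" "c/2"]
    by (simp add: S_def A_def B_def C_def s_def add_divide_distrib diff_divide_distrib algebra_simps)
  also have "\<dots> / D = hyperbolic_pseudocos a b c"
  proof -
    have "sinh l = 2 * sinh (l/2) * cosh (l/2)" for l :: real using sinh_double[of "l/2"] by simp
    then have "D = (2 * sinh (a/2) * cosh (a/2)) * (2 * sinh (b/2) * cosh (b/2)) * (2 * sinh (c/2) * cosh (c/2))"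
      unfolding D_def by metis
    then have "D = (4 * sinh (a/2) * cosh (b/2) * cosh (c/2)) * (2 * sinh (b/2) * sinh (c/2) * cosh (a/2))"
      by simp
    moreover have "4 * sinh (a/2) * cosh (b/2) * cosh (c/2) \<noteq> 0" using tri by simp
    moreover have "m * n / (m * k) = n / k" if "m \<noteq> 0" for m n k :: real using that by simp
    ultimately show ?thesis unfolding hyperbolic_pseudocos_def by metis
  qed
  finally have sin_eq: "sin x = hyperbolic_pseudocos a b c" .
  have "cos x = u * v * w * y * (u\<^sup>2 - v\<^sup>2 + w\<^sup>2 + y\<^sup>2) / (p\<^sup>2 * q\<^sup>2 * r\<^sup>2)"
    unfolding cosx H' using rpos by (simp add: field_simps power2_eq_square)
  then have "cos x = u * v * w * y * (S - A + B + C) / D"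
    by (simp add: roots D_def)
  then have cos_pos: "cos x > 0" using rpos pos D by simp
  have "0 < \<alpha>" "\<alpha> < pi/2" "0 < \<beta>" "\<beta> < pi/2" "0 < \<gamma>" "\<gamma> < pi/2"
    using arccos_lt_bounded[of "hyperbolic_cos a b c"] arccos_lt_bounded[of "hyperbolic_cos b c a"]
      arccos_lt_bounded[of "hyperbolic_cos c a b"] hyperbolic_cos_bound[of a b c]
      hyperbolic_cos_bound[of b c a] hyperbolic_cos_bound[of c a b] tri
    by (auto simp: \<alpha>_def \<beta>_def \<gamma>_def abs_less_iff)
  then have range: "- (pi / 2) < x" "x < pi" by (auto simp: x_def)
  \<comment> \<open>The sines and cosines of the half angles only give \<open>x < pi\<close> at once.\<close>
  have "x < pi / 2"
  proof (rule ccontr)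
    assume "\<not> x < pi / 2"
    then have "cos x \<le> cos (pi / 2)" using range by (intro cos_monotone_0_pi_le) auto
    with cos_pos show False by simp
  qed
  then have "arccos (cos (pi / 2 - x)) = pi / 2 - x" using range by (intro arccos_cos) auto
  then have "arccos (sin x) = pi / 2 - x" by (simp add: cos_diff)
  then show ?thesis
    unfolding sin_eq by (simp add: x_def \<alpha>_def \<beta>_def \<gamma>_def add_divide_distrib diff_divide_distrib)
qed

section \<open>Connectedness of the surface\<close>

lemma glued_rtrancl_preserves_faces:
  assumes "(p, p') \<in> (glued t)\<^sup>*" "fst p \<in> F"
    and closed: "\<And>f g i j. f \<in> F \<Longrightarrow> g \<in> faces t \<Longrightarrow> side_edge t f i = side_edge t g j \<Longrightarrow> g \<in> F"
  shows "fst p' \<in> F"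
  using assms(1,2)
proof (induction rule: rtrancl_induct)
  case (step y z)
  then show ?case using closed by (fastforce simp: glued_def)
qed

lemma glued_sym: "sym (glued t)"
  by (rule symI) (auto simp: glued_def; metis)

text \<open>
  The images of the faces in \<open>F\<close> and of the others are saturated and open in the quotient, disjoint, and cover \<open>S\<close>.
\<close>

lemma faces_connected:
  assumes surf: "closed_triangulated_surface S t" and conn: "connected_space S"
    and F: "F \<subseteq> faces t" "F \<noteq> {}"
    and closed: "\<And>f g i j. f \<in> F \<Longrightarrow> g \<in> faces t \<Longrightarrow> side_edge t f i = side_edge t g j \<Longrightarrow> g \<in> F"
  shows "F = faces t"
proof (rule ccontr)
  assume "F \<noteq> faces t"
  let ?X = "disjoint_triangles t" and ?\<Delta> = standard_triangle
  obtain q where q: "quotient_map ?X S q"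
    and eq: "\<And>p p'. p \<in> topspace ?X \<Longrightarrow> p' \<in> topspace ?X \<Longrightarrow> q p = q p' \<longleftrightarrow> (p, p') \<in> (glued t)\<^sup>*"
    using surf unfolding closed_triangulated_surface_def by blast
  have top: "topspace ?X = faces t \<times> ?\<Delta>" by (simp add: disjoint_triangles_def)
  have sat: "{p \<in> topspace ?X. q p \<in> q ` (G \<times> ?\<Delta>)} = G \<times> ?\<Delta>"
    if G: "G \<subseteq> faces t" "\<And>p p'. p \<in> G \<times> ?\<Delta> \<Longrightarrow> p' \<in> topspace ?X \<Longrightarrow> (p, p') \<in> (glued t)\<^sup>* \<Longrightarrow> fst p' \<in> G" for G
  proof
    show "G \<times> ?\<Delta> \<subseteq> {p \<in> topspace ?X. q p \<in> q ` (G \<times> ?\<Delta>)}" using G(1) top by auto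
    show "{p \<in> topspace ?X. q p \<in> q ` (G \<times> ?\<Delta>)} \<subseteq> G \<times> ?\<Delta>"
    proof
      fix p' assume "p' \<in> {p \<in> topspace ?X. q p \<in> q ` (G \<times> ?\<Delta>)}"
      then obtain p where p: "p \<in> G \<times> ?\<Delta>" "q p = q p'" "p' \<in> topspace ?X" by auto
      moreover have "p \<in> topspace ?X" using p(1) G(1) top by auto
      ultimately have "fst p' \<in> G" using G(2) eq by blast
      then show "p' \<in> G \<times> ?\<Delta>" using p(3) top by (auto simp: mem_Times_iff)
    qed
  qed
  have "open": "openin ?X (G \<times> ?\<Delta>)" if "G \<subseteq> faces t" for G
    unfolding disjoint_triangles_def openin_prod_Times_iff using that by auto
  have openq: "openin S (q ` (G \<times> ?\<Delta>))"
    if "G \<subseteq> faces t" "\<And>p p'. p \<in> G \<times> ?\<Delta> \<Longrightarrow> p' \<in> topspace ?X \<Longrightarrow> (p, p') \<in> (glued t)\<^sup>* \<Longrightarrow> fst p' \<in> G" for G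
  proof -
    have "openin ?X {p \<in> topspace ?X. q p \<in> U} = openin S U" if "U \<subseteq> topspace S" for U
      using q that by (simp add: quotient_map_def)
    moreover have "q ` (G \<times> ?\<Delta>) \<subseteq> topspace S" using q that(1) top by (auto simp: quotient_map_def)
    ultimately have "openin ?X {p \<in> topspace ?X. q p \<in> q ` (G \<times> ?\<Delta>)} = openin S (q ` (G \<times> ?\<Delta>))"
      by blast
    moreover have "{p \<in> topspace ?X. q p \<in> q ` (G \<times> ?\<Delta>)} = G \<times> ?\<Delta>"
      by (rule sat) (use that in blast)+
    ultimately show ?thesis using "open"[OF that(1)] by simp
  qed
  let ?F' = "faces t - F"
  have stay: "fst p' \<in> F" if "p \<in> F \<times> ?\<Delta>" "(p, p') \<in> (glued t)\<^sup>*" for p p'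
    using glued_rtrancl_preserves_faces[OF that(2), of F] that(1) closed by auto
  have stay': "fst p' \<in> ?F'" if "p \<in> ?F' \<times> ?\<Delta>" "p' \<in> topspace ?X" "(p, p') \<in> (glued t)\<^sup>*" for p p'
  proof (rule ccontr)
    assume "fst p' \<notin> ?F'"
    then have "p' \<in> F \<times> ?\<Delta>" using that(2) top by (auto simp: mem_Times_iff)
    moreover have "(p', p) \<in> (glued t)\<^sup>*" using that(3) sym_rtrancl[OF glued_sym] by (rule symD[rotated])
    ultimately have "fst p \<in> F" by (rule stay)
    with that(1) show False by auto
  qed
  have "(vector [1, 0, 0] :: real^3) \<in> ?\<Delta>"
    unfolding standard_triangle_def sum_3 mem_Collect_eq forall_3 vector_3 by simp
  then have ne: "?\<Delta> \<noteq> {}" by blast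
  have "openin S (q ` (F \<times> ?\<Delta>))" by (rule openq[OF F(1)]) (rule stay)
  moreover have "openin S (q ` (?F' \<times> ?\<Delta>))" by (rule openq[OF Diff_subset]) (rule stay')
  moreover have "topspace S \<subseteq> q ` (F \<times> ?\<Delta>) \<union> q ` (?F' \<times> ?\<Delta>)"
  proof -
    have "F \<times> ?\<Delta> \<union> ?F' \<times> ?\<Delta> = topspace ?X" using top F(1) by auto
    moreover have "q ` topspace ?X = topspace S" using q by (simp add: quotient_map_def)
    ultimately show ?thesis by (metis image_Un order_refl)
  qed
  moreover have "q ` (F \<times> ?\<Delta>) \<inter> q ` (?F' \<times> ?\<Delta>) = {}"
  proof (rule ccontr)
    assume "q ` (F \<times> ?\<Delta>) \<inter> q ` (?F' \<times> ?\<Delta>) \<noteq> {}"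
    then obtain p p' where pp: "p \<in> F \<times> ?\<Delta>" "p' \<in> ?F' \<times> ?\<Delta>" "q p = q p'" by auto
    then have "(p, p') \<in> (glued t)\<^sup>*" using eq[of p p'] top F(1) by auto
    then show False using stay[OF pp(1)] pp(2) by auto
  qed
  moreover have "q ` (F \<times> ?\<Delta>) \<noteq> {}" "q ` (?F' \<times> ?\<Delta>) \<noteq> {}"
    using F \<open>F \<noteq> faces t\<close> ne by auto
  ultimately show False using conn unfolding connected_space_def by blast
qed

section \<open>Curvatures determine the metric\<close>

lemma triangle_metric_sides:
  assumes "triangle_metric t l" "f \<in> faces t"
  shows "l (side_edge t f i) > 0"
    "l (side_edge t f 0) < l (side_edge t f 1) + l (side_edge t f 2)"
    "l (side_edge t f 1) < l (side_edge t f 2) + l (side_edge t f 0)"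
    "l (side_edge t f 2) < l (side_edge t f 0) + l (side_edge t f 1)"
proof -
  have *: "l (side_edge t f i) < l (side_edge t f (i + 1)) + l (side_edge t f (i + 2))" for i
    using assms unfolding triangle_metric_def by blast
  show "l (side_edge t f 0) < l (side_edge t f 1) + l (side_edge t f 2)" using *[of 0] unfolding index_values .
  show "l (side_edge t f 1) < l (side_edge t f 2) + l (side_edge t f 0)" using *[of 1] unfolding index_values .
  show "l (side_edge t f 2) < l (side_edge t f 0) + l (side_edge t f 1)" using *[of 2] unfolding index_values .
  show "l (side_edge t f i) > 0" using assms unfolding triangle_metric_def edges_def by blast
qed

lemma euclidean_metric_face:
  assumes "euclidean_polyhedral_metric t l" "f \<in> faces t"
  shows "euclidean.triangle_face t l f"
    and "inner_angle E2 t l f i = euclidean.angle t l f i"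
proof -
  note T = triangle_metric_sides[OF assms(1)[unfolded euclidean_polyhedral_metric_def] assms(2)]
  show tri: "euclidean.triangle_face t l f"
    using T unfolding euclidean.triangle_face_def euclidean.triangle_def by (auto simp: triangle_walls_def)
  show "inner_angle E2 t l f i = euclidean.angle t l f i"
    unfolding euclidean.angle_def by (rule inner_angle_euclidean[OF tri[unfolded euclidean.triangle_face_def] T(1)])
qed

lemma spherical_metric_face:
  assumes "spherical_polyhedral_metric t l" "f \<in> faces t"
  shows "spherical.triangle_face t l f"
    and "inner_angle S2 t l f i = spherical.angle t l f i"
proof -
  have "triangle_metric t l" using assms(1) by (simp add: spherical_polyhedral_metric_def)
  note T = triangle_metric_sides[OF this assms(2)]
  have per: "l (side_edge t f 0) + l (side_edge t f 1) + l (side_edge t f 2) < 2 * pi"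
    using assms unfolding spherical_polyhedral_metric_def sum_index by simp
  have "l (side_edge t f 0) < pi" "l (side_edge t f 1) < pi" "l (side_edge t f 2) < pi" using T(2-4) per by auto
  then have less: "\<forall>i. l (side_edge t f i) < pi" unfolding all_index by simp
  show tri: "spherical.triangle_face t l f"
    using T per less unfolding spherical.triangle_face_def spherical.triangle_def by (auto simp: triangle_walls_def)
  show "inner_angle S2 t l f i = spherical.angle t l f i"
    unfolding spherical.angle_def
    by (rule inner_angle_spherical[OF tri[unfolded spherical.triangle_face_def] T(1)]) (use less in simp)
qed

lemma hyperbolic_metric_face:
  assumes "hyperbolic_polyhedral_metric t l" "f \<in> faces t"
  shows "hyperbolic.triangle_face t l f"
    and "(inner_angle H2 t l f (i + 1) + inner_angle H2 t l f (i + 2) - inner_angle H2 t l f i) / 2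
      = pi / 2 - hyperbolic.angle t l f i"
    and "0 < hyperbolic.angle t l f i" "hyperbolic.angle t l f i < pi"
proof -
  have metric: "triangle_metric t l" using assms(1) by (simp add: hyperbolic_polyhedral_metric_def)
  note T = triangle_metric_sides[OF metric assms(2)]
  show tri: "hyperbolic.triangle_face t l f"
    using T unfolding hyperbolic.triangle_face_def hyperbolic_triangle_iff by auto
  let ?l = "\<lambda>j. l (side_edge t f j)"
  have ang: "inner_angle H2 t l f j = arccos (hyperbolic_cos (?l j) (?l (j + 1)) (?l (j + 2)))" for j
    by (rule inner_angle_hyperbolic[OF tri[unfolded hyperbolic.triangle_face_def] T(1)])
  have "?l j < ?l (j + 1) + ?l (j + 2)" for j
    using metric assms(2) unfolding triangle_metric_def by blast
  note this[of i] this[of "i + 1", unfolded index_arith] this[of "i + 2", unfolded index_arith]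
  then have ineq: "?l i < ?l (i + 1) + ?l (i + 2)" "?l (i + 1) < ?l i + ?l (i + 2)" "?l (i + 2) < ?l i + ?l (i + 1)"
    by linarith+
  show "(inner_angle H2 t l f (i + 1) + inner_angle H2 t l f (i + 2) - inner_angle H2 t l f i) / 2
      = pi / 2 - hyperbolic.angle t l f i"
    unfolding ang index_arith hyperbolic.angle_def by (rule hyperbolic_pseudoangle[OF T(1) T(1) T(1) ineq])
  have "\<bar>hyperbolic_pseudocos (?l i) (?l (i + 1)) (?l (i + 2))\<bar> < 1"
    by (rule hyperbolic.triangle_nondegenerate) (use T(1) ineq in \<open>simp add: hyperbolic_triangle_iff\<close>)
  then show "0 < hyperbolic.angle t l f i" "hyperbolic.angle t l f i < pi"
    using arccos_lt_bounded unfolding hyperbolic.angle_def by (auto simp: abs_less_iff)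
qed

lemma phi_eq:
  assumes "\<And>f i. f \<in> faces t \<Longrightarrow> inner_angle K t l f i = \<theta> f i"
  shows "phi K t h l e = (\<Sum>(f, i)\<in>sides_of t e. sin_power_integral h (\<theta> f i))"
  unfolding phi_def sin_power_integral_def
  by (rule sum.cong) (auto simp: sides_of_def assms)

lemma psi_eq:
  assumes "hyperbolic_polyhedral_metric t l"
  shows "psi H2 t h l e = - (\<Sum>(f, i)\<in>sides_of t e. sin_power_integral h (hyperbolic.angle t l f i))"
  unfolding psi_def sum_negf[symmetric]
proof (rule sum.cong[OF refl], clarify)
  fix f i assume "(f, i) \<in> sides_of t e"
  then have "f \<in> faces t" by (simp add: sides_of_def)
  note H = hyperbolic_metric_face(2-4)[OF assms this, of i]
  show "(LBINT s=ereal 0..ereal ((inner_angle H2 t l f (i + 1) + inner_angle H2 t l f (i + 2)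
      - inner_angle H2 t l f i) / 2). cos s powr h) = - sin_power_integral h (hyperbolic.angle t l f i)"
    unfolding H(1) using H(2,3) by (subst cos_power_integral) auto
qed

theorem theorem1p2:
  fixes S :: "'a topology" and T :: "('f, 'e) triangulation" and h :: real
  assumes "closed_triangulated_surface S T" and "connected_space S"
  shows "(\<forall>l l'. euclidean_polyhedral_metric T l \<and> euclidean_polyhedral_metric T l' \<and>
            (\<forall>e\<in>edges T. phi E2 T h l e = phi E2 T h l' e) \<longrightarrow>
            (\<exists>c>0. \<forall>e\<in>edges T. l' e = c * l e)) \<and>
         (\<forall>l l'. spherical_polyhedral_metric T l \<and> spherical_polyhedral_metric T l' \<and>
            (\<forall>e\<in>edges T. phi S2 T h l e = phi S2 T h l' e) \<longrightarrow>
            (\<forall>e\<in>edges T. l e = l' e)) \<and>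
         (\<forall>l l'. hyperbolic_polyhedral_metric T l \<and> hyperbolic_polyhedral_metric T l' \<and>
            (\<forall>e\<in>edges T. psi H2 T h l e = psi H2 T h l' e) \<longrightarrow>
            (\<forall>e\<in>edges T. l e = l' e))"
proof (intro conjI allI impI)
  have fin: "finite (faces T)" and ne: "faces T \<noteq> {}"
    using assms(1) by (auto simp: closed_triangulated_surface_def)
  {
    fix l l'
    assume A: "euclidean_polyhedral_metric T l \<and> euclidean_polyhedral_metric T l' \<and>
      (\<forall>e\<in>edges T. phi E2 T h l e = phi E2 T h l' e)"
    then have m: "euclidean_polyhedral_metric T l" "euclidean_polyhedral_metric T l'" by auto
    have same: "(\<Sum>(f, i)\<in>sides_of T e. sin_power_integral h (euclidean.angle T l f i))
      = (\<Sum>(f, i)\<in>sides_of T e. sin_power_integral h (euclidean.angle T l' f i))" if "e \<in> edges T" for e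
      using A that phi_eq[of T E2 l "euclidean.angle T l" h e] phi_eq[of T E2 l' "euclidean.angle T l'" h e]
        euclidean_metric_face(2)[OF m(1)] euclidean_metric_face(2)[OF m(2)] by simp
    have sim: "\<exists>c>0. \<forall>i. l' (side_edge T f i) = c * l (side_edge T f i)" if "f \<in> faces T" for f
      by (rule euclidean_faces_similar[OF fin _ _ same that]) (use m euclidean_metric_face(1) in auto)
    obtain f0 where f0: "f0 \<in> faces T" using ne by blast
    obtain c where c: "c > 0" "\<forall>i. l' (side_edge T f0 i) = c * l (side_edge T f0 i)" using sim[OF f0] by blast
    \<comment> \<open>The faces which are scaled by the same factor as \<open>f0\<close>.\<close>
    define F where "F = {f \<in> faces T. \<forall>i. l' (side_edge T f i) = c * l (side_edge T f i)}"
    have "F = faces T"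
    proof (rule faces_connected[OF assms])
      show "F \<subseteq> faces T" "F \<noteq> {}" using f0 c by (auto simp: F_def)
      fix f g i j assume f: "f \<in> F" and g: "g \<in> faces T" and e: "side_edge T f i = side_edge T g j"
      obtain d where d: "\<forall>i. l' (side_edge T g i) = d * l (side_edge T g i)" using sim[OF g] by blast
      have "l (side_edge T g j) > 0"
        using triangle_metric_sides(1)[of T l g j] m(1) g by (simp add: euclidean_polyhedral_metric_def)
      moreover have "d * l (side_edge T g j) = c * l (side_edge T g j)"
        using d f e unfolding F_def by (metis (mono_tags, lifting) mem_Collect_eq)
      ultimately have "d = c" by simp
      then show "g \<in> F" using g d by (simp add: F_def)
    qed
    then have "\<forall>e\<in>edges T. l' e = c * l e" by (auto simp: edges_def F_def)
    then show "\<exists>c>0. \<forall>e\<in>edges T. l' e = c * l e" using c(1) by blast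
  next
    fix l l'
    assume A: "spherical_polyhedral_metric T l \<and> spherical_polyhedral_metric T l' \<and>
      (\<forall>e\<in>edges T. phi S2 T h l e = phi S2 T h l' e)"
    then have m: "spherical_polyhedral_metric T l" "spherical_polyhedral_metric T l'" by auto
    have same: "(\<Sum>(f, i)\<in>sides_of T e. sin_power_integral h (spherical.angle T l f i))
      = (\<Sum>(f, i)\<in>sides_of T e. sin_power_integral h (spherical.angle T l' f i))" if "e \<in> edges T" for e
      using A that phi_eq[of T S2 l "spherical.angle T l" h e] phi_eq[of T S2 l' "spherical.angle T l'" h e]
        spherical_metric_face(2)[OF m(1)] spherical_metric_face(2)[OF m(2)] by simp
    show "\<forall>e\<in>edges T. l e = l' e"
    proof
      fix e assume "e \<in> edges T"
      show "l e = l' e"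
        by (rule spherical.rigidity[of "ereal 0" "ereal pi", OF _ _ _ fin _ _ same \<open>e \<in> edges T\<close>])
           (use m spherical_metric_face(1) in auto)
    qed
  next
    fix l l'
    assume A: "hyperbolic_polyhedral_metric T l \<and> hyperbolic_polyhedral_metric T l' \<and>
      (\<forall>e\<in>edges T. psi H2 T h l e = psi H2 T h l' e)"
    then have m: "hyperbolic_polyhedral_metric T l" "hyperbolic_polyhedral_metric T l'" by auto
    have same: "(\<Sum>(f, i)\<in>sides_of T e. sin_power_integral h (hyperbolic.angle T l f i))
      = (\<Sum>(f, i)\<in>sides_of T e. sin_power_integral h (hyperbolic.angle T l' f i))" if "e \<in> edges T" for e
      using A that psi_eq[OF m(1), of h e] psi_eq[OF m(2), of h e] by simp
    show "\<forall>e\<in>edges T. l e = l' e"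
    proof
      fix e assume "e \<in> edges T"
      show "l e = l' e"
        by (rule hyperbolic.rigidity[of "ereal 0" \<infinity>, OF _ _ _ fin _ _ same \<open>e \<in> edges T\<close>])
           (use m hyperbolic_metric_face(1) in auto)
    qed
  }
qed

end
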